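(* Let $G$ be a graph with base vertex $v_*$, let $\mathcal B$ be a collection of circuits of $G$, and let $K$ be the 2-cell complex obtained from $G$ (viewed as a 1-dimensional cell complex) by attaching a disc along each circuit of $\mathcal B$. Then $\pi_1(G,\mathcal B)$ is isomorphic to the fundamental group of the topological space $K$ (based at $v_*$). In particular, the fundamental group $\pi_1(G)$ is isomorphic to the fundamental group of the space obtained by attaching a disc to each triangle and square (circuit of length 3 or 4) of $G$.
   Context: Graphs are simple and undirected, $G=(V,E)$; $a\sim b$ means adjacency. A circuit $(x_1,\dots,x_n)$ is a simple closed walk (simple cycle, $n\ge3$); it may be written starting at any of its vertices and in either direction. A based loop is a map $\phi:\{0,\dots,n\}\to V$ ($n\ge0$) with $\phi(0)=\phi(n)=v_*$ and, for each $i$, $\phi(i)=\phi(i+1)$ or $\phi(i)\sim\phi(i+1)$; its word is $\phi(0),\dots,\phi(n)$. $\pi_1(G,\mathcal B)$ is the group (under concatenation) of equivalence classes of based loops, where two loops are equivalent if the word of one can be obtained from that of the other by finitely many of the following transformations and their inverses (dots denote unchanged parts): 1. $\dots av_1\dots v_ib\dots\mapsto\dots aw_1\dots w_jb\dots$ where $(a,v_1,\dots,v_i,b,w_j,\dots,w_1)$ is a circuit from $\mathcal B$ ($i,j\ge0$); 2. $\dots aba\dots\mapsto\dots a\dots$ if $a\sim b$; 3. $\dots aa\dots\mapsto\dots a\dots$. $\pi_1(G)$ (the fundamental group of Grigor'yan, Lin, Muranov and Yau) is the group of equivalence classes of based loops with respect to the transformations (and inverses): $\dots abc\dots\mapsto\dots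 ac\dots$ for $(a,b,c)$ a triangle; $\dots abc\dots\mapsto\dots adc\dots$ and $\dots abcd\dots\mapsto\dots ad\dots$ for $(a,b,c,d)$ a square; $\dots aba\dots\mapsto\dots a\dots$ for $a\sim b$; $\dots aa\dots\mapsto\dots a\dots$. It coincides with $\pi_1(G,\mathcal B)$ for $\mathcal B$ the set of all triangles and squares. *)

theory Defs
  imports "HOL-Analysis.Analysis" "HOL-Algebra.Group"
begin

section \<open>Graphs and circuits\<close>

definition simple_graph :: "'a set \<Rightarrow> 'a set set \<Rightarrow> bool" where
  "simple_graph V E \<longleftrightarrow> (\<forall>e\<in>E. e \<subseteq> V \<and> card e = 2)"

definition is_circuit :: "'a set \<Rightarrow> 'a set set \<Rightarrow> 'a list \<Rightarrow> bool" where
  "is_circuit V E xs \<longleftrightarrow>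
     3 \<le> length xs \<and> distinct xs \<and> set xs \<subseteq> V \<and>
     (\<forall>i<length xs. {xs ! i, xs ! (Suc i mod length xs)} \<in> E)"

text \<open>A circuit has no preferred starting vertex or direction, so it is the set of all the
  words that represent it. In particular a set of circuits never contains the same circuit
  twice.\<close>

definition circuit_of :: "'a list \<Rightarrow> 'a list set" where
  "circuit_of xs = (\<Union>k. {rotate k xs, rotate k (rev xs)})"

definition circuits :: "'a set \<Rightarrow> 'a set set \<Rightarrow> 'a list set set" where
  "circuits V E = circuit_of ` {xs. is_circuit V E xs}"

definition triangles_and_squares :: "'a set \<Rightarrow> 'a set set \<Rightarrow> 'a list set set" where
  "triangles_and_squares V E =
     circuit_of ` {xs. is_circuit V E xs \<and> (length xs = 3 \<or> length xs = 4)}"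


section \<open>Combinatorial fundamental groups\<close>

text \<open>A based loop \<open>\<phi> : {0, \<dots>, n} \<rightarrow> V\<close> is given by its word, a list of length \<open>n + 1\<close>.\<close>

definition based_loops :: "'a set \<Rightarrow> 'a set set \<Rightarrow> 'a \<Rightarrow> 'a list set" where
  "based_loops V E v =
     {w. w \<noteq> [] \<and> set w \<subseteq> V \<and> hd w = v \<and> last w = v \<and>
         (\<forall>i. Suc i < length w \<longrightarrow> w ! i = w ! Suc i \<or> {w ! i, w ! Suc i} \<in> E)}"

definition loop_equiv ::
  "'a set \<Rightarrow> 'a set set \<Rightarrow> 'a \<Rightarrow> ('a list \<Rightarrow> 'a list \<Rightarrow> bool) \<Rightarrow> ('a list \<times> 'a list) set" where
  "loop_equiv V E v step =
     {(u, w). u \<in> based_loops V E v \<and> w \<in> based_loops V E v \<and> equivclp step u w}"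

definition loop_class_group ::
  "'a set \<Rightarrow> 'a set set \<Rightarrow> 'a \<Rightarrow> ('a list \<Rightarrow> 'a list \<Rightarrow> bool) \<Rightarrow> 'a list set monoid" where
  "loop_class_group V E v step =
     \<lparr>carrier = based_loops V E v // loop_equiv V E v step,
      mult = (\<lambda>X Y. \<Union>u\<in>X. \<Union>w\<in>Y. loop_equiv V E v step `` {u @ tl w}),
      one = loop_equiv V E v step `` {[v]}\<rparr>"

inductive circuit_step :: "'a set set \<Rightarrow> 'a list set set \<Rightarrow> 'a list \<Rightarrow> 'a list \<Rightarrow> bool"
  for E :: "'a set set" and B :: "'a list set set" where
  circuit: "\<lbrakk>C \<in> B; [a] @ vs @ [b] @ rev ws \<in> C\<rbrakk> \<Longrightarrow>
     circuit_step E B (p @ [a] @ vs @ [b] @ q) (p @ [a] @ ws @ [b] @ q)"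
| backtrack: "{a, b} \<in> E \<Longrightarrow> circuit_step E B (p @ [a, b, a] @ q) (p @ [a] @ q)"
| stutter: "circuit_step E B (p @ [a, a] @ q) (p @ [a] @ q)"

definition circuit_group :: "'a set \<Rightarrow> 'a set set \<Rightarrow> 'a list set set \<Rightarrow> 'a \<Rightarrow> 'a list set monoid" where
  "circuit_group V E B v = loop_class_group V E v (circuit_step E B)"

text \<open>The fundamental group of a graph in the sense of Grigor'yan, Lin, Muranov and Yau.\<close>

inductive glmy_step :: "'a set \<Rightarrow> 'a set set \<Rightarrow> 'a list \<Rightarrow> 'a list \<Rightarrow> bool"
  for V :: "'a set" and E :: "'a set set" where
  triangle: "is_circuit V E [a, b, c] \<Longrightarrow> glmy_step V E (p @ [a, b, c] @ q) (p @ [a, c] @ q)"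
| square: "is_circuit V E [a, b, c, d] \<Longrightarrow>
     glmy_step V E (p @ [a, b, c] @ q) (p @ [a, d, c] @ q)"
| square_short: "is_circuit V E [a, b, c, d] \<Longrightarrow>
     glmy_step V E (p @ [a, b, c, d] @ q) (p @ [a, d] @ q)"
| backtrack: "{a, b} \<in> E \<Longrightarrow> glmy_step V E (p @ [a, b, a] @ q) (p @ [a] @ q)"
| stutter: "glmy_step V E (p @ [a, a] @ q) (p @ [a] @ q)"

definition glmy_group :: "'a set \<Rightarrow> 'a set set \<Rightarrow> 'a \<Rightarrow> 'a list set monoid" where
  "glmy_group V E v = loop_class_group V E v (glmy_step V E)"


section \<open>The fundamental group of a topological space\<close>

definition loops_at :: "'p topology \<Rightarrow> 'p \<Rightarrow> (real \<Rightarrow> 'p) set" where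
  "loops_at X x = {g. pathin X g \<and> g 0 = x \<and> g 1 = x}"

definition loop_homotopy :: "'p topology \<Rightarrow> 'p \<Rightarrow> ((real \<Rightarrow> 'p) \<times> (real \<Rightarrow> 'p)) set" where
  "loop_homotopy X x =
     {(g, h). g \<in> loops_at X x \<and> h \<in> loops_at X x \<and>
        homotopic_with (\<lambda>k. k 0 = x \<and> k 1 = x) (top_of_set {0..1}) X g h}"

text \<open>The library's \<open>joinpaths\<close> is restricted to codomains of class \<open>topological_space\<close>.\<close>

definition join_loops :: "(real \<Rightarrow> 'p) \<Rightarrow> (real \<Rightarrow> 'p) \<Rightarrow> real \<Rightarrow> 'p" where
  "join_loops g h = (\<lambda>t. if t \<le> 1/2 then g (2 * t) else h (2 * t - 1))"

definition fundamental_group :: "'p topology \<Rightarrow> 'p \<Rightarrow> (real \<Rightarrow> 'p) set monoid" where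
  "fundamental_group X x =
     \<lparr>carrier = loops_at X x // loop_homotopy X x,
      mult = (\<lambda>P Q. \<Union>g\<in>P. \<Union>h\<in>Q. loop_homotopy X x `` {join_loops g h}),
      one = loop_homotopy X x `` {\<lambda>_. x}\<rparr>"


section \<open>A graph as a 1-dimensional cell complex\<close>

text \<open>Points of the realization are written in barycentric coordinates: \<open>edge_point a b s\<close> is
  the point \<open>(1 - s) a + s b\<close>, and the vertex \<open>a\<close> is the indicator function of \<open>{a}\<close>. Thus
  \<open>edge_point a b s = edge_point b a (1 - s)\<close> and no orientation of the edges is chosen.\<close>

definition vertex_point :: "'a \<Rightarrow> 'a \<Rightarrow> real" where
  "vertex_point a = indicator {a}"

definition edge_point :: "'a \<Rightarrow> 'a \<Rightarrow> real \<Rightarrow> 'a \<Rightarrow> real" where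
  "edge_point a b s = (\<lambda>x. (1 - s) * vertex_point a x + s * vertex_point b x)"

definition graph_points :: "'a set \<Rightarrow> 'a set set \<Rightarrow> ('a \<Rightarrow> real) set" where
  "graph_points V E =
     vertex_point ` V \<union> {edge_point a b s | a b s. {a, b} \<in> E \<and> s \<in> {0..1}}"

text \<open>The topology is the weak one (the quotient topology from the disjoint union of the
  vertices and the closed edges), not the one induced by pointwise convergence.\<close>

definition graph_space :: "'a set \<Rightarrow> 'a set set \<Rightarrow> ('a \<Rightarrow> real) topology" where
  "graph_space V E =
     topology (\<lambda>U. U \<subseteq> graph_points V E \<and>
       (\<forall>a b. {a, b} \<in> E \<longrightarrow> openin (top_of_set {0..1}) {s \<in> {0..1}. edge_point a b s \<in> U}))"

lemma openin_graph_space: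
  "openin (graph_space V E) U \<longleftrightarrow> U \<subseteq> graph_points V E \<and>
     (\<forall>a b. {a, b} \<in> E \<longrightarrow> openin (top_of_set {0..1}) {s \<in> {0..1}. edge_point a b s \<in> U})"
proof -
  let ?Op = "\<lambda>U. U \<subseteq> graph_points V E \<and>
    (\<forall>a b. {a, b} \<in> E \<longrightarrow> openin (top_of_set {0..1}) {s \<in> {0..1}. edge_point a b s \<in> U})"
  have "istopology ?Op"
    unfolding istopology_def
  proof (rule conjI; intro allI impI)
    fix S T
    assume S: "?Op S" and T: "?Op T"
    have "{s \<in> {0..1}. edge_point a b s \<in> S \<inter> T} =
        {s \<in> {0..1}. edge_point a b s \<in> S} \<inter> {s \<in> {0..1}. edge_point a b s \<in> T}" for a b
      by blast
    then show "?Op (S \<inter> T)"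
      using S T by (metis (no_types, lifting) le_infI1 openin_Int)
  next
    fix K
    assume K: "\<forall>S\<in>K. ?Op S"
    have "{s \<in> {0..1}. edge_point a b s \<in> \<Union>K} =
        \<Union>((\<lambda>S. {s \<in> {0..1}. edge_point a b s \<in> S}) ` K)" for a b
      by blast
    moreover have "openin (top_of_set {0..1})
        (\<Union>((\<lambda>S. {s \<in> {0..1}. edge_point a b s \<in> S}) ` K))" if "{a, b} \<in> E" for a b
      using K that by (intro openin_Union) blast
    moreover have "\<Union>K \<subseteq> graph_points V E"
      using K by blast
    ultimately show "?Op (\<Union>K)"
      by simp
  qed
  then show ?thesis
    by (simp add: graph_space_def topology_inverse')
qed

lemma topspace_graph_space: "topspace (graph_space V E) = graph_points V E"
proof
  show "topspace (graph_space V E) \<subseteq> graph_points V E"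
    using openin_graph_space[of V E "topspace (graph_space V E)"] by simp
  have "{s \<in> {0..1}. edge_point a b s \<in> graph_points V E} = {0..1}" if "{a, b} \<in> E" for a b
    using that by (auto simp: graph_points_def)
  then have "openin (graph_space V E) (graph_points V E)"
    by (auto simp: openin_graph_space)
  then show "graph_points V E \<subseteq> topspace (graph_space V E)"
    by (rule openin_subset)
qed


section \<open>Attaching discs\<close>

text \<open>The space obtained from \<open>X\<close> by attaching \<open>Y\<close> along \<open>f : A \<rightarrow> X\<close>, where \<open>A \<subseteq> Y\<close>. Every
  class of the gluing relation has exactly one representative in \<open>X\<close> or in \<open>Y - A\<close>, and these
  representatives serve as the points; \<open>attach_map\<close> is the resulting map from \<open>Y\<close>.\<close>

definition attach_map :: "'y set \<Rightarrow> ('y \<Rightarrow> 'x) \<Rightarrow> 'y \<Rightarrow> 'x + 'y" where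
  "attach_map A f y = (if y \<in> A then Inl (f y) else Inr y)"

definition attach_points :: "'x topology \<Rightarrow> 'y topology \<Rightarrow> 'y set \<Rightarrow> ('x + 'y) set" where
  "attach_points X Y A = Inl ` topspace X \<union> Inr ` (topspace Y - A)"

definition attach_space ::
  "'x topology \<Rightarrow> 'y topology \<Rightarrow> 'y set \<Rightarrow> ('y \<Rightarrow> 'x) \<Rightarrow> ('x + 'y) topology" where
  "attach_space X Y A f =
     topology (\<lambda>U. U \<subseteq> attach_points X Y A \<and>
       openin X {x \<in> topspace X. Inl x \<in> U} \<and>
       openin Y {y \<in> topspace Y. attach_map A f y \<in> U})"

lemma openin_attach_space:
  "openin (attach_space X Y A f) U \<longleftrightarrow> U \<subseteq> attach_points X Y A \<and>
     openin X {x \<in> topspace X. Inl x \<in> U} \<and>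
     openin Y {y \<in> topspace Y. attach_map A f y \<in> U}"
proof -
  let ?Op = "\<lambda>U. U \<subseteq> attach_points X Y A \<and> openin X {x \<in> topspace X. Inl x \<in> U} \<and>
     openin Y {y \<in> topspace Y. attach_map A f y \<in> U}"
  have "istopology ?Op"
    unfolding istopology_def
  proof (rule conjI; intro allI impI)
    fix S T
    assume S: "?Op S" and T: "?Op T"
    have "{x \<in> topspace X. Inl x \<in> S \<inter> T} =
        {x \<in> topspace X. Inl x \<in> S} \<inter> {x \<in> topspace X. Inl x \<in> T}"
      and "{y \<in> topspace Y. attach_map A f y \<in> S \<inter> T} =
        {y \<in> topspace Y. attach_map A f y \<in> S} \<inter> {y \<in> topspace Y. attach_map A f y \<in> T}"
      by blast+
    then show "?Op (S \<inter> T)"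
      using S T by (metis (no_types, lifting) le_infI1 openin_Int)
  next
    fix K
    assume K: "\<forall>S\<in>K. ?Op S"
    have "{x \<in> topspace X. Inl x \<in> \<Union>K} = \<Union>((\<lambda>S. {x \<in> topspace X. Inl x \<in> S}) ` K)"
      and "{y \<in> topspace Y. attach_map A f y \<in> \<Union>K} =
        \<Union>((\<lambda>S. {y \<in> topspace Y. attach_map A f y \<in> S}) ` K)"
      by blast+
    moreover have "openin X (\<Union>((\<lambda>S. {x \<in> topspace X. Inl x \<in> S}) ` K))"
      using K by (intro openin_Union) blast
    moreover have "openin Y (\<Union>((\<lambda>S. {y \<in> topspace Y. attach_map A f y \<in> S}) ` K))"
      using K by (intro openin_Union) blast
    moreover have "\<Union>K \<subseteq> attach_points X Y A"
      using K by blast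
    ultimately show "?Op (\<Union>K)"
      by simp
  qed
  then show ?thesis
    by (simp add: attach_space_def topology_inverse')
qed

lemma topspace_attach_space:
  assumes "f ` (topspace Y \<inter> A) \<subseteq> topspace X"
  shows "topspace (attach_space X Y A f) = attach_points X Y A"
proof
  show "topspace (attach_space X Y A f) \<subseteq> attach_points X Y A"
    using openin_attach_space[of X Y A f "topspace (attach_space X Y A f)"] by simp
  have "{x \<in> topspace X. Inl x \<in> attach_points X Y A} = topspace X"
    and "{y \<in> topspace Y. attach_map A f y \<in> attach_points X Y A} = topspace Y"
    using assms by (auto simp: attach_points_def attach_map_def)
  then have "openin (attach_space X Y A f) (attach_points X Y A)"
    by (simp add: openin_attach_space)
  then show "attach_points X Y A \<subseteq> topspace (attach_space X Y A f)"
    by (rule openin_subset)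
qed

text \<open>The map from the unit circle that runs once, at constant speed, around the closed edge
  path \<open>xs ! 0, xs ! 1, \<dots>, xs ! (n - 1), xs ! 0\<close>.\<close>

definition circuit_map :: "'a list \<Rightarrow> complex \<Rightarrow> 'a \<Rightarrow> real" where
  "circuit_map xs z =
     (let n = length xs; t = real n * Arg2pi z / (2 * pi); k = nat \<lfloor>t\<rfloor>
      in edge_point (xs ! k) (xs ! (Suc k mod n)) (frac t))"

text \<open>A word \<open>r C\<close> representing each circuit \<open>C\<close> has to be chosen for the attaching map; the
  choice is a parameter.\<close>

definition disc_complex ::
  "'a set \<Rightarrow> 'a set set \<Rightarrow> 'a list set set \<Rightarrow> ('a list set \<Rightarrow> 'a list) \<Rightarrow>
     (('a \<Rightarrow> real) + ('a list set \<times> complex)) topology" where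
  "disc_complex V E B r =
     attach_space (graph_space V E)
       (sum_topology (\<lambda>_. top_of_set (cball 0 1)) B)
       (B \<times> sphere 0 1)
       (\<lambda>(C, z). circuit_map (r C) z)"

end

theory Submission
  imports Defs
begin

text \<open>
  The isomorphism sends the class of a word to the homotopy class of the edge path that it spells
  (\<open>word_path\<close>).

  It is well defined because both sides of every elementary move are images of two curves with the
  same ends in one convex set: an edge for backtracking, a disc for a circuit. Curves in a convex
  set are joined by straight lines, so their images are homotopic
  (\<open>factors_through_homotopic\<close>). The same observation gives the groupoid laws for paths, where
  the convex set is a real interval.

  Injectivity is a covering space argument without the covering space. The complex has an open
  cover by the vertex stars (the points that are not the centre of a disc and whose radial projection
  to the graph has a positive coordinate at the vertex) and the open discs. To each point a nearby
  vertex, its label, is attached. Inside one member of the cover there is a canonical class of words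
  from one label to another, and where two members overlap they give the same class. Word classes can
  therefore be transported consistently along short steps, hence along paths, and on a convex compact
  set a transport of this kind integrates to a global section, so that homotopic paths transport
  equally (\<open>carries_homotopic\<close>). Along the edge path of a word, transport appends that word
  (\<open>carries_word\<close>). Thus homotopic edge paths come from equivalent words.

  For surjectivity, a path is followed from its beginning. At each time the path so far, continued
  to a vertex near its end point, is homotopic to an edge path, and this property persists inside
  each member of the cover (\<open>spelled_step\<close>): a vertex star contracts to its vertex by pushing the
  discs out radially and then contracting edges, and an open disc is convex. By connectedness of the
  unit interval it holds at the end of the path.

  The moves of Grigor'yan, Lin, Muranov and Yau generate the same equivalence of words as the
  triangles and squares do, so the second isomorphism is an instance of the first.
\<close>

section \<open>Words, walks and circuits\<close>

definition cycle_edges :: "'a list \<Rightarrow> 'a set set" where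
  "cycle_edges xs = (\<lambda>i. {xs ! i, xs ! (Suc i mod length xs)}) ` {..<length xs}"

lemma is_circuit_alt:
  "is_circuit V E xs \<longleftrightarrow> 3 \<le> length xs \<and> distinct xs \<and> set xs \<subseteq> V \<and> cycle_edges xs \<subseteq> E"
  by (auto simp: is_circuit_def cycle_edges_def)

lemma cycle_edges_rotate: "cycle_edges (rotate k xs) = cycle_edges xs"
proof -
  have sub: "cycle_edges (rotate k xs) \<subseteq> cycle_edges xs" for k and xs :: "'a list"
  proof
    fix e assume "e \<in> cycle_edges (rotate k xs)"
    then obtain i where i: "i < length xs"
      and e: "e = {rotate k xs ! i, rotate k xs ! (Suc i mod length xs)}"
      by (auto simp: cycle_edges_def)
    let ?j = "(k + i) mod length xs"
    have "0 < length xs" using i by linarith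
    then have "Suc i mod length xs < length xs" "?j < length xs"
      by simp_all
    moreover have "(k + Suc i mod length xs) mod length xs = Suc ?j mod length xs"
      by (simp add: mod_simps)
    ultimately show "e \<in> cycle_edges xs"
      using i e by (auto simp: cycle_edges_def nth_rotate intro!: image_eqI[of _ _ ?j])
  qed
  have "rotate ((length xs - 1) * k) (rotate k xs) = xs"
  proof (cases "xs = []")
    case False
    then have "length xs * k = (length xs - 1) * k + k"
      by (cases xs) auto
    then have "rotate ((length xs - 1) * k + k) xs = xs"
      by (intro rotate_id) (metis mod_mult_self1_is_0)
    then show ?thesis
      by (simp add: rotate_rotate)
  qed simp
  then have "cycle_edges xs \<subseteq> cycle_edges (rotate k xs)"
    using sub[of "(length xs - 1) * k" "rotate k xs"] by simp
  with sub show ?thesis by blast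
qed

lemma cycle_edges_rev: "cycle_edges (rev xs) = cycle_edges xs"
proof -
  have sub: "cycle_edges (rev xs) \<subseteq> cycle_edges xs" for xs :: "'a list"
  proof
    fix e assume "e \<in> cycle_edges (rev xs)"
    then obtain i where i: "i < length xs"
      and e: "e = {rev xs ! i, rev xs ! (Suc i mod length xs)}"
      by (auto simp: cycle_edges_def)
    show "e \<in> cycle_edges xs"
    proof (cases "Suc i < length xs")
      case True
      let ?j = "length xs - Suc (Suc i)"
      have "?j < length xs" "Suc ?j mod length xs = length xs - Suc i"
        using True by auto
      then show ?thesis
        using True e by (auto simp: cycle_edges_def rev_nth intro!: image_eqI[of _ _ ?j])
    next
      case False
      then have "Suc i = length xs" using i by simp
      then have "rev xs ! i = xs ! 0" "rev xs ! 0 = xs ! i" "Suc i mod length xs = 0"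
        using i by (auto simp: rev_nth simp flip: \<open>Suc i = length xs\<close>)
      then show ?thesis
        using e i by (auto simp: cycle_edges_def insert_commute intro!: image_eqI[of _ _ i])
    qed
  qed
  from sub[of xs] sub[of "rev xs"] show ?thesis by auto
qed

lemma circuit_of_mem:
  assumes "ys \<in> circuit_of xs"
  shows "length ys = length xs" "set ys = set xs" "distinct ys = distinct xs"
    "cycle_edges ys = cycle_edges xs"
  using assms by (auto simp: circuit_of_def cycle_edges_rotate cycle_edges_rev)

lemma circuit_of_self: "xs \<in> circuit_of xs"
  unfolding circuit_of_def by (rule UN_I[of 0]) auto

lemma circuits_mem:
  assumes "C \<in> circuits V E" "xs \<in> C" "ys \<in> C"
  shows "is_circuit V E xs" "set ys = set xs" "cycle_edges ys = cycle_edges xs"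
proof -
  obtain zs where zs: "is_circuit V E zs" "C = circuit_of zs"
    using assms(1) by (auto simp: circuits_def)
  show "is_circuit V E xs" "set ys = set xs" "cycle_edges ys = cycle_edges xs"
    using zs circuit_of_mem[of xs zs] circuit_of_mem[of ys zs] assms by (auto simp: is_circuit_alt)
qed


abbreviation word_equiv :: "'a set set \<Rightarrow> 'a list set set \<Rightarrow> 'a list \<Rightarrow> 'a list \<Rightarrow> bool" where
  "word_equiv E B \<equiv> equivclp (circuit_step E B)"

definition walk :: "'a set \<Rightarrow> 'a set set \<Rightarrow> 'a list \<Rightarrow> bool" where
  "walk V E w \<longleftrightarrow> w \<noteq> [] \<and> set w \<subseteq> V \<and> successively (\<lambda>a b. a = b \<or> {a, b} \<in> E) w"

lemma walk_simps [simp]: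
  "\<not> walk V E []"
  "walk V E [a] \<longleftrightarrow> a \<in> V"
  "walk V E (a # b # w) \<longleftrightarrow> a \<in> V \<and> (a = b \<or> {a, b} \<in> E) \<and> walk V E (b # w)"
  by (auto simp: walk_def)

lemma walk_append: "walk V E (p @ a # q) \<longleftrightarrow> walk V E (p @ [a]) \<and> walk V E (a # q)"
proof (cases "p = []")
  case True
  then show ?thesis by (auto simp: walk_def)
next
  case False
  then show ?thesis by (auto simp: walk_def successively_append_iff)
qed

lemma walk_rev: "walk V E (rev w) = walk V E w"
proof -
  have "successively (\<lambda>x y. y = x \<or> {y, x} \<in> E) w = successively (\<lambda>x y. x = y \<or> {x, y} \<in> E) w"
    by (rule successively_cong) (auto simp: insert_commute)
  then show ?thesis
    by (simp add: walk_def successively_rev)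
qed

lemma walk_mono: "walk V E w \<Longrightarrow> V \<subseteq> V' \<Longrightarrow> E \<subseteq> E' \<Longrightarrow> walk V' E' w"
  unfolding walk_def by (auto elim!: successively_mono)

lemma based_loops_walk: "w \<in> based_loops V E v \<longleftrightarrow> walk V E w \<and> hd w = v \<and> last w = v"
  by (auto simp: based_loops_def walk_def successively_conv_nth)

lemma walk_join:
  assumes "walk V E u" "walk V E w" "last u = hd w"
  shows "walk V E (u @ tl w)"
proof -
  have "u \<noteq> []" "w \<noteq> []"
    using assms by (auto simp: walk_def)
  then have "u = butlast u @ [last u]" "w = last u # tl w"
    using append_butlast_last_id[of u] assms(3) by simp_all
  then show ?thesis
    using assms walk_append[of V E "butlast u" "last u" "tl w"]
    by (metis append.assoc append_Cons append_Nil)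
qed

lemma last_join: "u \<noteq> [] \<Longrightarrow> w \<noteq> [] \<Longrightarrow> last u = hd w \<Longrightarrow> last (u @ tl w) = last w"
  by (cases w) auto

lemma circuit_walk:
  assumes "3 \<le> length xs" "xs = [a] @ vs @ [b] @ ws"
  shows "walk (set xs) (cycle_edges xs) ([a] @ vs @ [b])"
proof -
  have "walk (set xs) (cycle_edges xs) xs"
    using assms(1) by (auto simp: walk_def successively_conv_nth cycle_edges_def)
  moreover have "xs = ([a] @ vs) @ b # ws"
    using assms by simp
  ultimately show ?thesis
    using walk_append[of "set xs" "cycle_edges xs" "[a] @ vs" b ws] by simp
qed

text \<open>The two arcs into which a circuit is cut by two of its vertices. The second one is read off the
  circuit by turning it round and rotating it, which changes neither its vertices nor its edges.\<close>

lemma circuit_walks: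
  assumes "C \<in> circuits V E" "[a] @ vs @ [b] @ rev ws \<in> C" "xs \<in> C"
  shows "walk (set xs) (cycle_edges xs) ([a] @ vs @ [b])"
    "walk (set xs) (cycle_edges xs) ([a] @ ws @ [b])"
proof -
  let ?y = "[a] @ vs @ [b] @ rev ws" and ?z = "[a] @ ws @ [b] @ rev vs"
  have y: "is_circuit V E ?y" "set ?y = set xs" "cycle_edges ?y = cycle_edges xs"
    using circuits_mem[OF assms(1)] assms by blast+
  have "rev ?y = (ws @ [b] @ rev vs) @ [a]" by simp
  then have eq: "rotate (length (ws @ [b] @ rev vs)) (rev ?y) = ?z"
    by (simp only: rotate_append)
  have "cycle_edges ?z = cycle_edges ?y"
    unfolding eq[symmetric] cycle_edges_rotate cycle_edges_rev ..
  moreover have "set ?z = set ?y" by auto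
  ultimately show "walk (set xs) (cycle_edges xs) ([a] @ vs @ [b])"
    "walk (set xs) (cycle_edges xs) ([a] @ ws @ [b])"
    using circuit_walk[of ?y a vs b "rev ws"] circuit_walk[of ?z a ws b "rev vs"] y
    by (auto simp: is_circuit_alt)
qed

lemma circuit_step_append:
  "circuit_step E B u w \<Longrightarrow> circuit_step E B (p @ u @ q) (p @ w @ q)"
proof (induction rule: circuit_step.induct)
  case (circuit C a vs b ws p' q')
  then show ?case
    using circuit_step.circuit[of C B a vs b ws E "p @ p'" "q' @ q"] by simp
next
  case (backtrack a b p' q')
  then show ?case
    using circuit_step.backtrack[of a b E B "p @ p'" "q' @ q"] by simp
next
  case (stutter p' a q')
  then show ?case
    using circuit_step.stutter[of E B "p @ p'" a "q' @ q"] by simp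
qed

lemma word_equiv_append:
  assumes "word_equiv E B u w"
  shows "word_equiv E B (p @ u @ q) (p @ w @ q)"
  using assms
  by (induction rule: equivclp_induct)
     (auto intro: equivclp_into_equivclp dest: circuit_step_append[of _ _ _ _ p q])

lemma circuit_step_ends: "circuit_step E B u w \<Longrightarrow> u \<noteq> [] \<and> w \<noteq> [] \<and> hd u = hd w \<and> last u = last w"
  by (induction rule: circuit_step.induct) (auto simp: hd_append)

text \<open>Concatenation of words that share an end vertex respects equivalence, because every move may be
  performed inside a longer word.\<close>

lemma word_equiv_join:
  assumes "word_equiv E B u u'" "word_equiv E B w w'" "w \<noteq> []" "hd w = last u"  "u \<noteq> []"
  shows "word_equiv E B (u @ tl w) (u' @ tl w')"
proof -
  have w: "w' \<noteq> [] \<and> hd w' = hd w"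
    using assms(2,3) by (induction rule: equivclp_induct) (auto dest: circuit_step_ends)
  have "u @ tl w = butlast u @ w @ []" "u @ tl w' = butlast u @ w' @ []"
    using assms w by (metis append_assoc append_butlast_last_id append_Cons append_Nil append_Nil2 list.collapse)+
  then have "word_equiv E B (u @ tl w) (u @ tl w')"
    using word_equiv_append[OF assms(2), of "butlast u" "[]"] by metis
  also have "word_equiv E B (u @ tl w') (u' @ tl w')"
    using word_equiv_append[OF assms(1), of "[]" "tl w'"] by simp
  finally show ?thesis .
qed

lemma word_equiv_spike:
  assumes "a = b \<or> {a, b} \<in> E"
  shows "word_equiv E B (p @ a # b # a # q) (p @ a # q)"
proof (cases "a = b")
  case True
  have "circuit_step E B (p @ [a, a] @ a # q) (p @ [a] @ a # q)" "circuit_step E B (p @ [a, a] @ q) (p @ [a] @ q)"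
    by (rule circuit_step.stutter)+
  then show ?thesis
    using True by (auto intro: equivclp_trans)
next
  case False
  then have "circuit_step E B (p @ [a, b, a] @ q) (p @ [a] @ q)"
    using assms by (intro circuit_step.backtrack) auto
  then show ?thesis by auto
qed

lemma word_equiv_stutter: "word_equiv E B (p @ a # a # q) (p @ a # q)"
  using circuit_step.stutter[of E B p a q] by auto

text \<open>A walk followed by its reversal cancels from the middle outwards, so reversal is the inverse.\<close>

lemma word_equiv_back_and_forth:
  assumes "walk V E w"
  shows "word_equiv E B (rev w @ tl w) [last w]"
  using assms
proof (induction w rule: induct_list012)
  case (3 a b w)
  have "word_equiv E B (rev (a # b # w) @ tl (a # b # w)) (rev (b # w) @ tl (b # w))"
    using word_equiv_spike[of b a E B "rev w" w] 3 by (auto simp: insert_commute)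
  also have "word_equiv E B (rev (b # w) @ tl (b # w)) [last (b # w)]"
    using 3 by simp
  finally show ?case by simp
qed auto

text \<open>A word may pass through arbitrary lists on its way to an equivalent one, but moves neither create
  nor destroy walks. Hence a walk and an equivalent word are linked through walks only, and every word
  in between spells a path.\<close>

lemma circuit_step_walk:
  assumes "circuit_step E B u w" "B \<subseteq> circuits V E" "simple_graph V E"
  shows "walk V E u = walk V E w"
  using assms
proof (induction rule: circuit_step.induct)
  case (circuit C a vs b ws p q)
  let ?y = "[a] @ vs @ [b] @ rev ws"
  have C: "C \<in> circuits V E" using circuit by auto
  have "is_circuit V E ?y" using circuits_mem(1)[OF C] circuit by blast
  then have "walk V E ([a] @ vs @ [b])" "walk V E ([a] @ ws @ [b])"
    using circuit_walks[OF C circuit(2) circuit(2)] by (auto simp: is_circuit_alt elim!: walk_mono)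
  moreover have "walk V E (p @ [a] @ xs @ [b] @ q) \<longleftrightarrow>
      walk V E (p @ [a]) \<and> walk V E ([a] @ xs @ [b]) \<and> walk V E (b # q)" for xs
    using walk_append[of V E p a "xs @ [b] @ q"] walk_append[of V E "a # xs" b q] by simp
  ultimately show ?case by simp
next
  case (backtrack a b p q)
  then have "a \<in> V" "b \<in> V" by (auto simp: simple_graph_def)
  then show ?case
    using backtrack walk_append[of V E p a "[b, a] @ q"] walk_append[of V E p a q]
    by (auto simp: insert_commute)
next
  case (stutter p a q)
  show ?case
    using walk_append[of V E p a "a # q"] walk_append[of V E p a q]
    by (auto simp: walk_def)
qed

text \<open>The initial arc of \<open>xs\<close> that ends at \<open>a\<close>. Up to equivalence these arcs are a potential for the words
  that run on the circuit: such a word extends the arc to its first letter to the arc to its last.\<close>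

definition arc_to :: "'a list \<Rightarrow> 'a \<Rightarrow> 'a list" where
  "arc_to xs a = takeWhile (\<lambda>x. x \<noteq> a) xs @ [a]"

lemma arc_to_nth:
  assumes "distinct xs" "i < length xs"
  shows "arc_to xs (xs ! i) = take (Suc i) xs"
proof -
  have "takeWhile (\<lambda>x. x \<noteq> xs ! i) xs = take i xs"
    using assms by (intro takeWhile_eq_take_P_nth) (auto simp: nth_eq_iff_index_eq)
  then show ?thesis
    using assms by (simp add: arc_to_def take_Suc_conv_app_nth)
qed

text \<open>All edges but one are steps along \<open>xs\<close> or back. The remaining one joins the two ends of \<open>xs\<close>,
  and there the circuit move replaces the whole arc \<open>xs\<close> by that single edge.\<close>

lemma word_equiv_arc_to_edge:
  assumes C: "C \<in> B" "C \<in> circuits V E" "xs \<in> C" and ab: "{a, b} \<in> cycle_edges xs"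
  shows "word_equiv E B (arc_to xs a @ [b]) (arc_to xs b)"
proof -
  let ?n = "length xs"
  have circ: "is_circuit V E xs"
    using circuits_mem[OF C(2,3,3)] by auto
  then have n: "3 \<le> ?n" and dist: "distinct xs" and E: "{a, b} \<in> E"
    using ab by (auto simp: is_circuit_alt)
  obtain i where i: "i < ?n" and abi: "{a, b} = {xs ! i, xs ! (Suc i mod ?n)}"
    using ab by (auto simp: cycle_edges_def)
  note spike = word_equiv_spike[of _ _ E B _ "[]"]
  show ?thesis
  proof (cases "Suc i < ?n")
    case True
    then consider "a = xs ! i" "b = xs ! Suc i" | "b = xs ! i" "a = xs ! Suc i"
      using abi by (auto simp: doubleton_eq_iff)
    then show ?thesis
    proof cases
      case 1
      then have "arc_to xs a @ [b] = arc_to xs b"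
        using arc_to_nth[OF dist, of i] arc_to_nth[OF dist, of "Suc i"] True
          take_Suc_conv_app_nth[of "Suc i" xs] by simp
      then show ?thesis by simp
    next
      case 2
      then have "arc_to xs a @ [b] = take i xs @ [b, a, b]" "arc_to xs b = take i xs @ [b]"
        using arc_to_nth[OF dist, of i] arc_to_nth[OF dist, of "Suc i"] True
          take_Suc_conv_app_nth[of "Suc i" xs] take_Suc_conv_app_nth[of i xs] by auto
      then show ?thesis
        using spike[of b a "take i xs"] E by (simp add: insert_commute)
    qed
  next
    case False
    \<comment> \<open>the edge that closes the circuit\<close>
    then have "Suc i = ?n" using i by simp
    then have i: "i = ?n - 1" "Suc i mod ?n = 0" by auto
    define vs where "vs = butlast (tl xs)"
    have xs: "xs = [hd xs] @ vs @ [last xs]"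
      unfolding vs_def using n by (cases xs; cases "tl xs") auto
    have ends: "hd xs = xs ! 0" "last xs = xs ! (?n - 1)"
      using n by (auto simp: hd_conv_nth last_conv_nth simp flip: length_greater_0_conv)
    have arcs: "arc_to xs (hd xs) = [hd xs]" "arc_to xs (last xs) = xs"
      using arc_to_nth[OF dist, of 0] arc_to_nth[OF dist, of "?n - 1"] n ends
        take_Suc_conv_app_nth[of 0 xs] by (cases xs; force)+
    have "circuit_step E B ([] @ [hd xs] @ vs @ [last xs] @ []) ([] @ [hd xs] @ [] @ [last xs] @ [])"
      using C xs by (intro circuit_step.circuit[of C]) auto
    then have step: "word_equiv E B xs [hd xs, last xs]"
      using xs by auto
    consider "a = last xs" "b = hd xs" | "b = last xs" "a = hd xs"
      using abi i ends by (auto simp: doubleton_eq_iff)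
    then show ?thesis
    proof cases
      case 1
      have "word_equiv E B (xs @ [hd xs]) [hd xs, last xs, hd xs]"
        using word_equiv_append[OF step, of "[]" "[hd xs]"] by simp
      also have "word_equiv E B [hd xs, last xs, hd xs] [hd xs]"
        using spike[of "hd xs" "last xs" "[]"] 1 E by (simp add: insert_commute)
      finally show ?thesis
        using 1 arcs by simp
    next
      case 2
      then show ?thesis
        using step arcs by (simp add: equivclp_sym)
    qed
  qed
qed

lemma word_equiv_arc_to:
  assumes C: "C \<in> B" "C \<in> circuits V E" "xs \<in> C" and w: "walk U (cycle_edges xs) w"
  shows "word_equiv E B (arc_to xs (hd w) @ tl w) (arc_to xs (last w))"
  using w
proof (induction w rule: rev_induct)
  case (snoc b w)
  show ?case
  proof (cases "w = []")
    case False
    then have "w = butlast w @ [last w]" by simp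
    then have *: "walk U (cycle_edges xs) w" "last w = b \<or> {last w, b} \<in> cycle_edges xs"
      using snoc.prems walk_append[of U "cycle_edges xs" "butlast w" "last w" "[b]"]
      by (metis append_assoc append_Cons append_Nil, metis append_assoc append_Cons append_Nil walk_simps(3))
    have "word_equiv E B ((arc_to xs (hd w) @ tl w) @ [b]) (arc_to xs (last w) @ [b])"
      using word_equiv_append[OF snoc.IH[OF *(1)], of "[]" "[b]"] by simp
    also have "word_equiv E B (arc_to xs (last w) @ [b]) (arc_to xs b)"
      using *(2) word_equiv_arc_to_edge[OF C, of "last w" b]
        word_equiv_stutter[of E B "takeWhile (\<lambda>x. x \<noteq> b) xs" b "[]"]
      by (auto simp: arc_to_def)
    finally show ?thesis
      using False by simp
  qed simp
qed auto

lemma walk_arc_to: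
  assumes circ: "is_circuit V E xs" and a: "a \<in> set xs"
  shows "walk V E (arc_to xs a)" "hd (arc_to xs a) = hd xs" "last (arc_to xs a) = a"
proof -
  from circ have w: "walk V E xs"
    unfolding is_circuit_def walk_def successively_conv_nth by (metis Suc_lessD list.size(3) mod_less not_numeral_le_zero)
  obtain i where i: "i < length xs" "a = xs ! i"
    using assms by (auto simp: in_set_conv_nth)
  have "arc_to xs a = take (Suc i) xs"
    using arc_to_nth i circ by (auto simp: is_circuit_def)
  moreover have "xs = take i xs @ a # drop (Suc i) xs"
    using i by (simp add: id_take_nth_drop)
  ultimately show "walk V E (arc_to xs a)" "hd (arc_to xs a) = hd xs"
    using w walk_append[of V E "take i xs" a "drop (Suc i) xs"] i
    by (auto simp: take_Suc_conv_app_nth simp flip: hd_take[of "Suc i" xs])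
  show "last (arc_to xs a) = a" by (simp add: arc_to_def)
qed

text \<open>The class of a word that runs on a circuit of \<open>B\<close> depends only on its ends, since by
  \<open>word_equiv_arc_to\<close> it changes the potential \<open>arc_to\<close> from one end to the other.\<close>

lemma word_equiv_in_circuit:
  assumes C: "C \<in> B" "C \<in> circuits V E" "xs \<in> C" and w: "walk (set xs) (cycle_edges xs) w"
  shows "word_equiv E B w (rev (arc_to xs (hd w)) @ tl (arc_to xs (last w)))"
proof -
  let ?a = "arc_to xs (hd w)"
  have hd: "hd w \<in> set xs" and la: "last w \<in> set xs" and ne: "w \<noteq> []" using w by (auto simp: walk_def)
  have circ: "is_circuit V E xs"
    using circuits_mem[OF C(2,3,3)] by auto
  note A = walk_arc_to[OF circ hd] and A' = walk_arc_to[OF circ la]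
  have ne': "?a \<noteq> []" by (simp add: arc_to_def)
  have "word_equiv E B ((rev ?a @ tl ?a) @ tl w) ([hd w] @ tl w)"
    using word_equiv_append[OF word_equiv_back_and_forth[OF A(1), of B], of "[]" "tl w"] A(3) by simp
  moreover have "word_equiv E B (rev ?a @ tl (?a @ tl w)) (rev ?a @ tl (arc_to xs (last w)))"
    by (rule word_equiv_join[OF _ word_equiv_arc_to[OF C w]])
       (use A A' ne' in \<open>auto simp: hd_append last_rev\<close>)
  ultimately show ?thesis
    using ne ne' by (metis append.assoc append_Cons append_Nil equivclp_sym equivclp_trans list.collapse tl_append2)
qed

lemma is_circuit_mem:
  assumes "is_circuit V E zs" "ys \<in> circuit_of zs" shows "is_circuit V E ys"
  using assms circuit_of_mem[OF assms(2)] by (auto simp: is_circuit_alt)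

lemma is_circuit_rotate: "is_circuit V E (rotate k xs) = is_circuit V E xs"
  by (simp add: is_circuit_alt cycle_edges_rotate)

lemma is_circuit_rev: "is_circuit V E (rev xs) = is_circuit V E xs"
  by (simp add: is_circuit_alt cycle_edges_rev)

lemma triangles_and_squares_mem:
  "(\<exists>C\<in>triangles_and_squares V E. xs \<in> C) \<longleftrightarrow>
     is_circuit V E xs \<and> (length xs = 3 \<or> length xs = 4)"
proof
  assume "\<exists>C\<in>triangles_and_squares V E. xs \<in> C"
  then show "is_circuit V E xs \<and> (length xs = 3 \<or> length xs = 4)"
    unfolding triangles_and_squares_def using is_circuit_mem circuit_of_mem(1) by fastforce
next
  assume "is_circuit V E xs \<and> (length xs = 3 \<or> length xs = 4)"
  then show "\<exists>C\<in>triangles_and_squares V E. xs \<in> C"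
    unfolding triangles_and_squares_def using circuit_of_self by (intro bexI[of _ "circuit_of xs"]) auto
qed

lemma glmy_step_circuit_step:
  assumes "glmy_step V E u w"
  shows "circuit_step E (triangles_and_squares V E) u w"
  using assms
proof (induction rule: glmy_step.induct)
  case (triangle a b c p q)
  then obtain C where "C \<in> triangles_and_squares V E" "[a, b, c] \<in> C"
    using triangles_and_squares_mem[of V E "[a, b, c]"] by auto
  then show ?case
    using circuit_step.circuit[of C _ a "[b]" c "[]" E p q] by simp
next
  case (square a b c d p q)
  then obtain C where "C \<in> triangles_and_squares V E" "[a, b, c, d] \<in> C"
    using triangles_and_squares_mem[of V E "[a, b, c, d]"] by auto
  then show ?case
    using circuit_step.circuit[of C _ a "[b]" c "[d]" E p q] by simp
next
  case (square_short a b c d p q)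
  then obtain C where "C \<in> triangles_and_squares V E" "[a, b, c, d] \<in> C"
    using triangles_and_squares_mem[of V E "[a, b, c, d]"] by auto
  then show ?case
    using circuit_step.circuit[of C _ a "[b, c]" d "[]" E p q] by simp
qed (rule circuit_step.backtrack circuit_step.stutter, assumption?)+

text \<open>A triangle or square is cut by two of its vertices into arcs with one or two interior vertices in
  total. If all of these lie on the second arc, the move is the inverse of a shortening along the
  reversed circuit.\<close>

lemma circuit_step_glmy_equiv:
  assumes "circuit_step E (triangles_and_squares V E) u w"
  shows "equivclp (glmy_step V E) u w"
  using assms
proof (induction rule: circuit_step.induct)
  case (circuit C a vs b ws p q)
  then have circ: "is_circuit V E ([a] @ vs @ [b] @ rev ws)"
    and "length vs + length ws = 1 \<or> length vs + length ws = 2"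
    using triangles_and_squares_mem[of V E "[a] @ vs @ [b] @ rev ws"] by auto
  then consider x where "vs = [x]" "ws = []" | x where "vs = []" "ws = [x]"
    | x y where "vs = [x, y]" "ws = []" | x y where "vs = [x]" "ws = [y]"
    | x y where "vs = []" "ws = [x, y]"
    by (cases vs; cases "tl vs"; cases ws; cases "tl ws") auto
  then show ?case
  proof cases
    case (1 x)
    then show ?thesis
      using glmy_step.triangle[of V E a x b p q] circ by auto
  next
    case (2 x)
    then have "is_circuit V E [a, x, b]"
      using circ is_circuit_rev[of V E "[a, b, x]"] is_circuit_rotate[of V E 2 "[x, b, a]"]
      by (simp add: numeral_2_eq_2)
    then show ?thesis
      using 2 glmy_step.triangle[of V E a x b p q] by auto
  next
    case (3 x y)
    then show ?thesis
      using glmy_step.square_short[of V E a x y b p q] circ by auto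
  next
    case (4 x y)
    then show ?thesis
      using glmy_step.square[of V E a x b y p q] circ by auto
  next
    case (5 x y)
    then have "is_circuit V E [a, x, y, b]"
      using circ is_circuit_rev[of V E "[a, b, y, x]"] is_circuit_rotate[of V E 3 "[x, y, b, a]"]
      by (simp add: numeral_3_eq_3)
    then show ?thesis
      using 5 glmy_step.square_short[of V E a x y b p q] by auto
  qed
qed (rule r_into_equivclp, rule glmy_step.backtrack glmy_step.stutter, assumption?)+

lemma equivclp_glmy_step:
  "equivclp (glmy_step V E) = word_equiv E (triangles_and_squares V E)"
proof (intro ext iffI)
  fix u w
  assume "equivclp (glmy_step V E) u w"
  then show "word_equiv E (triangles_and_squares V E) u w"
    by (induction rule: equivclp_induct)
       (auto intro: equivclp_into_equivclp dest: glmy_step_circuit_step)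
next
  fix u w
  assume "word_equiv E (triangles_and_squares V E) u w"
  then show "equivclp (glmy_step V E) u w"
  proof (induction rule: equivclp_induct)
    case (step y z)
    then have "equivclp (glmy_step V E) y z"
      using circuit_step_glmy_equiv equivclp_sym by metis
    with step.IH show ?case by (rule equivclp_trans)
  qed simp
qed

section \<open>Homotopy of paths relative to their ends\<close>

abbreviation unit_interval :: "real topology" where
  "unit_interval \<equiv> top_of_set {0..1}"

definition path_homotopic :: "'p topology \<Rightarrow> (real \<Rightarrow> 'p) \<Rightarrow> (real \<Rightarrow> 'p) \<Rightarrow> bool" where
  "path_homotopic X p q \<longleftrightarrow> p 0 = q 0 \<and> p 1 = q 1 \<and>
     homotopic_with (\<lambda>k. k 0 = p 0 \<and> k 1 = p 1) unit_interval X p q"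

text \<open>Only the values of a homotopy on the unit square matter, although \<open>homotopic_with\<close> prescribes the
  end maps on the whole real line.\<close>

lemma path_homotopic_iff:
  "path_homotopic X p q \<longleftrightarrow>
     (\<exists>H. continuous_map (prod_topology unit_interval unit_interval) X H \<and>
        (\<forall>s\<in>{0..1}. H (0, s) = p s \<and> H (1, s) = q s) \<and>
        (\<forall>t\<in>{0..1}. H (t, 0) = p 0 \<and> H (t, 1) = p 1))"
proof -
  have "homotopic_with (\<lambda>k. k 0 = p 0 \<and> k 1 = p 1) unit_interval X p q \<longleftrightarrow>
     (\<exists>H. continuous_map (prod_topology unit_interval unit_interval) X H \<and>
        (\<forall>s\<in>topspace unit_interval. H (0, s) = p s) \<and> (\<forall>s\<in>topspace unit_interval. H (1, s) = q s) \<and>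
        (\<forall>t\<in>{0..1}. H (t, 0) = p 0 \<and> H (t, 1) = p 1))"
    by (rule homotopic_with) auto
  moreover have "p 0 = q 0 \<and> p 1 = q 1"
    if "\<forall>s\<in>{0..1}. H (0::real, s) = p s \<and> H (1, s) = q s" "\<forall>t\<in>{0..1}. H (t, 0) = p 0 \<and> H (t, 1) = p 1"
    for H
    using that by (metis atLeastAtMost_iff order_refl zero_le_one)
  ultimately show ?thesis
    unfolding path_homotopic_def by (auto 0 4)
qed

lemma path_homotopic_imp_pathin:
  assumes "path_homotopic X p q" shows "pathin X p" "pathin X q"
  using assms homotopic_with_imp_continuous_maps by (fastforce simp: path_homotopic_def pathin_def)+

lemma path_homotopic_ends:
  assumes "path_homotopic X p q" shows "p 0 = q 0" "p 1 = q 1"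
  using assms by (auto simp: path_homotopic_def)

lemma path_homotopic_sym: "path_homotopic X p q \<Longrightarrow> path_homotopic X q p"
  by (auto simp: path_homotopic_def homotopic_with_symD)

lemma path_homotopic_trans [trans]:
  "path_homotopic X p q \<Longrightarrow> path_homotopic X q r \<Longrightarrow> path_homotopic X p r"
  by (auto simp: path_homotopic_def intro: homotopic_with_trans)

lemma path_homotopic_eq:
  assumes "pathin X p" "\<And>t. t \<in> {0..1} \<Longrightarrow> p t = q t"
  shows "path_homotopic X p q"
  using assms unfolding path_homotopic_def pathin_def
  by (auto intro!: homotopic_with_equal)

lemma path_homotopic_refl: "pathin X p \<Longrightarrow> path_homotopic X p p"
  by (rule path_homotopic_eq) auto

lemma continuous_map_join:
  assumes H: "continuous_map (prod_topology Y unit_interval) X H"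
    and K: "continuous_map (prod_topology Y unit_interval) X K"
    and eq: "\<And>y. y \<in> topspace Y \<Longrightarrow> H (y, 1) = K (y, 0)"
  shows "continuous_map (prod_topology Y unit_interval) X
    (\<lambda>z. if snd z \<le> 1/2 then H (fst z, 2 * snd z) else K (fst z, 2 * snd z - 1))"
proof (rule continuous_map_cases_le)
  let ?Z = "prod_topology Y unit_interval"
  have snd: "continuous_map ?Z euclideanreal snd"
    by (metis continuous_map_into_fulltopology continuous_map_snd)
  then show "continuous_map ?Z euclideanreal snd" .
  show "continuous_map ?Z euclideanreal (\<lambda>z. 1/2)" by simp
  have "continuous_map (subtopology ?Z {z \<in> topspace ?Z. snd z \<le> 1/2}) ?Z (\<lambda>z. (fst z, 2 * snd z))"
    unfolding continuous_map_paired
    by (auto simp: continuous_map_in_subtopology intro!: continuous_intros continuous_map_from_subtopology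
        continuous_map_fst snd)
  then show "continuous_map (subtopology ?Z {z \<in> topspace ?Z. snd z \<le> 1/2}) X (\<lambda>z. H (fst z, 2 * snd z))"
    using continuous_map_compose[OF _ H] by (fastforce simp: o_def)
  have "continuous_map (subtopology ?Z {z \<in> topspace ?Z. 1/2 \<le> snd z}) ?Z (\<lambda>z. (fst z, 2 * snd z - 1))"
    unfolding continuous_map_paired
    by (auto simp: continuous_map_in_subtopology intro!: continuous_intros continuous_map_from_subtopology
        continuous_map_fst snd)
  then show "continuous_map (subtopology ?Z {z \<in> topspace ?Z. 1/2 \<le> snd z}) X (\<lambda>z. K (fst z, 2 * snd z - 1))"
    using continuous_map_compose[OF _ K] by (fastforce simp: o_def)
  show "H (fst z, 2 * snd z) = K (fst z, 2 * snd z - 1)"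
    if "z \<in> topspace ?Z" "snd z = 1/2" for z
  proof -
    have "2 * snd z = 1" "2 * snd z - 1 = 0" "fst z \<in> topspace Y"
      using that by auto
    then show ?thesis
      by (simp only: eq)
  qed
qed

lemma path_homotopic_join:
  assumes p: "path_homotopic X p p'" and q: "path_homotopic X q q'" and "p 1 = q 0"
  shows "path_homotopic X (join_loops p q) (join_loops p' q')"
proof -
  obtain H where H: "continuous_map (prod_topology unit_interval unit_interval) X H"
    "\<forall>s\<in>{0..1}. H (0, s) = p s \<and> H (1, s) = p' s" "\<forall>t\<in>{0..1}. H (t, 0) = p 0 \<and> H (t, 1) = p 1"
    using p unfolding path_homotopic_iff by blast
  obtain K where K: "continuous_map (prod_topology unit_interval unit_interval) X K"
    "\<forall>s\<in>{0..1}. K (0, s) = q s \<and> K (1, s) = q' s" "\<forall>t\<in>{0..1}. K (t, 0) = q 0 \<and> K (t, 1) = q 1"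
    using q unfolding path_homotopic_iff by blast
  have "continuous_map (prod_topology unit_interval unit_interval) X
      (\<lambda>z. if snd z \<le> 1/2 then H (fst z, 2 * snd z) else K (fst z, 2 * snd z - 1))"
    using H K assms(3) by (intro continuous_map_join) auto
  then show ?thesis
    unfolding path_homotopic_iff using H K
    by (intro exI conjI) (auto simp: join_loops_def)
qed

lemma pathin_join:
  assumes "pathin X p" "pathin X q" "p 1 = q 0"
  shows "pathin X (join_loops p q)"
  using assms path_homotopic_join path_homotopic_refl path_homotopic_imp_pathin by blast

lemma join_loops_ends [simp]: "join_loops p q 0 = p 0" "join_loops p q 1 = q 1"
  by (auto simp: join_loops_def)

text \<open>\<open>p\<close> is the image under \<open>F\<close> of a curve in \<open>S\<close> from \<open>x\<close> to \<open>y\<close>. The ends in \<open>S\<close> are recorded,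
  since \<open>F\<close> need not be injective.\<close>

definition factors_through :: "'b::real_normed_vector set \<Rightarrow> ('b \<Rightarrow> 'p) \<Rightarrow> 'b \<Rightarrow> 'b \<Rightarrow> (real \<Rightarrow> 'p) \<Rightarrow> bool" where
  "factors_through S F x y p \<longleftrightarrow>
     (\<exists>\<gamma>. path \<gamma> \<and> path_image \<gamma> \<subseteq> S \<and> pathstart \<gamma> = x \<and> pathfinish \<gamma> = y \<and> (\<forall>t\<in>{0..1}. p t = F (\<gamma> t)))"

text \<open>The straight line homotopy in \<open>S\<close>, composed with \<open>F\<close>. Applied to an
  interval, a square or a disc, it is the source of the homotopies below.\<close>

lemma factors_through_homotopic:
  assumes F: "continuous_map (top_of_set S) X F" and S: "convex S"
    and p: "factors_through S F x y p" and q: "factors_through S F x y q"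
  shows "path_homotopic X p q"
proof -
  obtain \<gamma> where \<gamma>: "path \<gamma>" "path_image \<gamma> \<subseteq> S" "\<gamma> 0 = x" "\<gamma> 1 = y" "\<forall>t\<in>{0..1}. p t = F (\<gamma> t)"
    using p by (auto simp: factors_through_def pathstart_def pathfinish_def)
  obtain \<delta> where \<delta>: "path \<delta>" "path_image \<delta> \<subseteq> S" "\<delta> 0 = x" "\<delta> 1 = y" "\<forall>t\<in>{0..1}. q t = F (\<delta> t)"
    using q by (auto simp: factors_through_def pathstart_def pathfinish_def)
  let ?h = "\<lambda>z. (1 - fst z) *\<^sub>R \<gamma> (snd z) + fst z *\<^sub>R \<delta> (snd z)"
  have "continuous_on ({0..1} \<times> {0..1}) (\<gamma> \<circ> snd)" "continuous_on ({0..1} \<times> {0..1}) (\<delta> \<circ> snd)"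
    using \<gamma>(1) \<delta>(1) unfolding path_def
    by (intro continuous_on_compose continuous_intros; force elim: continuous_on_subset)+
  then have "continuous_on ({0..1} \<times> {0..1}) ?h"
    by (intro continuous_intros) (auto simp: o_def)
  moreover have "?h ` ({0..1} \<times> {0..1}) \<subseteq> S"
    using \<gamma>(2) \<delta>(2) S by (force simp: path_image_def convex_alt intro!: image_eqI)
  ultimately have "continuous_map (prod_topology unit_interval unit_interval) (top_of_set S) ?h"
    by (auto simp: continuous_map_in_subtopology prod_topology_subtopology_eu image_subset_iff)
  then have "continuous_map (prod_topology unit_interval unit_interval) X (F \<circ> ?h)"
    using F continuous_map_compose by blast
  moreover have "F x = p 0" "F y = p 1"
    using \<gamma> by auto
  ultimately show ?thesis
    unfolding path_homotopic_iff using \<gamma> \<delta>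
    by (intro exI[of _ "F \<circ> ?h"] conjI) (auto simp: algebra_simps simp flip: scaleR_add_left)
qed

lemma factors_through_pathin:
  assumes "continuous_map (top_of_set S) X F" "convex S" "factors_through S F x y p"
  shows "pathin X p"
  using factors_through_homotopic[OF assms(1,2,3,3)] path_homotopic_imp_pathin by blast

lemma factors_through_join:
  assumes "factors_through S F x y p" "factors_through S F y z q"
  shows "factors_through S F x z (join_loops p q)"
proof -
  obtain \<gamma> \<delta> where "path \<gamma>" "path_image \<gamma> \<subseteq> S" "pathstart \<gamma> = x" "pathfinish \<gamma> = y" "\<forall>t\<in>{0..1}. p t = F (\<gamma> t)"
    "path \<delta>" "path_image \<delta> \<subseteq> S" "pathstart \<delta> = y" "pathfinish \<delta> = z" "\<forall>t\<in>{0..1}. q t = F (\<delta> t)"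
    using assms by (auto simp: factors_through_def)
  moreover from this have "join_loops p q t = F ((\<gamma> +++ \<delta>) t)" if "t \<in> {0..1}" for t
    using that by (auto simp: join_loops_def joinpaths_def)
  ultimately show ?thesis
    unfolding factors_through_def
    by (intro exI[of _ "\<gamma> +++ \<delta>"]) (auto simp: path_image_join)
qed

lemma factors_through_line:
  assumes "convex S" "x \<in> S" "y \<in> S" "\<And>t. t \<in> {0..1} \<Longrightarrow> p t = F ((1 - t) *\<^sub>R x + t *\<^sub>R y)"
  shows "factors_through S F x y p"
  unfolding factors_through_def
  by (rule exI[of _ "linepath x y"])
     (use assms closed_segment_subset[of x S y] in \<open>auto simp: linepath_def[of x y, THEN fun_cong]\<close>)

lemma factors_through_subpath:
  assumes "a \<in> {0..1}" "b \<in> {0..1}" "\<And>t. t \<in> {0..1} \<Longrightarrow> q t = p ((1 - t) * a + t * b)"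
  shows "factors_through {0..1} p a b q"
  using assms by (intro factors_through_line) auto

text \<open>Both sides run through the same curve, the left hand side, at different speeds.\<close>

lemma path_homotopic_assoc:
  assumes "pathin X p" "pathin X q" "pathin X r" "p 1 = q 0" "q 1 = r 0"
  shows "path_homotopic X (join_loops (join_loops p q) r) (join_loops p (join_loops q r))"
proof -
  let ?F = "join_loops (join_loops p q) r"
  have F: "continuous_map (top_of_set {0..1}) X ?F"
    using assms pathin_join[of X "join_loops p q" r] pathin_join[of X p q] by (simp add: pathin_def)
  have "factors_through {0..1} ?F 0 (1/4) p" "factors_through {0..1} ?F (1/4) (1/2) q"
    "factors_through {0..1} ?F (1/2) 1 r"
    by (rule factors_through_subpath; use assms in \<open>auto simp: join_loops_def field_simps\<close>)+
  then have "factors_through {0..1} ?F 0 1 (join_loops p (join_loops q r))"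
    by (meson factors_through_join)
  moreover have "factors_through {0..1} ?F 0 1 ?F"
    by (rule factors_through_subpath) auto
  ultimately show ?thesis
    by (intro factors_through_homotopic[OF F]) auto
qed

lemma path_homotopic_const_right:
  assumes "pathin X p" "c = p 1"
  shows "path_homotopic X (join_loops p (\<lambda>_. c)) p"
proof (rule factors_through_homotopic)
  have p: "factors_through {0..1} p 0 1 p" and "factors_through {0..1} p 1 1 (\<lambda>_. c)"
    using assms(2) by (auto intro!: factors_through_subpath)
  then show "factors_through {0..1} p 0 1 (join_loops p (\<lambda>_. c))" "factors_through {0..1} p 0 1 p"
    by (auto intro: factors_through_join)
qed (use assms in \<open>auto simp: pathin_def\<close>)

lemma path_homotopic_const_left:
  assumes "pathin X p" "c = p 0"
  shows "path_homotopic X (join_loops (\<lambda>_. c) p) p"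
proof (rule factors_through_homotopic)
  have p: "factors_through {0..1} p 0 1 p" and "factors_through {0..1} p 0 0 (\<lambda>_. c)"
    using assms(2) by (auto intro!: factors_through_subpath)
  then show "factors_through {0..1} p 0 1 (join_loops (\<lambda>_. c) p)" "factors_through {0..1} p 0 1 p"
    by (auto intro: factors_through_join)
qed (use assms in \<open>auto simp: pathin_def\<close>)

text \<open>The square is convex, so the two ways around its boundary are homotopic inside it.\<close>

lemma path_homotopic_square:
  assumes H: "continuous_map (prod_topology unit_interval unit_interval) X H"
    and p: "\<And>s. s \<in> {0..1} \<Longrightarrow> p s = H (s, 0)" and q: "\<And>s. s \<in> {0..1} \<Longrightarrow> q s = H (s, 1)"
    and l: "\<And>t. t \<in> {0..1} \<Longrightarrow> l t = H (0, t)" and m: "\<And>t. t \<in> {0..1} \<Longrightarrow> m t = H (1, t)"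
  shows "path_homotopic X (join_loops p m) (join_loops l q)"
proof (rule factors_through_homotopic)
  show "continuous_map (top_of_set ({0..1} \<times> {0..1})) X H"
    using H by (simp add: prod_topology_subtopology_eu)
  have S: "convex ({0..1::real} \<times> {0..1::real})"
    by (intro convex_Times) auto
  then show "convex ({0..1::real} \<times> {0..1::real})" .
  show "factors_through ({0..1} \<times> {0..1}) H (0, 0) (1, 1) (join_loops p m)"
    by (rule factors_through_join[of _ _ _ "(1, 0)"]; rule factors_through_line[OF S]) (use p m in auto)
  show "factors_through ({0..1} \<times> {0..1}) H (0, 0) (1, 1) (join_loops l q)"
    by (rule factors_through_join[of _ _ _ "(0, 1)"]; rule factors_through_line[OF S]) (use l q in auto)
qed

section \<open>Monodromy of a locally flat transport\<close>

text \<open>The fibres \<open>Q x\<close> with the bijections \<open>T x y\<close> are the data of a covering space: over each member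
  of the cover they form a trivial bundle, by the cocycle condition \<open>T_trans\<close>. The transport \<open>T x y\<close>
  depends only on its end points and not on the member of the cover, so that the trivializations
  agree on overlaps.\<close>

locale local_transport =
  fixes X :: "'p topology" and cover :: "'p set set" and Q :: "'p \<Rightarrow> 'q set"
    and T :: "'p \<Rightarrow> 'p \<Rightarrow> 'q \<Rightarrow> 'q"
  assumes open_cover: "U \<in> cover \<Longrightarrow> openin X U"
    and covers: "topspace X \<subseteq> \<Union>cover"
    and T_in: "\<lbrakk>U \<in> cover; x \<in> U; y \<in> U; q \<in> Q x\<rbrakk> \<Longrightarrow> T x y q \<in> Q y"
    and T_trans: "\<lbrakk>U \<in> cover; x \<in> U; y \<in> U; z \<in> U; q \<in> Q x\<rbrakk> \<Longrightarrow> T y z (T x y q) = T x z q"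
    and T_refl: "\<lbrakk>x \<in> topspace X; q \<in> Q x\<rbrakk> \<Longrightarrow> T x x q = q"
begin

text \<open>A lift is a flat section over \<open>S\<close> of the bundle pulled back along \<open>H\<close>. The uniform \<open>\<delta>\<close> is
  available because the domains of interest are compact.\<close>

definition is_lift :: "'b::metric_space set \<Rightarrow> ('b \<Rightarrow> 'p) \<Rightarrow> ('b \<Rightarrow> 'q) \<Rightarrow> bool" where
  "is_lift S H F \<longleftrightarrow> (\<forall>z\<in>S. F z \<in> Q (H z)) \<and>
     (\<exists>\<delta>>0. \<forall>z\<in>S. \<forall>z'\<in>S. dist z z' < \<delta> \<longrightarrow> F z' = T (H z) (H z') (F z))"

lemma is_lift_in: "is_lift S H F \<Longrightarrow> z \<in> S \<Longrightarrow> F z \<in> Q (H z)"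
  unfolding is_lift_def by (elim conjE) (erule bspec)

lemma is_lift_unique:
  assumes "connected S" "is_lift S H F" "is_lift S H F'" "a \<in> S" "b \<in> S" "F a = F' a"
  shows "F b = F' b"
proof -
  obtain \<delta> where \<delta>: "\<delta> > 0" "\<And>z z'. \<lbrakk>z \<in> S; z' \<in> S; dist z z' < \<delta>\<rbrakk> \<Longrightarrow> F z' = T (H z) (H z') (F z)"
    using assms(2) unfolding is_lift_def by blast
  obtain \<delta>' where \<delta>': "\<delta>' > 0" "\<And>z z'. \<lbrakk>z \<in> S; z' \<in> S; dist z z' < \<delta>'\<rbrakk> \<Longrightarrow> F' z' = T (H z) (H z') (F' z)"
    using assms(3) unfolding is_lift_def by blast
  define e where "e = min \<delta> \<delta>' / 2"
  have e: "e > 0" using \<delta>(1) \<delta>'(1) by (simp add: e_def)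
  show ?thesis
  proof (rule connected_induction_simple[of S a b "\<lambda>z. F z = F' z"])
    fix c assume c: "c \<in> S"
    have "F y = F' y" if "x \<in> S \<inter> ball c e" "y \<in> S \<inter> ball c e" "F x = F' x" for x y
    proof -
      have "dist x y \<le> dist c x + dist c y"
        by (metis dist_commute dist_triangle)
      then have "dist x y < \<delta>" "dist x y < \<delta>'"
        using that by (auto simp: e_def field_simps)
      then show ?thesis
        using \<delta>(2)[of x y] \<delta>'(2)[of x y] that by simp
    qed
    then have "\<forall>x\<in>S \<inter> ball c e. \<forall>y\<in>S \<inter> ball c e. F x = F' x \<longrightarrow> F y = F' y"
      by blast
    moreover have "openin (top_of_set S) (S \<inter> ball c e)" "c \<in> S \<inter> ball c e"
      using c e by auto
    ultimately show "\<exists>T. openin (top_of_set S) T \<and> c \<in> T \<and> (\<forall>x\<in>T. \<forall>y\<in>T. F x = F' x \<longrightarrow> F y = F' y)"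
      by (intro exI[of _ "S \<inter> ball c e"] conjI)
  qed (use assms in auto)
qed

lemma is_lift_compose:
  assumes "is_lift S H F" "\<And>z. z \<in> S' \<Longrightarrow> f z \<in> S" "\<And>z. z \<in> S' \<Longrightarrow> H' z = H (f z)"
    "\<And>z. z \<in> S' \<Longrightarrow> F' z = F (f z)" "\<And>z z'. dist (f z) (f z') \<le> dist z z'"
  shows "is_lift S' H' F'"
proof -
  obtain \<delta> where \<delta>: "\<delta> > 0" "\<And>z z'. \<lbrakk>z \<in> S; z' \<in> S; dist z z' < \<delta>\<rbrakk> \<Longrightarrow> F z' = T (H z) (H z') (F z)"
    using assms(1) unfolding is_lift_def by blast
  have "F' z' = T (H' z) (H' z') (F' z)" if "z \<in> S'" "z' \<in> S'" "dist z z' < \<delta>" for z z'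
    using \<delta>(2)[of "f z" "f z'"] assms(2-4) le_less_trans[OF assms(5) that(3)] that by metis
  moreover have "F' z \<in> Q (H' z)" if "z \<in> S'" for z
    using assms(1-4) that unfolding is_lift_def by metis
  ultimately show ?thesis
    unfolding is_lift_def using \<delta>(1) by blast
qed

lemma lebesgue_number:
  fixes S :: "'b::metric_space set"
  assumes S: "compact S" and H: "continuous_map (top_of_set S) X H" and "S \<noteq> {}"
  obtains e where "e > 0" "\<And>A. \<lbrakk>A \<subseteq> S; diameter A < e\<rbrakk> \<Longrightarrow> \<exists>U\<in>cover. H ` A \<subseteq> U"
proof -
  let ?C = "{W. open W \<and> (\<exists>U\<in>cover. H ` (S \<inter> W) \<subseteq> U)}"
  have "\<exists>W\<in>?C. z \<in> W" if z: "z \<in> S" for z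
  proof -
    have "H z \<in> topspace X"
      using H z continuous_map_image_subset_topspace by fastforce
    then obtain U where U: "U \<in> cover" "H z \<in> U"
      using covers by blast
    have "openin (top_of_set S) {z \<in> S. H z \<in> U}"
      using openin_continuous_map_preimage[OF H open_cover[OF U(1)]] by simp
    then obtain W where "open W" "{z \<in> S. H z \<in> U} = S \<inter> W"
      by (auto simp: openin_open)
    then show ?thesis
      using U z by (intro bexI[of _ W]) auto
  qed
  then have sub: "S \<subseteq> \<Union>?C"
    by (meson UnionI subsetI)
  with \<open>S \<noteq> {}\<close> have "?C \<noteq> {}"
    by (metis Union_empty subset_empty)
  with sub obtain e where e: "0 < e" "\<And>A. \<lbrakk>A \<subseteq> S; diameter A < e\<rbrakk> \<Longrightarrow> \<exists>W\<in>?C. A \<subseteq> W"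
    using Lebesgue_number_lemma[OF S, of ?C] by (metis (mono_tags, lifting) mem_Collect_eq)
  show ?thesis
  proof (rule that[OF e(1)])
    fix A assume A: "A \<subseteq> S" "diameter A < e"
    then obtain W U where "U \<in> cover" "H ` (S \<inter> W) \<subseteq> U" "A \<subseteq> W"
      using e(2)[OF A] by auto
    moreover have "H ` A \<subseteq> H ` (S \<inter> W)"
      using A(1) \<open>A \<subseteq> W\<close> by (intro image_mono) simp
    ultimately show "\<exists>U\<in>cover. H ` A \<subseteq> U"
      by (meson order_trans)
  qed
qed

text \<open>From \<open>a\<close> one goes to \<open>z\<close> in \<open>n\<close> equal steps along the segment and transports \<open>q\<close> at each step.
  If \<open>n\<close> is large enough for the Lebesgue number of the cover, corresponding steps towards two close
  points \<open>z\<close> and \<open>z'\<close> form small quadrilaterals, each inside one member of the cover, where transport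
  is path independent. The quadrilaterals add up to the claim for \<open>z\<close> and \<open>z'\<close>.\<close>

lemma is_lift_exists:
  fixes S :: "'b::real_normed_vector set"
  assumes S: "compact S" "convex S" and H: "continuous_map (top_of_set S) X H"
    and a: "a \<in> S" and q: "q \<in> Q (H a)"
  obtains F where "is_lift S H F" "F a = q"
proof -
  obtain e where e: "e > 0" "\<And>A. \<lbrakk>A \<subseteq> S; diameter A < e\<rbrakk> \<Longrightarrow> \<exists>U\<in>cover. H ` A \<subseteq> U"
    using lebesgue_number[OF S(1) H] a by blast
  have Hx: "H z \<in> topspace X" if "z \<in> S" for z
    using H that continuous_map_image_subset_topspace by fastforce
  obtain D where D: "\<And>z. z \<in> S \<Longrightarrow> norm (z - a) \<le> D"
    using compact_imp_bounded[OF S(1)] by (metis bounded_any_center dist_commute dist_norm)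
  \<comment> \<open>Steps of length \<open>D / n\<close> are shorter than a quarter of the Lebesgue number.\<close>
  obtain n :: nat where n: "D < real n * (e / 4)" "n > 0"
  proof -
    obtain m :: nat where "D < real m * (e / 4)"
      using reals_Archimedean3[of "e / 4"] e(1) by fastforce
    then have "D < real (Suc m) * (e / 4)"
      using e(1) by (simp add: algebra_simps)
    then show ?thesis by (rule that) simp
  qed
  define pt where "pt z i = (1 - real i / real n) *\<^sub>R a + (real i / real n) *\<^sub>R z" for z i
  have pt_S: "pt z i \<in> S" if "z \<in> S" "i \<le> n" for z i
    unfolding pt_def using that n a S(2) by (intro convexD_alt) (auto simp: field_simps)
  have pt_dist: "dist (pt z i) (pt z' i) \<le> dist z z'" if "i \<le> n" for z z' i
  proof -
    have "dist (pt z i) (pt z' i) = (real i / real n) * dist z z'"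
      by (simp add: pt_def dist_norm flip: scaleR_diff_right)
    also have "\<dots> \<le> 1 * dist z z'"
      using that n by (intro mult_right_mono) (auto simp: field_simps)
    finally show ?thesis by simp
  qed
  have pt_step: "dist (pt z i) (pt z (Suc i)) < e / 4" if "z \<in> S" for z i
  proof -
    have "pt z (Suc i) - pt z i = (1 / real n) *\<^sub>R (z - a)"
      by (simp add: pt_def algebra_simps add_divide_distrib)
    then have "dist (pt z i) (pt z (Suc i)) = norm (z - a) / n"
      by (metis dist_commute dist_norm norm_scaleR abs_divide abs_of_nat abs_one mult.commute mult_1 times_divide_eq_right)
    also have "\<dots> < e / 4"
      using D[OF that] n by (simp add: field_simps)
    finally show ?thesis .
  qed
  \<comment> \<open>The diagonals are shorter than \<open>e / 2\<close>.\<close>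
  have square: "\<exists>U\<in>cover. H (pt z i) \<in> U \<and> H (pt z (Suc i)) \<in> U \<and> H (pt z' i) \<in> U \<and> H (pt z' (Suc i)) \<in> U"
    if z: "z \<in> S" "z' \<in> S" "dist z z' < e / 4" "Suc i \<le> n" for z z' i
  proof -
    let ?A = "{pt z i, pt z (Suc i), pt z' i, pt z' (Suc i)}"
    have d: "dist (pt z i) (pt z (Suc i)) < e / 4" "dist (pt z' i) (pt z' (Suc i)) < e / 4"
      "dist (pt z i) (pt z' i) < e / 4" "dist (pt z (Suc i)) (pt z' (Suc i)) < e / 4"
      using pt_step[of z i] pt_step[of z' i] pt_dist[of i z z'] pt_dist[of "Suc i" z z'] z by auto
    then have d': "dist (pt z i) (pt z' (Suc i)) < e / 2" "dist (pt z (Suc i)) (pt z' i) < e / 2"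
      using dist_triangle[of "pt z i" "pt z' (Suc i)" "pt z' i"]
        dist_triangle[of "pt z (Suc i)" "pt z' i" "pt z i"] by (auto simp: dist_commute)
    have "diameter ?A \<le> e / 2"
    proof (rule diameter_le)
      fix x y assume "x \<in> ?A" "y \<in> ?A"
      then show "norm (x - y) \<le> e / 2"
        using d d' e(1) by (auto simp: dist_norm norm_minus_commute)
    qed simp
    then show ?thesis
      using e(2)[of ?A] e(1) pt_S z by auto
  qed
  define F where "F z i = rec_nat q (\<lambda>i r. T (H (pt z i)) (H (pt z (Suc i))) r) i" for z i
  have F_simps: "F z 0 = q" "F z (Suc i) = T (H (pt z i)) (H (pt z (Suc i))) (F z i)" for z i
    by (simp_all add: F_def)
  have pt0: "pt z 0 = a" for z
    by (simp add: pt_def)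
  have F_in: "F z i \<in> Q (H (pt z i))" if "z \<in> S" "i \<le> n" for z i
    using that(2)
  proof (induction i)
    case 0
    then show ?case by (simp add: F_simps pt0 q)
  next
    case (Suc i)
    then show ?case
      using square[of z z i] that(1) e(1) T_in by (fastforce simp: F_simps)
  qed
  have F_near: "F z' i = T (H (pt z i)) (H (pt z' i)) (F z i)"
    if z: "z \<in> S" "z' \<in> S" "dist z z' < e / 4" and "i \<le> n" for z z' i
    using that(4)
  proof (induction i)
    case 0
    then show ?case by (simp add: F_simps pt0 q T_refl Hx a)
  next
    case (Suc i)
    obtain U where U: "U \<in> cover" "H (pt z i) \<in> U" "H (pt z (Suc i)) \<in> U" "H (pt z' i) \<in> U" "H (pt z' (Suc i)) \<in> U"
      using square[OF z Suc.prems] by blast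
    have in_Q: "F z i \<in> Q (H (pt z i))"
      using F_in Suc.prems z by simp
    have "F z' (Suc i) = T (H (pt z' i)) (H (pt z' (Suc i))) (T (H (pt z i)) (H (pt z' i)) (F z i))"
      using Suc by (simp add: F_simps)
    also have "\<dots> = T (H (pt z (Suc i))) (H (pt z' (Suc i))) (T (H (pt z i)) (H (pt z (Suc i))) (F z i))"
      using T_trans[OF U(1,2,4,5) in_Q] T_trans[OF U(1,2,3,5) in_Q] by simp
    finally show ?case by (simp add: F_simps)
  qed
  have ptn: "pt z n = z" for z
    using n by (simp add: pt_def)
  show ?thesis
  proof
    show "is_lift S H (\<lambda>z. F z n)"
      unfolding is_lift_def
    proof (intro conjI ballI exI[of _ "e / 4"] impI)
      show "F z n \<in> Q (H z)" if "z \<in> S" for z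
        using F_in[OF that order_refl] by (simp add: ptn)
      show "F z' n = T (H z) (H z') (F z n)" if "z \<in> S" "z' \<in> S" "dist z z' < e / 4" for z z'
        using F_near[OF that order_refl] by (simp add: ptn)
    qed (use e(1) in simp)
    have "pt a i = a" for i by (simp add: pt_def flip: scaleR_add_left)
    have "F a i = q" if "i \<le> n" for i
      using that q Hx[OF a] \<open>\<And>i. pt a i = a\<close> by (induction i) (auto simp: F_simps T_refl)
    then show "F a n = q" by simp
  qed
qed

definition carries :: "(real \<Rightarrow> 'p) \<Rightarrow> 'q \<Rightarrow> 'q \<Rightarrow> bool" where
  "carries p q q' \<longleftrightarrow> (\<exists>F. is_lift {0..1} p F \<and> F 0 = q \<and> F 1 = q')"

lemma carries_unique: "carries p q r \<Longrightarrow> carries p q r' \<Longrightarrow> r = r'"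
proof -
  assume "carries p q r" "carries p q r'"
  then obtain F F' where "is_lift {0..1} p F" "is_lift {0..1} p F'" "F 0 = q" "F' 0 = q" "F 1 = r" "F' 1 = r'"
    unfolding carries_def by (elim exE conjE)
  then show "r = r'"
    using is_lift_unique[of "{0..1::real}" p F F' 0 1] by simp
qed

lemma carries_join:
  assumes p: "pathin X p" and p': "pathin X p'" "p 1 = p' 0" and c: "carries p q r" "carries p' r s"
  shows "carries (join_loops p p') q s"
proof -
  obtain F1 where F1: "is_lift {0..1} p F1" "F1 0 = q" "F1 1 = r"
    using c(1) by (auto simp: carries_def)
  obtain F2 where F2: "is_lift {0..1} p' F2" "F2 0 = r" "F2 1 = s"
    using c(2) by (auto simp: carries_def)
  have "continuous_map (top_of_set {0..1}) X (join_loops p p')"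
    using pathin_join[OF p p'] by (simp add: pathin_def)
  moreover have "q \<in> Q (join_loops p p' 0)"
    using is_lift_in[OF F1(1), of 0] F1(2) by simp
  ultimately obtain F where F: "is_lift {0..1} (join_loops p p') F" "F 0 = q"
    using is_lift_exists[of "{0..1::real}" "join_loops p p'" 0 q] by auto
  have dist: "dist (z / 2 :: real) (z' / 2) \<le> dist z z'" "dist ((z + 1) / 2 :: real) ((z' + 1) / 2) \<le> dist z z'"
    for z z' by (auto simp: dist_real_def abs_if field_simps)
  have "is_lift {0..1} p (\<lambda>z. F (z / 2))"
    by (rule is_lift_compose[OF F(1), where f = "\<lambda>z. z / 2"])
       (use dist(1) in \<open>auto simp: join_loops_def\<close>)
  then have "F (1 / 2) = r"
    using is_lift_unique[of "{0..1::real}" p "\<lambda>z. F (z / 2)" F1 0 1] F1 F(2) by simp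
  moreover have "is_lift {0..1} p' (\<lambda>z. F ((z + 1) / 2))"
    by (rule is_lift_compose[OF F(1), where f = "\<lambda>z. (z + 1) / 2"])
       (use p'(2) dist(2) in \<open>auto simp: join_loops_def field_simps\<close>)
  ultimately have "F 1 = s"
    using is_lift_unique[of "{0..1::real}" p' "\<lambda>z. F ((z + 1) / 2)" F2 0 1] F2 by simp
  then show ?thesis
    unfolding carries_def using F by blast
qed

lemma is_lift_const: "x \<in> topspace X \<Longrightarrow> q \<in> Q x \<Longrightarrow> is_lift S (\<lambda>_. x) (\<lambda>_. q)"
  unfolding is_lift_def by (auto simp: T_refl intro!: exI[of _ 1])

text \<open>A lift over the unit square restricts to lifts over its four sides, and it is constant on the two
  sides on which the homotopy is.\<close>

lemma carries_homotopic:
  assumes "path_homotopic X p p'" "carries p q r"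
  shows "carries p' q r"
proof -
  obtain H where H: "continuous_map (prod_topology unit_interval unit_interval) X H"
    "\<forall>s\<in>{0..1}. H (0, s) = p s \<and> H (1, s) = p' s" "\<forall>t\<in>{0..1}. H (t, 0) = p 0 \<and> H (t, 1) = p 1"
    using assms(1) unfolding path_homotopic_iff by blast
  obtain F1 where F1: "is_lift {0..1} p F1" "F1 0 = q" "F1 1 = r"
    using assms(2) by (auto simp: carries_def)
  have pq: "p 0 \<in> topspace X" "p 1 \<in> topspace X" "q \<in> Q (p 0)" "r \<in> Q (p 1)"
    using path_homotopic_imp_pathin(1)[OF assms(1)] is_lift_in[OF F1(1), of 0] is_lift_in[OF F1(1), of 1] F1(2,3)
    by (auto simp: path_start_in_topspace path_finish_in_topspace)
  let ?S = "{0..1::real} \<times> {0..1::real}"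
  have "compact ?S" "convex ?S"
    by (auto intro!: compact_Times convex_Times)
  moreover have "continuous_map (top_of_set ?S) X H" "q \<in> Q (H (0, 0))"
    using H pq by (auto simp: prod_topology_subtopology_eu)
  ultimately obtain F where F: "is_lift ?S H F" "F (0, 0) = q"
    using is_lift_exists[of ?S H "(0, 0)" q] by auto
  have row: "is_lift {0..1} (\<lambda>s. H (c, s)) (\<lambda>s. F (c, s))"
    and col: "is_lift {0..1} (\<lambda>s. H (s, c)) (\<lambda>s. F (s, c))" if "c \<in> {0..1}" for c
    using that
    by (auto intro: is_lift_compose[OF F(1), where f = "\<lambda>s. (c, s)"]
        is_lift_compose[OF F(1), where f = "\<lambda>s. (s, c)"] simp: dist_Pair_Pair)
  have const: "F (1, c) = F (0, c)" if "c \<in> {0..1}" "x \<in> topspace X" "F (0, c) \<in> Q x"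
    "\<And>s. s \<in> {0..1} \<Longrightarrow> H (s, c) = x" for c x
  proof -
    have "is_lift {0..1::real} (\<lambda>_. x) (\<lambda>s. F (s, c))"
      using col[OF that(1)] that(4) by (auto intro: is_lift_compose[where f = id])
    then show ?thesis
      using is_lift_unique[OF _ _ is_lift_const[OF that(2,3)], of "{0..1::real}" "\<lambda>s. F (s, c)" 0 1]
      by simp
  qed
  have "is_lift {0..1} p (\<lambda>s. F (0, s))"
    using row[of 0] H(2) by (auto intro: is_lift_compose[where f = id])
  then have "F (0, 1) = r"
    using is_lift_unique[of "{0..1::real}" p "\<lambda>s. F (0, s)" F1 0 1] F1 F(2) by simp
  then have "F (1, 0) = q" "F (1, 1) = r"
    using const[of 0 "p 0"] const[of 1 "p 1"] H(3) F(2) pq by auto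
  moreover have "is_lift {0..1} p' (\<lambda>s. F (1, s))"
    using row[of 1] H(2) by (auto intro: is_lift_compose[where f = id])
  ultimately show ?thesis
    unfolding carries_def by blast
qed

end

section \<open>Deformations and the topology of a graph\<close>

text \<open>The tube lemma: the complement is the projection of a closed set along the compact factor
  \<open>{\<alpha>..\<beta>}\<close>.\<close>

lemma openin_tube:
  fixes \<alpha> \<beta> :: real
  assumes F: "continuous_map (prod_topology Y unit_interval) Z F" and U: "openin Z U"
    and "0 \<le> \<alpha>" "\<beta> \<le> 1"
  shows "openin Y {y \<in> topspace Y. \<forall>t\<in>{\<alpha>..\<beta>}. F (y, t) \<in> U}"
proof -
  let ?J = "top_of_set {\<alpha>..\<beta>}"
  let ?C = "{z \<in> topspace (prod_topology Y ?J). F z \<notin> U}"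
  have "?J = subtopology unit_interval {\<alpha>..\<beta>}"
    using assms(3,4) by (auto simp: subtopology_subtopology intro!: arg_cong[where f = top_of_set])
  then have "prod_topology Y ?J = subtopology (prod_topology Y unit_interval) (topspace Y \<times> {\<alpha>..\<beta>})"
    by (simp add: subtopology_Times)
  then have "continuous_map (prod_topology Y ?J) Z F"
    by (simp add: F continuous_map_from_subtopology)
  then have "openin (prod_topology Y ?J) {z \<in> topspace (prod_topology Y ?J). F z \<in> U}"
    using U by (rule openin_continuous_map_preimage)
  then have "closedin (prod_topology Y ?J)
      (topspace (prod_topology Y ?J) - {z \<in> topspace (prod_topology Y ?J). F z \<in> U})"
    by blast
  also have "topspace (prod_topology Y ?J) - {z \<in> topspace (prod_topology Y ?J). F z \<in> U} = ?C"
    by blast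
  finally have "closedin Y (fst ` ?C)"
    using closed_map_fst[of ?J Y] by (auto simp: closed_map_def compact_space_subtopology)
  then have "openin Y (topspace Y - fst ` ?C)"
    by blast
  also have "topspace Y - fst ` ?C = {y \<in> topspace Y. \<forall>t\<in>{\<alpha>..\<beta>}. F (y, t) \<in> U}"
    by force
  finally show ?thesis .
qed

text \<open>Joint continuity of a deformation in point and time is reduced to the openness of the sets
  of points that stay in \<open>U\<close> during a closed time interval. Openness in a weak topology is tested cell by
  cell, and on each cell \<open>openin_tube\<close> applies. This argument is why a product of a quotient map with the
  identity of a compact interval is again a quotient map.\<close>

lemma continuous_map_deformation:
  fixes D :: "'x \<Rightarrow> real \<Rightarrow> 'z"
  assumes A: "A \<subseteq> topspace X"
    and cont: "\<And>x. x \<in> A \<Longrightarrow> continuous_map unit_interval Z (D x)"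
    and opn: "\<And>U \<alpha> \<beta>. \<lbrakk>openin Z U; 0 \<le> \<alpha>; \<alpha> \<le> \<beta>; \<beta> \<le> 1\<rbrakk> \<Longrightarrow> openin X {x \<in> A. \<forall>t\<in>{\<alpha>..\<beta>}. D x t \<in> U}"
  shows "continuous_map (prod_topology (subtopology X A) unit_interval) Z (\<lambda>(x, t). D x t)"
proof -
  let ?P = "prod_topology (subtopology X A) unit_interval"
  have top: "topspace ?P = A \<times> {0..1}"
    using A by auto
  have "openin ?P {z \<in> topspace ?P. (case z of (x, t) \<Rightarrow> D x t) \<in> U}" if U: "openin Z U" for U
    unfolding openin_prod_topology_alt
  proof (intro allI impI)
    fix x t assume "(x, t) \<in> {z \<in> topspace ?P. (case z of (x, t) \<Rightarrow> D x t) \<in> U}"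
    then have x: "x \<in> A" and t: "t \<in> {0..1}" and DU: "D x t \<in> U"
      by (auto simp: top)
    have "openin unit_interval {t \<in> {0..1}. D x t \<in> U}"
      using openin_continuous_map_preimage[OF cont[OF x] U] by simp
    then obtain e where e: "e > 0" "\<And>s. s \<in> {0..1} \<Longrightarrow> dist s t < e \<Longrightarrow> D x s \<in> U"
      using t DU unfolding openin_euclidean_subtopology_iff by blast
    \<comment> \<open>a closed interval around \<open>t\<close>, as compactness of the time interval makes the set below open\<close>
    define \<alpha> \<beta> where "\<alpha> = max 0 (t - e / 2)" and "\<beta> = min 1 (t + e / 2)"
    have ab: "0 \<le> \<alpha>" "\<alpha> \<le> \<beta>" "\<beta> \<le> 1"
      using t e(1) by (auto simp: \<alpha>_def \<beta>_def)
    have "openin (subtopology X A) {x \<in> A. \<forall>t\<in>{\<alpha>..\<beta>}. D x t \<in> U}"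
      using opn[OF U ab] by (metis (no_types, lifting) inf.absorb_iff2 mem_Collect_eq openin_subtopology_Int2 subsetI)
    moreover have "openin unit_interval ({0..1} \<inter> ball t (e / 2))"
      by auto
    moreover have "D x s \<in> U" if "s \<in> {\<alpha>..\<beta>}" for s
      using that ab e by (intro e(2)) (auto simp: \<alpha>_def \<beta>_def dist_real_def)
    moreover have "{0..1} \<inter> ball t (e / 2) \<subseteq> {\<alpha>..\<beta>}"
      by (auto simp: \<alpha>_def \<beta>_def dist_real_def abs_if field_simps split: if_splits)
    ultimately show "\<exists>V W. openin (subtopology X A) V \<and> openin unit_interval W \<and> x \<in> V \<and> t \<in> W \<and>
        V \<times> W \<subseteq> {z \<in> topspace ?P. (case z of (x, t) \<Rightarrow> D x t) \<in> U}"
      using x t e(1) A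
      by (intro exI[of _ "{x \<in> A. \<forall>t\<in>{\<alpha>..\<beta>}. D x t \<in> U}"] exI[of _ "{0..1} \<inter> ball t (e / 2)"])
         (auto simp: top simp del: Int_iff)
  qed
  moreover have "D x t \<in> topspace Z" if "x \<in> A" "t \<in> {0..1}" for x t
    using cont[OF that(1)] that(2) continuous_map_image_subset_topspace by fastforce
  ultimately show ?thesis
    unfolding continuous_map by (auto simp: top)
qed

lemma continuous_map_deformation_along:
  assumes D: "continuous_map (prod_topology (subtopology X A) unit_interval) Z (\<lambda>(x, t). D x t)"
    and p: "pathin X p" "\<And>s. s \<in> {0..1} \<Longrightarrow> p s \<in> A"
  shows "continuous_map (prod_topology unit_interval unit_interval) Z (\<lambda>(s, t). D (p s) t)"
proof -
  have "continuous_map unit_interval (subtopology X A) p"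
    using p by (auto simp: pathin_def continuous_map_in_subtopology)
  then have "continuous_map (prod_topology unit_interval unit_interval)
      (prod_topology (subtopology X A) unit_interval) (\<lambda>(s, t). (p s, t))"
    by (subst continuous_map_prod_top) simp
  from continuous_map_compose[OF this D] show ?thesis
    by (simp add: o_def case_prod_unfold)
qed

lemma vertex_point_apply: "vertex_point a x = (if x = a then 1 else 0)"
  by (simp add: vertex_point_def)

lemma edge_point_apply:
  "edge_point a b s x = (1 - s) * (if x = a then 1 else 0) + s * (if x = b then 1 else 0)"
  by (simp add: edge_point_def vertex_point_apply)

lemma edge_point_commute: "edge_point a b s = edge_point b a (1 - s)"
  by (auto simp: edge_point_apply fun_eq_iff)

lemma edge_point_ends [simp]:
  "edge_point a b 0 = vertex_point a" "edge_point a b 1 = vertex_point b" "edge_point a a s = vertex_point a"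
  by (auto simp: edge_point_apply vertex_point_apply fun_eq_iff)

lemma edge_point_in: "{a, b} \<in> E \<Longrightarrow> s \<in> {0..1} \<Longrightarrow> edge_point a b s \<in> graph_points V E"
  unfolding graph_points_def by blast

lemma edge_point_continuous:
  assumes "{a, b} \<in> E"
  shows "continuous_map unit_interval (graph_space V E) (edge_point a b)"
  using assms edge_point_in[OF assms] by (auto simp: continuous_map openin_graph_space topspace_graph_space)

lemma edge_point_pos:
  assumes "s \<in> {0..1}" "edge_point a b s x > 0" shows "x = a \<or> x = b"
  using assms by (auto simp: edge_point_apply split: if_splits)

text \<open>If \<open>y\<close> lies on an edge at \<open>a\<close>, the line stays on that edge, so these lines contract the star of \<open>a\<close>.\<close>

definition line_to :: "('a \<Rightarrow> real) \<Rightarrow> 'a \<Rightarrow> real \<Rightarrow> 'a \<Rightarrow> real" where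
  "line_to y a t = (\<lambda>x. (1 - t) * y x + t * vertex_point a x)"

lemma line_to_ends [simp]: "line_to y a 0 = y" "line_to y a 1 = vertex_point a"
  by (auto simp: line_to_def)

lemma line_to_edge_point: "line_to (edge_point b a s) a t = edge_point b a (1 - (1 - t) * (1 - s))"
  by (auto simp: line_to_def edge_point_apply vertex_point_apply fun_eq_iff algebra_simps)

lemma line_to_edge_point': "line_to (edge_point a b s) a t = edge_point a b ((1 - t) * s)"
  by (auto simp: line_to_def edge_point_apply vertex_point_apply fun_eq_iff algebra_simps)

lemma line_to_vertex_point: "line_to (vertex_point b) a t = edge_point b a t"
  by (simp add: line_to_def edge_point_def)

locale graph =
  fixes V :: "'a set" and E :: "'a set set"
  assumes simple: "simple_graph V E"
begin

lemma edge_in: "{a, b} \<in> E \<Longrightarrow> a \<in> V \<and> b \<in> V \<and> a \<noteq> b"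
  using simple by (auto simp: simple_graph_def)

lemma graph_point_cases:
  assumes "y \<in> graph_points V E" "y a > 0"
  shows "a \<in> V \<and> (y = vertex_point a \<or> (\<exists>b s. {a, b} \<in> E \<and> s \<in> {0..<1} \<and> y = edge_point a b s))"
  using assms(1) unfolding graph_points_def
proof
  assume "y \<in> vertex_point ` V"
  then show ?thesis
    using assms(2) by (auto simp: vertex_point_apply split: if_splits)
next
  assume "y \<in> {edge_point c d s |c d s. {c, d} \<in> E \<and> s \<in> {0..1}}"
  then obtain c d s where y: "y = edge_point c d s" "{c, d} \<in> E" "s \<in> {0..1}"
    by blast
  then have "a = c \<or> a = d"
    using assms(2) edge_point_pos by metis
  moreover have "c \<in> V" "d \<in> V" "c \<noteq> d"
    using edge_in y by auto
  moreover have "s < 1" if "a = c"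
    using that assms(2) y \<open>c \<noteq> d\<close> by (auto simp: edge_point_apply)
  moreover have "0 < s" if "a = d"
    using that assms(2) y \<open>c \<noteq> d\<close> by (auto simp: edge_point_apply)
  moreover have "{d, c} \<in> E" "y = edge_point d c (1 - s)"
    using y edge_point_commute[of c d s] by (auto simp: insert_commute)
  ultimately show ?thesis
    using y by (metis atLeastAtMost_iff atLeastLessThan_iff diff_ge_0_iff_ge diff_less_eq less_add_same_cancel1)
qed

lemma graph_point_ex_pos:
  assumes "y \<in> graph_points V E" obtains a where "y a > 0"
  using assms unfolding graph_points_def
proof
  assume "y \<in> {edge_point c d s |c d s. {c, d} \<in> E \<and> s \<in> {0..1}}"
  then obtain c d s where y: "y = edge_point c d s" "{c, d} \<in> E" "s \<in> {0..1}"
    by blast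
  then have "y c > 0 \<or> y d > 0"
    using edge_in[OF y(2)] by (auto simp: edge_point_apply)
  then show ?thesis using that by blast
qed (use that in \<open>auto simp: vertex_point_apply split: if_splits\<close>)

lemma graph_point_two_pos:
  assumes "y \<in> graph_points V E" "y a > 0" "y b > 0" "a \<noteq> b"
  obtains s where "{a, b} \<in> E" "s \<in> {0..1}" "y = edge_point a b s"
proof -
  have "y \<noteq> vertex_point a"
    using assms by (auto simp: vertex_point_apply)
  then obtain c s where y: "{a, c} \<in> E" "s \<in> {0..<1}" "y = edge_point a c s"
    using graph_point_cases[OF assms(1,2)] by auto
  then have "c = b"
    using assms edge_point_pos[of s a c b] by auto
  then show ?thesis
    using that[of s] y by simp
qed

definition star :: "'a \<Rightarrow> ('a \<Rightarrow> real) set" where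
  "star a = {y \<in> graph_points V E. y a > 0}"

lemma star_subset: "star a \<subseteq> topspace (graph_space V E)"
  by (auto simp: star_def topspace_graph_space)

lemma star_eq_or_adjacent:
  assumes "y \<in> star a" "y \<in> star b" shows "a = b \<or> {a, b} \<in> E"
  using assms graph_point_two_pos by (metis (mono_tags, lifting) mem_Collect_eq star_def)

lemma star_V: "y \<in> star a \<Longrightarrow> a \<in> V"
  using graph_point_cases by (auto simp: star_def)

lemma star_two_eq:
  assumes "y \<in> star a" "y \<in> star b" "y \<in> star c" "a \<noteq> b" shows "c = a \<or> c = b"
proof -
  obtain s where "s \<in> {0..1}" "y = edge_point a b s"
    using assms graph_point_two_pos[of y a b] by (auto simp: star_def)
  then show ?thesis
    using assms edge_point_pos[of s a b c] by (auto simp: star_def)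
qed

lemma openin_deformed_star:
  assumes U: "openin (graph_space V E) U" and ab: "0 \<le> \<alpha>" "\<beta> \<le> 1"
  shows "openin (graph_space V E) {y \<in> star a. \<forall>t\<in>{\<alpha>..\<beta>}. line_to y a t \<in> U}"
  unfolding openin_graph_space
proof (intro conjI allI impI)
  let ?W = "{y \<in> star a. \<forall>t\<in>{\<alpha>..\<beta>}. line_to y a t \<in> U}"
  show "?W \<subseteq> graph_points V E"
    by (auto simp: star_def)
  have key: "openin unit_interval {s \<in> {0..1}. edge_point a d s \<in> ?W}" if d: "{a, d} \<in> E" for d
  proof -
    have "continuous_map (prod_topology unit_interval unit_interval) unit_interval (\<lambda>z. (1 - snd z) * fst z)"
      by (auto simp: prod_topology_subtopology_eu continuous_map_in_subtopology mult_le_one intro!: continuous_intros)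
    from continuous_map_compose[OF this edge_point_continuous[OF d]]
    have cont: "continuous_map (prod_topology unit_interval unit_interval) (graph_space V E)
        (\<lambda>z. edge_point a d ((1 - snd z) * fst z))"
      by (simp add: o_def)
    have "openin unit_interval {s \<in> {0..1}. \<forall>t\<in>{\<alpha>..\<beta>}. edge_point a d ((1 - t) * s) \<in> U}"
      using openin_tube[OF cont U ab] by simp
    moreover have "openin unit_interval ({0..1} \<inter> {..<1})"
      by (simp add: openin_open_Int)
    ultimately have "openin unit_interval
      ({s \<in> {0..1}. \<forall>t\<in>{\<alpha>..\<beta>}. edge_point a d ((1 - t) * s) \<in> U} \<inter> ({0..1} \<inter> {..<1}))"
      by (rule openin_Int)
    also have "{s \<in> {0..1}. \<forall>t\<in>{\<alpha>..\<beta>}. edge_point a d ((1 - t) * s) \<in> U} \<inter> ({0..1} \<inter> {..<1})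
        = {s \<in> {0..1}. edge_point a d s \<in> ?W}"
      using edge_in[OF d] edge_point_in[OF d]
      by (auto simp: star_def line_to_edge_point' edge_point_apply[of _ _ _ a])
    finally show ?thesis .
  qed
  fix c d assume cd: "{c, d} \<in> E"
  consider "a = c" | "a = d" | "a \<noteq> c" "a \<noteq> d" by blast
  then show "openin unit_interval {s \<in> {0..1}. edge_point c d s \<in> ?W}"
  proof cases
    case 1
    then show ?thesis using key cd by simp
  next
    case 2
    have "continuous_map unit_interval unit_interval (\<lambda>s. 1 - s)"
      by (auto simp: continuous_map_in_subtopology intro!: continuous_intros)
    from openin_continuous_map_preimage[OF this key[of c]]
    have "openin unit_interval {s \<in> {0..1}. edge_point a c (1 - s) \<in> ?W}"
      using 2 cd by (simp add: insert_commute Collect_conj_eq[symmetric] cong: conj_cong)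
    then show ?thesis
      using 2 edge_point_commute[of c d] by simp
  next
    case 3
    then have empty: "{s \<in> {0..1}. edge_point c d s \<in> ?W} = {}"
      by (auto simp: star_def edge_point_apply)
    show ?thesis unfolding empty by simp
  qed
qed

lemma openin_star: "openin (graph_space V E) (star a)"
  using openin_deformed_star[OF openin_topspace, of 1 0 a] by simp

lemma line_to_pathin:
  assumes "y \<in> star a"
  shows "pathin (graph_space V E) (line_to y a)"
proof -
  have a: "a \<in> V" and cases: "y = vertex_point a \<or> (\<exists>b s. {a, b} \<in> E \<and> s \<in> {0..<1} \<and> y = edge_point a b s)"
    using graph_point_cases assms by (auto simp: star_def)
  from cases show ?thesis
  proof (elim disjE exE conjE)
    assume "y = vertex_point a"
    then have "line_to y a = (\<lambda>_. vertex_point a)"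
      by (auto simp: line_to_vertex_point)
    then show ?thesis
      using a by (simp add: topspace_graph_space graph_points_def)
  next
    fix b s assume y: "{a, b} \<in> E" "s \<in> {0..<1}" "y = edge_point a b s"
    have "continuous_map unit_interval unit_interval (\<lambda>t. (1 - t) * s)"
      using y(2) by (auto simp: continuous_map_in_subtopology mult_le_one intro!: continuous_intros)
    note cont = continuous_map_compose[OF this edge_point_continuous[OF y(1), of V]]
    show ?thesis
    proof -
      have "line_to (edge_point a b s) a = (\<lambda>t. edge_point a b ((1 - t) * s))"
        by (rule ext) (rule line_to_edge_point')
      with cont show ?thesis
        by (simp add: pathin_def y(3) o_def)
    qed
  qed
qed

lemma line_to_continuous:
  "continuous_map (prod_topology (subtopology (graph_space V E) (star a)) unit_interval) (graph_space V E)
     (\<lambda>(y, t). line_to y a t)"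
proof (rule continuous_map_deformation)
  show "star a \<subseteq> topspace (graph_space V E)"
    by (rule star_subset)
  show "continuous_map unit_interval (graph_space V E) (line_to y a)" if "y \<in> star a" for y
    using line_to_pathin[OF that] by (simp add: pathin_def)
qed (rule openin_deformed_star)

end

section \<open>Circuits as closed curves\<close>

definition circle :: "real \<Rightarrow> complex" where
  "circle \<theta> = cis (2 * pi * \<theta>)"

lemma norm_circle [simp]: "norm (circle \<theta>) = 1"
  by (simp add: circle_def)

lemma circle_surj:
  assumes "norm z = 1" obtains \<theta> where "\<theta> \<in> {0..<1}" "z = circle \<theta>"
proof (rule that[of "Arg2pi z / (2 * pi)"])
  show "Arg2pi z / (2 * pi) \<in> {0..<1}"
    using Arg2pi[of z] by auto
  show "z = circle (Arg2pi z / (2 * pi))"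
    using Arg2pi_eq[of z] assms by (simp add: circle_def cis_conv_exp)
qed

lemma circle_part:
  assumes "\<theta> \<in> {0..1}" "n > 0"
  obtains k where "k < n" "\<theta> \<in> {real k / real n..real (Suc k) / real n}"
proof (cases "\<theta> = 1")
  case True
  then show ?thesis using assms that[of "n - 1"] by auto
next
  case False
  let ?k = "nat \<lfloor>real n * \<theta>\<rfloor>"
  have "real n * \<theta> < real n" "0 \<le> real n * \<theta>"
    using False assms by auto
  then have "?k < n" "real ?k \<le> real n * \<theta>" "real n * \<theta> \<le> real (Suc ?k)"
    by linarith+
  then show ?thesis
    using assms that[of ?k] by (simp add: field_simps)
qed

text \<open>At the last point of the \<open>k\<close>-th arc the formula of the next arc is in force, for the last arc
  that of the first one; both formulas give the common vertex there.\<close>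

lemma circuit_map_circle:
  assumes k: "k < length xs" and \<theta>: "\<theta> \<in> {real k / real (length xs)..real (Suc k) / real (length xs)}"
  shows "circuit_map xs (circle \<theta>) =
    edge_point (xs ! k) (xs ! (Suc k mod length xs)) (real (length xs) * \<theta> - real k)"
proof -
  let ?n = "length xs"
  have n: "?n > 0" using k by linarith
  have arg: "Arg2pi (circle \<theta>) = 2 * pi * \<theta>" if "0 \<le> \<theta>" "\<theta> < 1" for \<theta>
    using that by (intro Arg2pi_unique[of 1]) (auto simp: circle_def cis_conv_exp)
  have bounds: "real k \<le> ?n * \<theta>" "?n * \<theta> \<le> real (Suc k)"
    using \<theta> n by (auto simp: field_simps)
  have "0 \<le> \<theta>"
    using \<theta> by (auto intro: order_trans[rotated])
  show ?thesis
  proof (cases "?n * \<theta> = real (Suc k)")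
    case False
    then have "?n * \<theta> < real (Suc k)" using bounds by simp
    also have "\<dots> \<le> real ?n * 1" using k by simp
    finally have "\<theta> < 1" using n by simp
    moreover have fl: "\<lfloor>?n * \<theta>\<rfloor> = int k"
      using bounds False by (simp add: floor_eq_iff)
    moreover have "frac (?n * \<theta>) = ?n * \<theta> - real k"
      using fl by (simp add: frac_def)
    ultimately show ?thesis
      using arg[OF \<open>0 \<le> \<theta>\<close>] by (simp add: circuit_map_def Let_def)
  next
    case True
    show ?thesis
    proof (cases "Suc k < ?n")
      case True': True
      then have "?n * \<theta> < ?n * 1" using True by simp
      then have "\<theta> < 1" using n by simp
      moreover have "nat (1 + int k) = Suc k" by simp
      ultimately show ?thesis
        using arg[OF \<open>0 \<le> \<theta>\<close>] True True' by (simp add: circuit_map_def Let_def frac_def del: nat_eq_iff2)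
    next
      case False
      then have "Suc k = ?n" using k by simp
      then have "\<theta> = 1" using True n by (metis mult_cancel_left2 of_nat_eq_0_iff less_numeral_extra(3))
      then have "circle \<theta> = circle 0" by (simp add: circle_def)
      then have "circuit_map xs (circle \<theta>) = vertex_point (xs ! 0)"
        using arg[of 0] by (simp add: circuit_map_def Let_def)
      moreover have "?n * \<theta> - real k = 1"
        using True by simp
      ultimately show ?thesis
        using \<open>Suc k = ?n\<close> by (simp del: of_nat_Suc)
    qed
  qed
qed

context graph
begin

text \<open>The argument of a complex number jumps at 1. The closed curve is therefore parametrized by the unit
  interval, where it is pasted from finitely many edges, and continuity descends along the quotient map
  from the interval to the circle.\<close>

lemma circuit_map_continuous:
  assumes xs: "is_circuit V E xs"
  shows "continuous_map (top_of_set (sphere 0 1)) (graph_space V E) (circuit_map xs)"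
proof -
  let ?n = "length xs"
  have n: "?n > 0" and edge: "\<And>k. k < ?n \<Longrightarrow> {xs ! k, xs ! (Suc k mod ?n)} \<in> E"
    using xs by (auto simp: is_circuit_def)
  have "continuous_map unit_interval (graph_space V E) (circuit_map xs \<circ> circle)"
  proof (rule pasting_lemma_closed[where I = "{..<?n}"
        and T = "\<lambda>k. {real k / ?n..real (Suc k) / ?n}"
        and f = "\<lambda>k \<theta>. edge_point (xs ! k) (xs ! (Suc k mod ?n)) (?n * \<theta> - real k)"])
    fix k assume "k \<in> {..<?n}"
    then have k: "k < ?n" by simp
    have sub: "{real k / ?n..real (Suc k) / ?n} \<subseteq> {0..1}"
    proof -
      have "real (Suc k) / ?n \<le> 1"
        using k n by (simp add: divide_le_eq)
      then show ?thesis by auto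
    qed
    then show "closedin unit_interval {real k / ?n..real (Suc k) / ?n}"
      by (simp add: closed_subset)
    have "continuous_map (subtopology unit_interval {real k / ?n..real (Suc k) / ?n}) unit_interval (\<lambda>\<theta>. ?n * \<theta> - real k)"
      using n k by (auto simp: continuous_map_in_subtopology subtopology_subtopology field_simps intro!: continuous_intros)
    from continuous_map_compose[OF this edge_point_continuous[OF edge[OF k]]]
    show "continuous_map (subtopology unit_interval {real k / ?n..real (Suc k) / ?n}) (graph_space V E)
      (\<lambda>\<theta>. edge_point (xs ! k) (xs ! (Suc k mod ?n)) (?n * \<theta> - real k))"
      by (simp add: o_def)
  next
    fix i j \<theta>
    assume "i \<in> {..<?n}" "j \<in> {..<?n}" "\<theta> \<in> topspace unit_interval \<inter> {real i / ?n..real (Suc i) / ?n} \<inter> {real j / ?n..real (Suc j) / ?n}"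
    then show "edge_point (xs ! i) (xs ! (Suc i mod ?n)) (?n * \<theta> - real i) = edge_point (xs ! j) (xs ! (Suc j mod ?n)) (?n * \<theta> - real j)"
      using circuit_map_circle[of i xs \<theta>] circuit_map_circle[of j xs \<theta>] by simp
  next
    fix \<theta> :: real assume "\<theta> \<in> topspace unit_interval"
    then obtain k where "k < ?n" "\<theta> \<in> {real k / ?n..real (Suc k) / ?n}"
      using circle_part[of \<theta> ?n] n by auto
    then show "\<exists>j. j \<in> {..<?n} \<and> \<theta> \<in> {real j / ?n..real (Suc j) / ?n} \<and>
        (circuit_map xs \<circ> circle) \<theta> = edge_point (xs ! j) (xs ! (Suc j mod ?n)) (?n * \<theta> - real j)"
      using circuit_map_circle[of k xs \<theta>] by auto
  qed simp
  moreover have "quotient_map unit_interval (top_of_set (sphere 0 1)) circle"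
  proof (rule T1_Spaces.continuous_imp_quotient_map)
    show "continuous_map unit_interval (top_of_set (sphere 0 1)) circle"
      by (auto simp: continuous_map_in_subtopology circle_def cis_conv_exp intro!: continuous_intros)
    show "circle ` topspace unit_interval = topspace (top_of_set (sphere 0 1))"
    proof
      show "topspace (top_of_set (sphere 0 1)) \<subseteq> circle ` topspace unit_interval"
      proof
        fix z :: complex assume "z \<in> topspace (top_of_set (sphere 0 1))"
        then have "norm z = 1" by simp
        then obtain \<theta> where "\<theta> \<in> {0..<1}" "z = circle \<theta>"
          by (rule circle_surj)
        then show "z \<in> circle ` topspace unit_interval"
          by (intro image_eqI[of _ _ \<theta>]) auto
      qed
    qed auto
  qed (auto simp: compact_space_subtopology Hausdorff_space_subtopology)
  ultimately show ?thesis
    by (rule continuous_compose_quotient_map[rotated])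
qed

end

section \<open>The complex and its cover by vertex stars and open discs\<close>

text \<open>The radial projection of the disc to its boundary. The value at the centre, where there is no
  direction, only serves to give the centre a label and a path to the graph.\<close>

definition direction :: "complex \<Rightarrow> complex" where
  "direction z = (if z = 0 then 1 else sgn z)"

lemma norm_direction [simp]: "norm (direction z) = 1"
  by (simp add: direction_def norm_sgn)

lemma direction_sphere [simp]: "norm z = 1 \<Longrightarrow> direction z = z"
  by (auto simp: direction_def sgn_div_norm)

lemma direction_segment_in:
  assumes "norm z \<le> 1" "t \<in> {0..1}"
  shows "norm ((1 - t) *\<^sub>R z + t *\<^sub>R direction z) \<le> 1"
proof -
  have "(1 - t) *\<^sub>R z + t *\<^sub>R direction z \<in> cball 0 1"
    by (rule convexD_alt) (use assms in auto)
  then show ?thesis by simp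
qed

lemma openin_punctured_disc: "openin (top_of_set (cball 0 1)) (cball 0 1 - {0::complex})"
  by (simp add: openin_diff)

text \<open>The point of the unit circle that \<open>circuit_map xs\<close> sends to the vertex \<open>a\<close>.\<close>

definition circle_vertex :: "'a list \<Rightarrow> 'a \<Rightarrow> complex" where
  "circle_vertex xs a = circle (real (length (takeWhile (\<lambda>x. x \<noteq> a) xs)) / real (length xs))"

lemma circle_vertex_nth:
  assumes "distinct xs" "k < length xs"
  shows "circle_vertex xs (xs ! k) = circle (real k / real (length xs))"
    "circle_vertex xs (xs ! (Suc k mod length xs)) = circle (real (Suc k) / real (length xs))"
proof -
  have nth: "circle_vertex xs (xs ! k) = circle (real k / real (length xs))" if "k < length xs" for k
  proof -
    have "takeWhile (\<lambda>x. x \<noteq> xs ! k) xs = take k xs"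
      using assms that by (intro takeWhile_eq_take_P_nth) (auto simp: nth_eq_iff_index_eq)
    then show ?thesis using that by (simp add: circle_vertex_def)
  qed
  then show "circle_vertex xs (xs ! k) = circle (real k / real (length xs))"
    using assms by simp
  show "circle_vertex xs (xs ! (Suc k mod length xs)) = circle (real (Suc k) / real (length xs))"
  proof (cases "Suc k < length xs")
    case True
    then show ?thesis using nth[of "Suc k"] by simp
  next
    case False
    then have "Suc k = length xs" using assms by simp
    moreover have "circle 1 = circle 0" by (simp add: circle_def)
    ultimately show ?thesis
      using nth[of 0] assms by (auto simp flip: \<open>Suc k = length xs\<close>)
  qed
qed

type_synonym 'a complex_point = "('a \<Rightarrow> real) + ('a list set \<times> complex)"

locale circuit_complex = graph +
  fixes B :: "'a list set set" and r :: "'a list set \<Rightarrow> 'a list"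
  assumes B_circuits: "B \<subseteq> circuits V E" and r_mem: "C \<in> B \<Longrightarrow> r C \<in> C"
begin

lemma r_circuit: "C \<in> B \<Longrightarrow> is_circuit V E (r C)"
  using circuits_mem(1)[of C V E "r C" "r C"] B_circuits r_mem by auto

definition K :: "'a complex_point topology" where
  "K = disc_complex V E B r"

text \<open>The characteristic map of the disc attached along \<open>C\<close>, defined on the closed unit disc.\<close>

definition disc :: "'a list set \<Rightarrow> complex \<Rightarrow> 'a complex_point" where
  "disc C z = (if norm z = 1 then Inl (circuit_map (r C) z) else Inr (C, z))"

lemma circuit_map_in: "C \<in> B \<Longrightarrow> norm z = 1 \<Longrightarrow> circuit_map (r C) z \<in> graph_points V E"
  using continuous_map_image_subset_topspace[OF circuit_map_continuous[OF r_circuit], of C]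
  by (auto simp: topspace_graph_space image_subset_iff)

lemma disc_attach_map:
  "C \<in> B \<Longrightarrow> attach_map (B \<times> sphere 0 1) (\<lambda>(C, z). circuit_map (r C) z) (C, z) = disc C z"
  by (simp add: attach_map_def disc_def)

lemma topspace_K:
  "topspace K = Inl ` graph_points V E \<union> {Inr (C, z) |C z. C \<in> B \<and> norm z < 1}"
proof -
  have "topspace K = attach_points (graph_space V E) (sum_topology (\<lambda>_. top_of_set (cball 0 1)) B) (B \<times> sphere 0 1)"
    unfolding K_def disc_complex_def
    by (rule topspace_attach_space) (auto simp: topspace_graph_space circuit_map_in)
  then show ?thesis
    by (auto simp: attach_points_def topspace_graph_space image_iff less_le)
qed

lemma openin_K:
  "openin K U \<longleftrightarrow> U \<subseteq> topspace K \<and> openin (graph_space V E) {y \<in> graph_points V E. Inl y \<in> U} \<and>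
     (\<forall>C\<in>B. openin (top_of_set (cball 0 1)) {z \<in> cball 0 1. disc C z \<in> U})"
proof -
  let ?Y = "sum_topology (\<lambda>_. top_of_set (cball 0 1)) B"
  let ?m = "attach_map (B \<times> sphere 0 1) (\<lambda>(C, z). circuit_map (r C) z)"
  have "attach_points (graph_space V E) ?Y (B \<times> sphere 0 1) = topspace K"
    unfolding K_def disc_complex_def
    by (rule topspace_attach_space[symmetric]) (auto simp: topspace_graph_space circuit_map_in)
  moreover have "openin ?Y {y \<in> topspace ?Y. ?m y \<in> U} \<longleftrightarrow>
      (\<forall>C\<in>B. openin (top_of_set (cball 0 1)) {z \<in> cball 0 1. disc C z \<in> U})"
    unfolding openin_sum_topology by (auto simp: disc_attach_map cong: conj_cong)
  ultimately show ?thesis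
    unfolding K_def disc_complex_def openin_attach_space topspace_graph_space by simp
qed

lemma Inl_continuous: "continuous_map (graph_space V E) K Inl"
  unfolding continuous_map by (auto simp: openin_K topspace_K topspace_graph_space)

lemma disc_in: "C \<in> B \<Longrightarrow> norm z \<le> 1 \<Longrightarrow> disc C z \<in> topspace K"
  by (auto simp: disc_def topspace_K circuit_map_in)

lemma disc_continuous: "C \<in> B \<Longrightarrow> continuous_map (top_of_set (cball 0 1)) K (disc C)"
  unfolding continuous_map by (auto simp: openin_K disc_in)

text \<open>The radial projection to the graph and the straight line motion \<open>push\<close> towards it. The
  motion of a single point is continuous in time, even from the centre of a disc; continuity in point
  and time together holds away from the centres.\<close>

definition proj :: "'a complex_point \<Rightarrow> 'a \<Rightarrow> real" where
  "proj x = (case x of Inl y \<Rightarrow> y | Inr (C, z) \<Rightarrow> circuit_map (r C) (direction z))"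

definition push ::
  "'a complex_point \<Rightarrow> real \<Rightarrow> 'a complex_point" where
  "push x t = (case x of Inl y \<Rightarrow> Inl y | Inr (C, z) \<Rightarrow> disc C ((1 - t) *\<^sub>R z + t *\<^sub>R direction z))"

lemma proj_Inl [simp]: "proj (Inl y) = y"
  by (simp add: proj_def)

lemma push_Inl [simp]: "push (Inl y) t = Inl y"
  by (simp add: push_def)

lemma proj_disc: "proj (disc C z) = circuit_map (r C) (direction z)"
  by (simp add: disc_def proj_def)

lemma push_disc: "push (disc C z) t = disc C ((1 - t) *\<^sub>R z + t *\<^sub>R direction z)"
  by (simp add: disc_def push_def flip: scaleR_add_left)

lemma K_cases:
  assumes "x \<in> topspace K"
  obtains (graph) y where "y \<in> graph_points V E" "x = Inl y"
    | (disc) C z where "C \<in> B" "norm z < 1" "x = Inr (C, z)" "x = disc C z"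
  using assms by (auto simp: topspace_K disc_def)

lemma proj_in: "x \<in> topspace K \<Longrightarrow> proj x \<in> graph_points V E"
  by (erule K_cases) (auto simp: proj_def circuit_map_in)

lemma push_ends:
  assumes "x \<in> topspace K"
  shows "push x 0 = x" "push x 1 = Inl (proj x)"
proof -
  from assms have "push x 0 = x \<and> push x 1 = Inl (proj x)"
  proof (cases rule: K_cases)
    case (disc C z)
    have "push (disc C z) 0 = disc C z" "push (disc C z) 1 = Inl (proj (disc C z))"
      unfolding push_disc proj_disc by (simp, simp add: disc_def)
    then show ?thesis by (simp only: disc(4)[symmetric])
  qed simp
  then show "push x 0 = x" "push x 1 = Inl (proj x)" by auto
qed

lemma push_factors:
  assumes "C \<in> B" "norm z \<le> 1"
  shows "factors_through (cball 0 1) (disc C) z (direction z) (push (disc C z))"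
  by (rule factors_through_line) (use assms in \<open>auto simp: push_disc\<close>)

lemma push_pathin: "x \<in> topspace K \<Longrightarrow> pathin K (push x)"
proof (erule K_cases)
  fix y assume y: "y \<in> graph_points V E" "x = Inl y"
  then have "push x = (\<lambda>_. Inl y)" by auto
  then show ?thesis using y by (simp add: topspace_K)
next
  fix C z assume C: "C \<in> B" and z: "norm z < 1" and x: "x = disc C z"
  show ?thesis
    unfolding x using factors_through_pathin[OF disc_continuous[OF C] _ push_factors[OF C]] z by simp
qed

definition punctured :: "'a complex_point set" where
  "punctured = {x \<in> topspace K. \<forall>C. x \<noteq> Inr (C, 0)}"

lemma disc_punctured: "C \<in> B \<Longrightarrow> norm z \<le> 1 \<Longrightarrow> disc C z \<in> punctured \<longleftrightarrow> z \<noteq> 0"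
  using disc_in[of C z] by (auto simp: punctured_def disc_def)

lemma Inl_punctured: "Inl y \<in> punctured \<longleftrightarrow> y \<in> graph_points V E"
  by (auto simp: punctured_def topspace_K)

text \<open>The set consists of \<open>W\<close> and, in each punctured disc, of the radii that point into \<open>W\<close>. For a star in
  the graph this says that the vertex star is open.\<close>

lemma openin_proj:
  assumes W: "openin (graph_space V E) W"
  shows "openin K {x \<in> punctured. proj x \<in> W}"
  unfolding openin_K
proof (intro conjI ballI)
  let ?U = "{x \<in> punctured. proj x \<in> W}"
  show "?U \<subseteq> topspace K"
    by (auto simp: punctured_def)
  have "{y \<in> graph_points V E. Inl y \<in> ?U} = W"
    using openin_subset[OF W] by (auto simp: Inl_punctured topspace_graph_space)
  then show "openin (graph_space V E) {y \<in> graph_points V E. Inl y \<in> ?U}"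
    using W by simp
  fix C assume C: "C \<in> B"
  have "continuous_map (top_of_set (cball 0 1 - {0})) (top_of_set (sphere 0 1)) (sgn :: complex \<Rightarrow> complex)"
    by (auto simp: continuous_map_in_subtopology norm_sgn intro!: continuous_on_sgn continuous_on_id)
  from continuous_map_compose[OF this circuit_map_continuous[OF r_circuit[OF C]]]
  have "openin (top_of_set (cball 0 1 - {0})) {z \<in> cball 0 1 - {0}. circuit_map (r C) (sgn z) \<in> W}"
    using openin_continuous_map_preimage[OF _ W] by (fastforce simp: o_def)
  then have "openin (top_of_set (cball 0 1)) {z \<in> cball 0 1 - {0}. circuit_map (r C) (sgn z) \<in> W}"
    using openin_punctured_disc openin_trans by blast
  also have "{z \<in> cball 0 1 - {0}. circuit_map (r C) (sgn z) \<in> W} = {z \<in> cball 0 1. disc C z \<in> ?U}"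
    using C by (auto simp: disc_punctured proj_disc direction_def)
  finally show "openin (top_of_set (cball 0 1)) {z \<in> cball 0 1. disc C z \<in> ?U}" .
qed

lemma proj_continuous: "continuous_map (subtopology K punctured) (graph_space V E) proj"
  unfolding continuous_map
proof (intro conjI allI impI)
  show "proj ` topspace (subtopology K punctured) \<subseteq> topspace (graph_space V E)"
    by (auto simp: proj_in topspace_graph_space)
  fix W assume "openin (graph_space V E) W"
  then have "openin K {x \<in> punctured. proj x \<in> W}"
    by (rule openin_proj)
  moreover have "{x \<in> topspace (subtopology K punctured). proj x \<in> W} = {x \<in> punctured. proj x \<in> W} \<inter> punctured"
    by (auto simp: punctured_def)
  ultimately show "openin (subtopology K punctured) {x \<in> topspace (subtopology K punctured). proj x \<in> W}"
    unfolding openin_subtopology by blast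
qed

lemma push_continuous:
  "continuous_map (prod_topology (subtopology K punctured) unit_interval) K (\<lambda>(x, t). push x t)"
proof (rule continuous_map_deformation)
  show "punctured \<subseteq> topspace K"
    by (auto simp: punctured_def)
  show "continuous_map unit_interval K (push x)" if "x \<in> punctured" for x
    using push_pathin[of x] that by (simp add: punctured_def pathin_def)
  fix U and \<alpha> \<beta> :: real
  assume U: "openin K U" and ab: "0 \<le> \<alpha>" "\<alpha> \<le> \<beta>" "\<beta> \<le> 1"
  let ?W = "{x \<in> punctured. \<forall>t\<in>{\<alpha>..\<beta>}. push x t \<in> U}"
  show "openin K ?W"
    unfolding openin_K
  proof (intro conjI ballI)
    show "?W \<subseteq> topspace K"
      by (auto simp: punctured_def)
    have "{y \<in> graph_points V E. Inl y \<in> ?W} = {y \<in> graph_points V E. Inl y \<in> U}"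
      using ab(2) by (auto simp: Inl_punctured)
    then show "openin (graph_space V E) {y \<in> graph_points V E. Inl y \<in> ?W}"
      using U by (simp add: openin_K)
    fix C assume C: "C \<in> B"
    let ?D = "cball 0 1 - {0} :: complex set"
    have "continuous_on (?D \<times> {0..1}) (\<lambda>z. (1 - snd z) *\<^sub>R fst z + snd z *\<^sub>R sgn (fst z))"
      by (intro continuous_intros) auto
    moreover have "(\<lambda>z. (1 - snd z) *\<^sub>R fst z + snd z *\<^sub>R sgn (fst z)) \<in> ?D \<times> {0..1} \<rightarrow> cball 0 1"
    proof
      fix w assume "w \<in> ?D \<times> {0..1::real}"
      then show "(1 - snd w) *\<^sub>R fst w + snd w *\<^sub>R sgn (fst w) \<in> cball 0 1"
      proof -
        have "fst w \<noteq> 0" "norm (fst w) \<le> 1" "snd w \<in> {0..1}"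
          using \<open>w \<in> ?D \<times> {0..1}\<close> by auto
        then show ?thesis
          using direction_segment_in[of "fst w" "snd w"] by (simp add: direction_def)
      qed
    qed
    ultimately have "continuous_map (prod_topology (top_of_set ?D) unit_interval) (top_of_set (cball 0 1))
        (\<lambda>z. (1 - snd z) *\<^sub>R fst z + snd z *\<^sub>R sgn (fst z))"
      unfolding prod_topology_subtopology_eu continuous_map_in_subtopology continuous_map_iff_continuous
      by (simp add: image_subset_iff_funcset)
    note cont = continuous_map_compose[OF this disc_continuous[OF C]]
    have "openin (top_of_set ?D) {z \<in> ?D. \<forall>t\<in>{\<alpha>..\<beta>}. disc C ((1 - t) *\<^sub>R z + t *\<^sub>R sgn z) \<in> U}"
      using openin_tube[OF cont U ab(1,3)] by (simp add: o_def)
    then have "openin (top_of_set (cball 0 1)) {z \<in> ?D. \<forall>t\<in>{\<alpha>..\<beta>}. disc C ((1 - t) *\<^sub>R z + t *\<^sub>R sgn z) \<in> U}"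
      using openin_punctured_disc openin_trans by blast
    also have "{z \<in> ?D. \<forall>t\<in>{\<alpha>..\<beta>}. disc C ((1 - t) *\<^sub>R z + t *\<^sub>R sgn z) \<in> U} = {z \<in> cball 0 1. disc C z \<in> ?W}"
      using C by (auto simp: disc_punctured push_disc direction_def)
    finally show "openin (top_of_set (cball 0 1)) {z \<in> cball 0 1. disc C z \<in> ?W}" .
  qed
qed

definition vertex_star :: "'a \<Rightarrow> 'a complex_point set" where
  "vertex_star a = {x \<in> punctured. proj x \<in> star a}"

definition cell :: "'a list set \<Rightarrow> 'a complex_point set" where
  "cell C = {Inr (C, z) |z. norm z < 1}"

text \<open>Vertices \<open>a\<close> outside \<open>V\<close> contribute the empty set.\<close>

definition star_cover :: "'a complex_point set set" where
  "star_cover = range vertex_star \<union> cell ` B"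

lemma openin_star_cover: "U \<in> star_cover \<Longrightarrow> openin K U"
  unfolding star_cover_def
proof (elim UnE imageE)
  fix a assume "U = vertex_star a"
  then show ?thesis
    using openin_proj[OF openin_star] by (simp add: vertex_star_def)
next
  fix C assume C: "C \<in> B" and U: "U = cell C"
  have "{z \<in> cball 0 1. disc C' z \<in> cell C} = (if C' = C then cball 0 1 \<inter> ball 0 1 else {})" for C'
    by (auto simp: disc_def cell_def)
  moreover have "Inl y \<notin> cell C" for y
    by (auto simp: cell_def)
  moreover have "cell C \<subseteq> topspace K"
    using C by (auto simp: cell_def topspace_K)
  moreover have "openin (top_of_set (cball 0 1)) (cball 0 1 \<inter> ball (0::complex) 1)"
    by (rule openin_open_Int) simp
  ultimately show ?thesis
    unfolding U openin_K by simp
qed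

lemma star_cover_covers: "topspace K \<subseteq> \<Union>star_cover"
proof
  fix x assume x: "x \<in> topspace K"
  then show "x \<in> \<Union>star_cover"
  proof (cases rule: K_cases)
    case (graph y)
    obtain a where "y a > 0"
      using graph(1) by (rule graph_point_ex_pos)
    then have "x \<in> vertex_star a"
      using graph by (simp add: vertex_star_def Inl_punctured star_def)
    then show ?thesis by (auto simp: star_cover_def)
  next
    case (disc C z)
    then have "x \<in> cell C" by (auto simp: cell_def)
    then show ?thesis
      using disc by (auto simp: star_cover_def)
  qed
qed

lemma star_coverE:
  assumes "U \<in> star_cover"
  obtains a where "U = vertex_star a" | C where "C \<in> B" "U = cell C"
  using assms by (auto simp: star_cover_def)

section \<open>Edge paths and paths to a nearby vertex\<close>

definition edge_path :: "'a \<Rightarrow> 'a \<Rightarrow> real \<Rightarrow> 'a complex_point" where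
  "edge_path a b t = Inl (edge_point a b t)"

fun word_path :: "'a list \<Rightarrow> real \<Rightarrow> 'a complex_point" where
  "word_path [] = undefined"
| "word_path [a] = (\<lambda>_. Inl (vertex_point a))"
| "word_path (a # b # w) = join_loops (edge_path a b) (word_path (b # w))"

lemma edge_path_ends [simp]:
  "edge_path a b 0 = Inl (vertex_point a)" "edge_path a b 1 = Inl (vertex_point b)"
  by (auto simp: edge_path_def)

lemma edge_path_same: "edge_path a a = (\<lambda>_. Inl (vertex_point a))"
  by (auto simp: edge_path_def)

lemma edge_path_continuous: "{a, b} \<in> E \<Longrightarrow> continuous_map unit_interval K (edge_path a b)"
  using continuous_map_compose[OF edge_point_continuous Inl_continuous, of a b]
  by (simp add: o_def edge_path_def[abs_def])

lemma vertex_in: "a \<in> V \<Longrightarrow> Inl (vertex_point a) \<in> topspace K"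
  by (auto simp: topspace_K graph_points_def)

lemma edge_path_pathin: "a \<in> V \<Longrightarrow> a = b \<or> {a, b} \<in> E \<Longrightarrow> pathin K (edge_path a b)"
  using edge_path_continuous by (auto simp: edge_path_same pathin_def vertex_in)

lemma word_path_ends [simp]:
  "w \<noteq> [] \<Longrightarrow> word_path w 0 = Inl (vertex_point (hd w))"
  "w \<noteq> [] \<Longrightarrow> word_path w 1 = Inl (vertex_point (last w))"
  by (induction w rule: word_path.induct) auto

lemma word_path_pathin: "walk V E w \<Longrightarrow> pathin K (word_path w)"
proof (induction w rule: word_path.induct)
  case (3 a b w)
  then show ?case
    by (auto intro!: pathin_join edge_path_pathin simp del: word_path.simps(2,3) simp: word_path.simps(3)[of a b w])
qed (auto simp: vertex_in)

lemma word_path_append: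
  assumes "walk V E (p @ a # q)"
  shows "path_homotopic K (word_path (p @ a # q)) (join_loops (word_path (p @ [a])) (word_path (a # q)))"
  using assms
proof (induction p rule: induct_list012)
  case 1
  then have "path_homotopic K (join_loops (\<lambda>_. Inl (vertex_point a)) (word_path (a # q))) (word_path (a # q))"
    by (intro path_homotopic_const_left word_path_pathin) auto
  then show ?case by (simp add: path_homotopic_sym)
next
  case (2 b)
  then have "pathin K (edge_path b a)" "pathin K (word_path (a # q))"
    by (auto intro: edge_path_pathin word_path_pathin)
  moreover have "pathin K (\<lambda>_. Inl (vertex_point a) :: _ + _)"
    using 2 by (auto simp: vertex_in walk_def)
  ultimately have "path_homotopic K (join_loops (edge_path b a) (word_path (a # q)))
      (join_loops (join_loops (edge_path b a) (\<lambda>_. Inl (vertex_point a))) (word_path (a # q)))"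
    by (intro path_homotopic_join path_homotopic_refl path_homotopic_const_right[THEN path_homotopic_sym]) auto
  then show ?case by simp
next
  case (3 b c p)
  then have w: "walk V E (c # p @ a # q)" and e: "pathin K (edge_path b c)"
    by (auto intro: edge_path_pathin)
  have w': "walk V E (c # p @ [a])" "walk V E (a # q)"
    using w walk_append[of V E "c # p" a q] by auto
  have "path_homotopic K (join_loops (edge_path b c) (word_path (c # p @ a # q)))
     (join_loops (edge_path b c) (join_loops (word_path (c # p @ [a])) (word_path (a # q))))"
    using 3 e by (intro path_homotopic_join path_homotopic_refl) auto
  also have "path_homotopic K \<dots>
     (join_loops (join_loops (edge_path b c) (word_path (c # p @ [a]))) (word_path (a # q)))"
    using e w' by (intro path_homotopic_assoc[THEN path_homotopic_sym] word_path_pathin) auto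
  finally show ?case by simp
qed

text \<open>For a point of a closed disc, both parts of this path run inside that disc, which makes it comparable
  with edge paths along the boundary (\<open>to_vertex_factors\<close>).\<close>

definition to_vertex :: "'a \<Rightarrow> 'a complex_point \<Rightarrow> real \<Rightarrow> 'a complex_point" where
  "to_vertex a x = join_loops (push x) (\<lambda>t. Inl (line_to (proj x) a t))"

lemma line_to_pathin_K: "y \<in> star a \<Longrightarrow> pathin K (\<lambda>t. Inl (line_to y a t))"
  using pathin_compose[OF line_to_pathin Inl_continuous] by (simp add: o_def)

lemma to_vertex_pathin:
  assumes "x \<in> topspace K" "proj x \<in> star a"
  shows "pathin K (to_vertex a x)"
  unfolding to_vertex_def
  using assms by (intro pathin_join push_pathin line_to_pathin_K) (auto simp: push_ends)

lemma to_vertex_ends [simp]: 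
  "x \<in> topspace K \<Longrightarrow> to_vertex a x 0 = x" "to_vertex a x 1 = Inl (vertex_point a)"
  by (auto simp: to_vertex_def push_ends)

text \<open>A vertex star contracts to its vertex, first radially onto the star in the graph and then along the
  edges. Each of the two contractions, performed along \<open>p\<close>, gives a homotopy square, and the two squares
  fit together along the projection of \<open>p\<close> to the graph.\<close>

lemma vertex_star_path:
  assumes p: "pathin K p" and star: "\<And>s. s \<in> {0..1} \<Longrightarrow> p s \<in> vertex_star a"
  shows "path_homotopic K (join_loops p (to_vertex a (p 1))) (to_vertex a (p 0))"
proof -
  define q where "q = (\<lambda>s. Inl (proj (p s)) :: 'a complex_point)"
  define l where "l = (\<lambda>s t. Inl (line_to (proj (p s)) a t) :: 'a complex_point)"
  have p_star: "p s \<in> topspace K" "proj (p s) \<in> star a" "p s \<in> punctured" if "s \<in> {0..1}" for s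
    using star[OF that] by (auto simp: vertex_star_def punctured_def)
  then have p01: "p 0 \<in> topspace K" "p 1 \<in> topspace K" "proj (p 0) \<in> star a" "proj (p 1) \<in> star a"
    by auto
  have "continuous_map unit_interval (graph_space V E) (\<lambda>s. proj (p s))"
    using continuous_map_compose[OF _ proj_continuous, of unit_interval p] p p_star(3)
    by (auto simp: pathin_def continuous_map_in_subtopology o_def)
  then have proj_p: "pathin (graph_space V E) (\<lambda>s. proj (p s))"
    by (simp add: pathin_def)
  have q: "pathin K q"
    using pathin_compose[OF proj_p Inl_continuous] by (simp add: o_def q_def)
  have "continuous_map (prod_topology unit_interval unit_interval) K (\<lambda>(s, t). push (p s) t)"
    by (rule continuous_map_deformation_along[OF push_continuous p p_star(3)])
  then have push_square: "path_homotopic K (join_loops p (push (p 1))) (join_loops (push (p 0)) q)"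
    by (rule path_homotopic_square) (use p_star push_ends in \<open>auto simp: q_def\<close>)
  have "continuous_map (prod_topology unit_interval unit_interval) (graph_space V E)
      (\<lambda>(s, t). line_to (proj (p s)) a t)"
    by (rule continuous_map_deformation_along[OF line_to_continuous proj_p p_star(2)])
  from continuous_map_compose[OF this Inl_continuous]
  have "continuous_map (prod_topology unit_interval unit_interval) K (\<lambda>(s, t). Inl (line_to (proj (p s)) a t))"
    by (simp add: o_def case_prod_unfold)
  then have line_square: "path_homotopic K (join_loops q (l 1)) (join_loops (l 0) (\<lambda>_. Inl (vertex_point a)))"
    by (rule path_homotopic_square) (auto simp: q_def l_def)
  have l: "pathin K (l 0)" "pathin K (l 1)"
    using line_to_pathin_K p01 by (auto simp: l_def)
  note paths = p q push_pathin[OF p01(1)] push_pathin[OF p01(2)] l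
  have ends: "push (p 0) 0 = p 0" "push (p 0) 1 = q 0" "push (p 1) 0 = p 1" "push (p 1) 1 = q 1"
    "l 0 0 = q 0" "l 1 0 = q 1" "l 0 1 = Inl (vertex_point a)" "l 1 1 = Inl (vertex_point a)"
    using p01 by (auto simp: push_ends q_def l_def)
  have "path_homotopic K (join_loops p (join_loops (push (p 1)) (l 1))) (join_loops (join_loops p (push (p 1))) (l 1))"
    by (intro path_homotopic_assoc[THEN path_homotopic_sym] paths) (simp_all add: ends)
  also have "path_homotopic K \<dots> (join_loops (join_loops (push (p 0)) q) (l 1))"
    by (intro path_homotopic_join push_square path_homotopic_refl paths) (simp add: ends)
  also have "path_homotopic K \<dots> (join_loops (push (p 0)) (join_loops q (l 1)))"
    by (intro path_homotopic_assoc paths) (simp_all add: ends)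
  also have "path_homotopic K \<dots> (join_loops (push (p 0)) (join_loops (l 0) (\<lambda>_. Inl (vertex_point a))))"
    by (intro path_homotopic_join line_square path_homotopic_refl paths) (simp add: ends)
  also have "path_homotopic K \<dots> (join_loops (push (p 0)) (l 0))"
    by (intro path_homotopic_join path_homotopic_const_right path_homotopic_refl paths) (simp_all add: ends)
  finally show ?thesis
    by (simp add: to_vertex_def l_def)
qed

text \<open>If \<open>x\<close> is near two different vertices, it projects into the edge between them, and the change from
  one standard path to the other takes place inside this edge.\<close>

lemma to_vertex_switch:
  assumes x: "x \<in> topspace K" and ab: "proj x \<in> star a" "proj x \<in> star b"
  shows "a = b \<or> {a, b} \<in> E"
    "path_homotopic K (join_loops (to_vertex a x) (edge_path a b)) (to_vertex b x)"
proof -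
  define l where "l = (\<lambda>c t. Inl (line_to (proj x) c t) :: 'a complex_point)"
  have l: "pathin K (l a)" "pathin K (l b)"
    using line_to_pathin_K ab by (auto simp: l_def)
  have aV: "a \<in> V"
    using ab(1) graph_point_cases by (auto simp: star_def)
  have "(a = b \<or> {a, b} \<in> E) \<and> path_homotopic K (join_loops (l a) (edge_path a b)) (l b)"
  proof (cases "a = b")
    case True
    then show ?thesis
      using path_homotopic_const_right[OF l(2), of "Inl (vertex_point b)"] by (simp add: edge_path_same l_def)
  next
    case False
    then obtain s where s: "{a, b} \<in> E" "s \<in> {0..1}" "proj x = edge_point a b s"
      using ab graph_point_two_pos[of "proj x" a b] by (auto simp: star_def)
    have "path_homotopic K (join_loops (l a) (edge_path a b)) (l b)"
    proof (rule factors_through_homotopic[OF edge_path_continuous[OF s(1)]])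
      show "factors_through {0..1} (edge_path a b) s 1 (join_loops (l a) (edge_path a b))"
        by (rule factors_through_join[where y = 0]; rule factors_through_subpath)
           (use s(2) in \<open>auto simp: l_def s(3) line_to_edge_point' edge_path_def\<close>)
      show "factors_through {0..1} (edge_path a b) s 1 (l b)"
        by (rule factors_through_subpath)
           (use s(2) in \<open>auto simp: l_def s(3) line_to_edge_point edge_path_def algebra_simps\<close>)
    qed simp
    then show ?thesis using s(1) by simp
  qed
  then have edge: "a = b \<or> {a, b} \<in> E" and line: "path_homotopic K (join_loops (l a) (edge_path a b)) (l b)"
    by auto
  show "a = b \<or> {a, b} \<in> E" by (rule edge)
  have e: "pathin K (edge_path a b)"
    using edge_path_pathin[OF aV edge] .
  have "path_homotopic K (join_loops (join_loops (push x) (l a)) (edge_path a b)) (join_loops (push x) (join_loops (l a) (edge_path a b)))"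
    by (intro path_homotopic_assoc push_pathin x l e) (auto simp: push_ends[OF x] l_def)
  also have "path_homotopic K \<dots> (join_loops (push x) (l b))"
    by (intro path_homotopic_join path_homotopic_refl push_pathin x line) (auto simp: push_ends[OF x] l_def)
  finally show "path_homotopic K (join_loops (to_vertex a x) (edge_path a b)) (to_vertex b x)"
    by (simp add: to_vertex_def l_def)
qed

text \<open>An affine motion along the \<open>k\<close>-th edge of a circuit is a motion along the boundary circle of
  its disc. Edge paths are the case of the parameters 0 and 1, and the final parts of
  the standard paths \<open>to_vertex\<close> the case in which one parameter is 0 or 1.\<close>

lemma circuit_edge_factors:
  assumes C: "C \<in> B" and k: "k < length (r C)" and s: "s \<in> {0..1}" "s' \<in> {0..1}"
    and p: "\<And>t. t \<in> {0..1} \<Longrightarrow>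
      p t = Inl (edge_point (r C ! k) (r C ! (Suc k mod length (r C))) ((1 - t) * s + t * s'))"
  shows "factors_through (cball 0 1) (disc C)
    (circle ((real k + s) / real (length (r C)))) (circle ((real k + s') / real (length (r C)))) p"
  unfolding factors_through_def
proof (intro exI conjI)
  let ?n = "length (r C)"
  let ?\<gamma> = "\<lambda>t. circle ((real k + ((1 - t) * s + t * s')) / real ?n)"
  show "path ?\<gamma>"
    unfolding path_def circle_def cis_conv_exp by (intro continuous_intros) (use k in auto)
  show "path_image ?\<gamma> \<subseteq> cball 0 1"
    by (auto simp: path_image_def)
  show "pathstart ?\<gamma> = circle ((real k + s) / real ?n)" "pathfinish ?\<gamma> = circle ((real k + s') / real ?n)"
    by (auto simp: pathstart_def pathfinish_def)
  show "\<forall>t\<in>{0..1}. p t = disc C (?\<gamma> t)"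
  proof
    fix t :: real assume t: "t \<in> {0..1}"
    have u: "(1 - t) * s + t * s' \<in> {0..1}"
      using convexD_alt[of "{0..1::real}" s s' t] s t by simp
    have n: "0 < real ?n" using k by linarith
    have "?n * ((real k + ((1 - t) * s + t * s')) / real ?n) - real k = (1 - t) * s + t * s'"
      using n by simp
    moreover have "(real k + ((1 - t) * s + t * s')) / real ?n \<in> {real k / ?n..real (Suc k) / ?n}"
      using u n by (auto simp: divide_right_mono)
    ultimately show "p t = disc C (?\<gamma> t)"
      using circuit_map_circle[OF k] p[OF t] by (simp add: disc_def)
  qed
qed

lemma edge_path_factors:
  assumes C: "C \<in> B" and ab: "{a, b} \<in> cycle_edges (r C)"
  shows "factors_through (cball 0 1) (disc C) (circle_vertex (r C) a) (circle_vertex (r C) b) (edge_path a b)"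
proof -
  let ?xs = "r C" let ?n = "length (r C)"
  have dist: "distinct ?xs" using r_circuit[OF C] by (simp add: is_circuit_def)
  obtain k where k: "k < ?n" "{a, b} = {?xs ! k, ?xs ! (Suc k mod ?n)}"
    using ab by (auto simp: cycle_edges_def)
  then consider "a = ?xs ! k" "b = ?xs ! (Suc k mod ?n)" | "b = ?xs ! k" "a = ?xs ! (Suc k mod ?n)"
    by (auto simp: doubleton_eq_iff)
  then show ?thesis
  proof cases
    case 1
    then show ?thesis
      using circuit_edge_factors[OF C k(1), of 0 1 "edge_path a b"] circle_vertex_nth[OF dist k(1)]
      by (auto simp: edge_path_def add.commute)
  next
    case 2
    then show ?thesis
      using circuit_edge_factors[OF C k(1), of 1 0 "edge_path a b"] circle_vertex_nth[OF dist k(1)]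
      by (auto simp: edge_path_def add.commute edge_point_commute[of "?xs ! (Suc k mod ?n)" "?xs ! k"])
  qed
qed

lemma word_path_factors:
  assumes C: "C \<in> B" and "walk (set (r C)) (cycle_edges (r C)) w"
  shows "factors_through (cball 0 1) (disc C) (circle_vertex (r C) (hd w)) (circle_vertex (r C) (last w)) (word_path w)"
  using assms(2)
proof (induction w rule: word_path.induct)
  case (2 a)
  then obtain k where "k < length (r C)" "a = r C ! k"
    by (auto simp: in_set_conv_nth)
  then have "factors_through (cball 0 1) (disc C) (circle_vertex (r C) a) (circle_vertex (r C) a) (word_path [a])"
    using circuit_edge_factors[OF C, of k 0 0 "word_path [a]"] circle_vertex_nth(1)[of "r C" k] r_circuit[OF C]
    by (auto simp: is_circuit_def)
  then show ?case by simp
next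
  case (3 a b w)
  have "factors_through (cball 0 1) (disc C) (circle_vertex (r C) a) (circle_vertex (r C) b) (edge_path a b)"
  proof (cases "a = b")
    case True
    then obtain k where "k < length (r C)" "a = r C ! k"
      using 3 by (auto simp: in_set_conv_nth)
    then show ?thesis
      using circuit_edge_factors[OF C, of k 0 0 "word_path [a]"] circle_vertex_nth(1)[of "r C" k] r_circuit[OF C] True
      by (auto simp: is_circuit_def edge_path_same)
  qed (use 3 edge_path_factors[OF C] in auto)
  with 3 show ?case
    by (auto intro: factors_through_join)
qed auto

lemma star_in_circuit:
  assumes C: "C \<in> B" and \<zeta>: "norm \<zeta> = 1" and a: "circuit_map (r C) \<zeta> \<in> star a"
  obtains k s where "k < length (r C)" "s \<in> {0..1}" "a = r C ! k \<or> a = r C ! (Suc k mod length (r C))"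
    "circuit_map (r C) \<zeta> = edge_point (r C ! k) (r C ! (Suc k mod length (r C))) s"
    "\<zeta> = circle ((real k + s) / length (r C))"
proof -
  let ?n = "length (r C)"
  have n: "?n > 0" using r_circuit[OF C] by (auto simp: is_circuit_def)
  obtain \<theta> where \<theta>: "\<theta> \<in> {0..<1}" "\<zeta> = circle \<theta>"
    using \<zeta> by (rule circle_surj)
  then obtain k where k: "k < ?n" "\<theta> \<in> {real k / ?n..real (Suc k) / ?n}"
    using circle_part[of \<theta> ?n] n by auto
  have eq: "circuit_map (r C) \<zeta> = edge_point (r C ! k) (r C ! (Suc k mod ?n)) (?n * \<theta> - real k)"
    using circuit_map_circle[OF k] \<theta> by simp
  have s: "?n * \<theta> - real k \<in> {0..1}"
    using k n by (auto simp: field_simps)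
  then have "a = r C ! k \<or> a = r C ! (Suc k mod ?n)"
    using a edge_point_pos[OF s, of _ _ a] unfolding eq star_def by blast
  then show ?thesis
    using that[OF k(1) s _ eq] \<theta> n by simp
qed

lemma to_vertex_factors:
  assumes C: "C \<in> B" and z: "norm z \<le> 1" and a: "proj (disc C z) \<in> star a"
  shows "a \<in> set (r C)"
    "factors_through (cball 0 1) (disc C) z (circle_vertex (r C) a) (to_vertex a (disc C z))"
proof -
  let ?xs = "r C" let ?n = "length (r C)"
  have dist: "distinct ?xs" using r_circuit[OF C] by (simp add: is_circuit_def)
  obtain k s where k: "k < ?n" and s: "s \<in> {0..1}" and ak: "a = ?xs ! k \<or> a = ?xs ! (Suc k mod ?n)"
    and eq: "proj (disc C z) = edge_point (?xs ! k) (?xs ! (Suc k mod ?n)) s"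
    "direction z = circle ((real k + s) / ?n)"
    using star_in_circuit[OF C, of "direction z" a] a by (auto simp: proj_disc)
  have "Suc k mod ?n < ?n" using k by (intro mod_less_divisor) linarith
  then show "a \<in> set ?xs" using ak k by auto
  let ?l = "\<lambda>t. Inl (line_to (proj (disc C z)) a t)"
  have "factors_through (cball 0 1) (disc C) (direction z) (circle_vertex ?xs a) ?l"
    using ak
  proof
    assume "a = ?xs ! k"
    then show ?thesis
      using circuit_edge_factors[OF C k s, of 0 ?l] circle_vertex_nth[OF dist k]
      by (auto simp: eq line_to_edge_point')
  next
    assume "a = ?xs ! (Suc k mod ?n)"
    then show ?thesis
      using circuit_edge_factors[OF C k s, of 1 ?l] circle_vertex_nth[OF dist k]
      by (auto simp: eq line_to_edge_point algebra_simps)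
  qed
  then show "factors_through (cball 0 1) (disc C) z (circle_vertex ?xs a) (to_vertex a (disc C z))"
    unfolding to_vertex_def by (rule factors_through_join[OF push_factors[OF C z]])
qed



section \<open>Equivalent words give homotopic edge paths\<close>

lemma word_path_join:
  assumes "walk V E u" "walk V E w" "last u = hd w"
  shows "path_homotopic K (word_path (u @ tl w)) (join_loops (word_path u) (word_path w))"
proof -
  have ne: "u \<noteq> []" "w \<noteq> []" using assms by (auto simp: walk_def)
  then have u: "butlast u @ [hd w] = u" "hd w # tl w = w"
    using append_butlast_last_id[of u] assms(3) by simp_all
  then have "butlast u @ w = u @ tl w"
    by (metis append.assoc append_Cons append_Nil)
  then show ?thesis
    using word_path_append[of "butlast u" "hd w" "tl w"] walk_join[OF assms] by (simp only: u)
qed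

text \<open>Subwords with homotopic edge paths may be exchanged, which reduces each move to its essential part.\<close>

lemma word_path_replace:
  assumes walks: "walk V E (p @ x @ q)" "walk V E (p @ y @ q)" and ne: "x \<noteq> []" "y \<noteq> []"
    and ends: "hd x = hd y" "last x = last y"
    and xy: "path_homotopic K (word_path x) (word_path y)"
  shows "path_homotopic K (word_path (p @ x @ q)) (word_path (p @ y @ q))"
proof -
  have split: "walk V E (p @ [hd z])" "walk V E (z @ q)" "walk V E z" "walk V E (last z # q)"
    "path_homotopic K (word_path (p @ z @ q))
       (join_loops (word_path (p @ [hd z])) (join_loops (word_path z) (word_path (last z # q))))"
    if w: "walk V E (p @ z @ q)" and z: "z \<noteq> []" for z
  proof -
    have eq: "hd z # tl z @ q = z @ q"
      using z by simp
    have eq': "z @ q = butlast z @ last z # q" "butlast z @ [last z] = z"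
      using z append_butlast_last_id[of z] by (metis append.assoc append_Cons append_Nil, simp)
    show 1: "walk V E (p @ [hd z])" and 2: "walk V E (z @ q)"
      using w walk_append[of V E p "hd z" "tl z @ q"] unfolding eq by blast+
    then show 3: "walk V E z" and 4: "walk V E (last z # q)"
      using walk_append[of V E "butlast z" "last z" q] unfolding eq'(1)[symmetric] eq'(2) by blast+
    have 5: "path_homotopic K (word_path (z @ q)) (join_loops (word_path z) (word_path (last z # q)))"
      using word_path_append[of "butlast z" "last z" q] 2 unfolding eq'(1)[symmetric] eq'(2) by blast
    have "path_homotopic K (word_path (p @ z @ q)) (join_loops (word_path (p @ [hd z])) (word_path (z @ q)))"
      using word_path_append[of p "hd z" "tl z @ q"] w by (simp only: eq)
    also have "path_homotopic K \<dots>
        (join_loops (word_path (p @ [hd z])) (join_loops (word_path z) (word_path (last z # q))))"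
      by (intro path_homotopic_join path_homotopic_refl word_path_pathin 1 5) (use z in simp)
    finally show "path_homotopic K (word_path (p @ z @ q))
       (join_loops (word_path (p @ [hd z])) (join_loops (word_path z) (word_path (last z # q))))" .
  qed
  note x = split[OF walks(1) ne(1)] and y = split[OF walks(2) ne(2)]
  note x(5)
  also have "path_homotopic K
      (join_loops (word_path (p @ [hd x])) (join_loops (word_path x) (word_path (last x # q))))
      (join_loops (word_path (p @ [hd y])) (join_loops (word_path y) (word_path (last y # q))))"
    unfolding ends using x(1,4) y(1,4) ne ends
    by (intro path_homotopic_join xy path_homotopic_refl word_path_pathin) auto
  also note y(5)[THEN path_homotopic_sym]
  finally show ?thesis .
qed

text \<open>Both sides of a circuit move run along the boundary of one disc, and both sides of a backtracking
  move inside one edge.\<close>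

lemma word_path_step:
  assumes "circuit_step E B u w" "walk V E u"
  shows "path_homotopic K (word_path u) (word_path w)"
proof -
  have w: "walk V E w"
    using circuit_step_walk[OF assms(1) B_circuits simple] assms(2) by simp
  from assms(1) show ?thesis
  proof cases
    case (circuit C a vs b ws p q)
    then have C: "C \<in> circuits V E" using B_circuits by auto
    note cw = circuit_walks[OF C circuit(4) r_mem[OF circuit(3)]]
    have "path_homotopic K (word_path ([a] @ vs @ [b])) (word_path ([a] @ ws @ [b]))"
      using factors_through_homotopic[OF disc_continuous[OF circuit(3)] _
          word_path_factors[OF circuit(3) cw(1)]] word_path_factors[OF circuit(3) cw(2)] by simp
    then show ?thesis
      using word_path_replace[of p "[a] @ vs @ [b]" q "[a] @ ws @ [b]"] assms(2) w circuit by simp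
  next
    case (backtrack a b p q)
    have ab: "{a, b} \<in> E" by fact
    have "path_homotopic K (word_path [a, b, a]) (word_path [a])"
    proof (rule factors_through_homotopic[OF edge_path_continuous[OF ab]])
      have const: "factors_through {0..1} (edge_path a b) 0 0 (\<lambda>_. Inl (vertex_point a))"
        by (rule factors_through_subpath) (auto simp: edge_path_def)
      then show "factors_through {0..1} (edge_path a b) 0 0 (word_path [a])"
        by simp
      have "factors_through {0..1} (edge_path a b) 0 1 (edge_path a b)"
        by (rule factors_through_subpath) auto
      moreover have "factors_through {0..1} (edge_path a b) 1 0 (edge_path b a)"
        by (rule factors_through_subpath) (auto simp: edge_path_def edge_point_commute[of b a])
      ultimately show "factors_through {0..1} (edge_path a b) 0 0 (word_path [a, b, a])"
        using const by (auto intro!: factors_through_join)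
    qed simp
    then show ?thesis
      using word_path_replace[of p "[a, b, a]" q "[a]"] assms(2) w backtrack by simp
  next
    case (stutter p a q)
    have "walk V E ([a] @ q)"
      using w stutter walk_append[of V E p a q] by simp
    then have "a \<in> V" by (auto simp: walk_def)
    then have "path_homotopic K (word_path [a, a]) (word_path [a])"
      using path_homotopic_const_right[of K "\<lambda>_. Inl (vertex_point a)" "Inl (vertex_point a)"]
      by (simp add: edge_path_same vertex_in)
    then show ?thesis
      using word_path_replace[of p "[a, a]" q "[a]"] assms(2) w stutter by simp
  qed
qed

lemma word_path_equiv:
  assumes "word_equiv E B u w" "walk V E u"
  shows "walk V E w \<and> path_homotopic K (word_path u) (word_path w)"
  using assms(1)
proof (induction rule: equivclp_induct)
  case base
  show ?case using assms(2) word_path_pathin path_homotopic_refl by blast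
next
  case (step y z)
  then have "walk V E z" "path_homotopic K (word_path y) (word_path z)"
    using circuit_step_walk[OF _ B_circuits simple] word_path_step path_homotopic_sym by blast+
  then show ?case
    using step.IH path_homotopic_trans by blast
qed

section \<open>The monodromy of the complex\<close>

text \<open>A vertex near \<open>x\<close>. If \<open>x\<close> projects into the interior of an edge, the choice between its two ends
  is arbitrary, and the transport corrects for the jumps.\<close>

definition label :: "'a complex_point \<Rightarrow> 'a" where
  "label x = (SOME a. proj x a > 0)"

lemma label_star: "x \<in> topspace K \<Longrightarrow> proj x \<in> star (label x)"
  using graph_point_ex_pos[OF proj_in] someI_ex[of "\<lambda>a. proj x a > 0"] proj_in
  by (metis (mono_tags, lifting) label_def mem_Collect_eq star_def)

lemma label_vertex [simp]: "label (Inl (vertex_point a)) = a"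
proof -
  have "(\<lambda>b. proj (Inl (vertex_point a)) b > 0) = (\<lambda>b. b = a)"
    by (auto simp: vertex_point_apply)
  then show ?thesis unfolding label_def by simp
qed

text \<open>Indices for the members of the cover. An index determines the base vertex of the words in its member,
  which the set of points alone need not do.\<close>

definition patch :: "'a + 'a list set \<Rightarrow> 'a complex_point set" where
  "patch i = (case i of Inl a \<Rightarrow> vertex_star a | Inr C \<Rightarrow> cell C)"

definition patches :: "('a + 'a list set) set" where
  "patches = range Inl \<union> Inr ` B"

text \<open>A word from a base vertex of the member \<open>i\<close> of the cover to the label of a point in it. For a disc the
  base vertex is the beginning of the chosen word of its circuit. The word from one label to another
  inside the member goes through the base vertex, so the cocycle condition amounts to the
  cancellation of a spoke with its reversal.\<close>

definition spoke :: "'a + 'a list set \<Rightarrow> 'a complex_point \<Rightarrow> 'a list" where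
  "spoke i x = (case i of Inl a \<Rightarrow> [a, label x] | Inr C \<Rightarrow> arc_to (r C) (label x))"

definition local_word ::
  "'a + 'a list set \<Rightarrow> 'a complex_point \<Rightarrow>
     'a complex_point \<Rightarrow> 'a list" where
  "local_word i x y = rev (spoke i x) @ tl (spoke i y)"

lemma star_cover_patches: "star_cover = patch ` patches"
  by (auto simp: star_cover_def patches_def patch_def image_Un image_image)

lemma patch_in: "i \<in> patches \<Longrightarrow> x \<in> patch i \<Longrightarrow> x \<in> topspace K"
  using openin_subset[OF openin_star_cover] by (auto simp: star_cover_patches)

lemma label_in_circuit:
  assumes C: "C \<in> B" and x: "x \<in> cell C" shows "label x \<in> set (r C)"
proof -
  obtain z where z: "norm z < 1" "x = Inr (C, z)" using x by (auto simp: cell_def)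
  have x_disc: "x = disc C z" using z by (simp add: disc_def)
  have "proj (disc C z) \<in> star (label x)"
    unfolding x_disc by (rule label_star) (use disc_in[OF C] z in simp)
  then show ?thesis
    using to_vertex_factors(1)[OF C] z by (metis less_imp_le)
qed

lemma spoke:
  assumes "i \<in> patches" "x \<in> patch i"
  shows "walk V E (spoke i x)" "last (spoke i x) = label x" "spoke i x \<noteq> []"
    "y \<in> patch i \<Longrightarrow> hd (spoke i y) = hd (spoke i x)"
proof -
  have *: "walk V E (spoke i x) \<and> last (spoke i x) = label x \<and>
      hd (spoke i x) = (case i of Inl a \<Rightarrow> a | Inr C \<Rightarrow> hd (r C))" if x: "x \<in> patch i" for x
    using assms(1) unfolding patches_def
  proof (elim UnE imageE)
    fix a assume i: "i = Inl a"
    then have "proj x \<in> star a" "x \<in> topspace K"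
      using x by (auto simp: patch_def vertex_star_def punctured_def)
    then show ?thesis
      using star_eq_or_adjacent[of "proj x" a "label x"] label_star[of x] star_V[of "proj x"]
      by (auto simp: i spoke_def)
  next
    fix C assume C: "C \<in> B" "i = Inr C"
    then show ?thesis
      using walk_arc_to[OF r_circuit[OF C(1)] label_in_circuit[OF C(1)], of x] x by (auto simp: patch_def spoke_def)
  qed
  from * show "walk V E (spoke i x)" "last (spoke i x) = label x"
    "y \<in> patch i \<Longrightarrow> hd (spoke i y) = hd (spoke i x)"
    using assms(2) by simp_all
  then show "spoke i x \<noteq> []" by (auto simp: walk_def)
qed

lemma local_word:
  assumes i: "i \<in> patches" and x: "x \<in> patch i" and y: "y \<in> patch i"
  shows "local_word i x y \<noteq> []" "hd (local_word i x y) = label x" "last (local_word i x y) = label y"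
  using spoke[OF i x] spoke[OF i y] last_join[of "rev (spoke i x)" "spoke i y"] spoke(4)[OF i x y]
  by (auto simp: local_word_def hd_rev last_rev)

lemma local_word_refl:
  assumes i: "i \<in> patches" and x: "x \<in> patch i"
  shows "word_equiv E B (local_word i x x) [label x]"
  using word_equiv_back_and_forth[OF spoke(1)[OF assms]] spoke(2)[OF assms] by (simp add: local_word_def)

lemma local_word_trans:
  assumes i: "i \<in> patches" and x: "x \<in> patch i" and y: "y \<in> patch i" and z: "z \<in> patch i"
  shows "word_equiv E B (local_word i x y @ tl (local_word i y z)) (local_word i x z)"
proof -
  let ?x = "spoke i x" and ?y = "spoke i y" and ?z = "spoke i z"
  have ne: "?x \<noteq> []" "?y \<noteq> []" "?z \<noteq> []" and hd: "hd ?x = hd ?y"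
    using spoke i x y z by blast+
  have "word_equiv E B (rev (rev ?y) @ tl (rev ?y)) [last (rev ?y)]"
    using spoke(1)[OF i y] by (intro word_equiv_back_and_forth) (simp add: walk_rev)
  then have "word_equiv E B (butlast (rev ?x) @ (?y @ tl (rev ?y)) @ tl ?z) (butlast (rev ?x) @ [hd ?y] @ tl ?z)"
    using ne by (intro word_equiv_append) (simp add: last_rev)
  moreover have "butlast (rev ?x) @ [hd ?y] = rev ?x"
    using append_butlast_last_id[of "rev ?x"] ne hd by (simp add: last_rev)
  moreover have "butlast (rev ?x) @ ?y = rev ?x @ tl ?y"
    using \<open>butlast (rev ?x) @ [hd ?y] = rev ?x\<close> ne by (metis append.assoc append_Cons append_Nil list.collapse)
  ultimately show ?thesis
    using ne by (metis append.assoc local_word_def tl_append2 rev_is_Nil_conv)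
qed

text \<open>In the part of a vertex star inside a disc, all labels lie on the two edges of the circuit at \<open>a\<close>.
  The local word of the star therefore runs on the circuit, and \<open>word_equiv_in_circuit\<close> compares it with
  that of the disc.\<close>

lemma local_word_in_circuit:
  assumes C: "C \<in> B" and a: "x \<in> vertex_star a" "y \<in> vertex_star a" and c: "x \<in> cell C" "y \<in> cell C"
  shows "word_equiv E B [label x, a, label y] (local_word (Inr C) x y)"
proof -
  have adj: "label w = a \<or> {label w, a} \<in> cycle_edges (r C)" "a \<in> set (r C)" if w: "w \<in> cell C" "w \<in> vertex_star a" for w
  proof -
    obtain z where z: "norm z < 1" "w = disc C z" using w by (auto simp: cell_def disc_def)
    have star: "proj (disc C z) \<in> star a"
      using w z by (auto simp: vertex_star_def)
    then show "a \<in> set (r C)"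
      using to_vertex_factors(1)[OF C] z by (metis less_imp_le)
    have star': "proj (disc C z) \<in> star (label w)"
      using label_star[of w] disc_in[OF C] z by simp
    obtain k s where k: "k < length (r C)" "s \<in> {0..1}"
      "a = r C ! k \<or> a = r C ! (Suc k mod length (r C))"
      "circuit_map (r C) (direction z) = edge_point (r C ! k) (r C ! (Suc k mod length (r C))) s"
      using star_in_circuit[OF C norm_direction star[unfolded proj_disc]] by blast
    then have "label w = r C ! k \<or> label w = r C ! (Suc k mod length (r C))"
      using star' edge_point_pos[OF k(2), of _ _ "label w"] by (auto simp: star_def proj_disc)
    moreover have "{r C ! k, r C ! (Suc k mod length (r C))} \<in> cycle_edges (r C)"
      using k(1) by (auto simp: cycle_edges_def)
    ultimately show "label w = a \<or> {label w, a} \<in> cycle_edges (r C)"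
      using k(3) by (auto simp: insert_commute)
  qed
  have "walk (set (r C)) (cycle_edges (r C)) [label x, a, label y]"
    using adj[OF c(1) a(1)] adj[OF c(2) a(2)] label_in_circuit[OF C] c by (auto simp: insert_commute)
  then show ?thesis
    using word_equiv_in_circuit[OF C _ r_mem[OF C], of V E "[label x, a, label y]"] B_circuits C
    by (auto simp: local_word_def spoke_def)
qed

text \<open>Two different vertex stars meet only in points that project into the edge between the two vertices, so
  that only the two ends of the edge occur in the words. Different open discs are disjoint.\<close>

lemma local_word_agree:
  assumes i: "i \<in> patches" "x \<in> patch i" "y \<in> patch i" and j: "j \<in> patches" "x \<in> patch j" "y \<in> patch j"
  shows "word_equiv E B (local_word i x y) (local_word j x y)"
proof -
  have Inl_word: "local_word (Inl a) x y = [label x, a, label y]" for a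
    by (simp add: local_word_def spoke_def)
  consider (vv) a b where "i = Inl a" "j = Inl b" | (vc) a C where "i = Inl a" "j = Inr C" "C \<in> B"
    | (cv) a C where "i = Inr C" "j = Inl a" "C \<in> B" | (cc) C D where "i = Inr C" "j = Inr D"
    using i(1) j(1) by (auto simp: patches_def)
  then show ?thesis
  proof cases
    case vv
    show ?thesis
    proof (cases "a = b")
      case False
      have star: "proj x \<in> star a" "proj x \<in> star b" "proj y \<in> star a" "proj y \<in> star b"
        using i j vv by (auto simp: patch_def vertex_star_def)
      have xy: "label x = a \<or> label x = b" "label y = a \<or> label y = b"
        using star_two_eq[OF star(1,2) label_star False] star_two_eq[OF star(3,4) label_star False]
          patch_in i by auto
      have ab: "{a, b} \<in> E" "{b, a} \<in> E"
        using star_eq_or_adjacent[OF star(1,2)] False by (auto simp: insert_commute)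
      have s: "word_equiv E B [c, c, d] [c, d, d]" "word_equiv E B [c, c, c] [c]" for c d
        using word_equiv_stutter[of E B "[]" c "[d]"] word_equiv_stutter[of E B "[c]" d "[]"]
          word_equiv_spike[of c c E B "[]" "[]"]
        by (auto intro: equivclp_trans equivclp_sym)
      have t: "word_equiv E B [a, b, a] [a]" "word_equiv E B [b, a, b] [b]"
        using word_equiv_spike[of _ _ E B "[]" "[]"] ab by auto
      from xy show ?thesis
        unfolding vv Inl_word
        by (elim disjE; simp) (use s t equivclp_trans equivclp_sym in metis)+
    qed (simp add: vv)
  next
    case vc
    then show ?thesis
      using local_word_in_circuit[of C x a y] i j by (simp add: Inl_word patch_def)
  next
    case cv
    then show ?thesis
      using local_word_in_circuit[of C x a y] i j by (simp add: Inl_word patch_def equivclp_sym)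
  next
    case cc
    then have "C = D"
      using i j by (auto simp: patch_def cell_def)
    then show ?thesis using cc by simp
  qed
qed

definition word_class :: "'a list \<Rightarrow> 'a list set" where
  "word_class u = {w. word_equiv E B u w}"

lemma word_class_eq: "word_class u = word_class w \<longleftrightarrow> word_equiv E B u w"
proof
  assume "word_class u = word_class w"
  then have "w \<in> word_class u" by (simp add: word_class_def)
  then show "word_equiv E B u w" by (simp add: word_class_def)
qed (auto simp: word_class_def intro: equivclp_trans equivclp_sym)

text \<open>Classes of words that end at the label of \<open>x\<close>. The classes of walks from a fixed vertex form the
  fibre over \<open>x\<close> of the universal covering of the component of that vertex.\<close>

definition fibre :: "'a complex_point \<Rightarrow> 'a list set set" where
  "fibre x = {word_class u |u. u \<noteq> [] \<and> last u = label x}"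

text \<open>Any member of the cover that contains both points may be used, by \<open>local_word_agree\<close>.\<close>

definition transport ::
  "'a complex_point \<Rightarrow> 'a complex_point \<Rightarrow>
     'a list set \<Rightarrow> 'a list set" where
  "transport x y X =
     (let l = (SOME l. \<exists>i\<in>patches. x \<in> patch i \<and> y \<in> patch i \<and> l = local_word i x y)
      in {w. \<exists>u\<in>X. word_equiv E B (u @ tl l) w})"

lemma transport_word_class:
  assumes i: "i \<in> patches" "x \<in> patch i" "y \<in> patch i" and u: "u \<noteq> []" "last u = label x"
  shows "transport x y (word_class u) = word_class (u @ tl (local_word i x y))"
proof -
  define l where "l = (SOME l. \<exists>i\<in>patches. x \<in> patch i \<and> y \<in> patch i \<and> l = local_word i x y)"
  have "\<exists>i\<in>patches. x \<in> patch i \<and> y \<in> patch i \<and> l = local_word i x y"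
    unfolding l_def by (rule someI_ex) (use i in blast)
  then obtain j where j: "j \<in> patches" "x \<in> patch j" "y \<in> patch j" "l = local_word j x y"
    by blast
  have "word_equiv E B (u @ tl l) (u @ tl (local_word i x y))"
    using local_word_agree[OF j(1-3) i] local_word[OF j(1-3)] u unfolding j(4)
    by (intro word_equiv_join) auto
  moreover have "word_equiv E B (u' @ tl l) (u @ tl l)" if "word_equiv E B u u'" for u'
    using word_equiv_append[OF that, of "[]" "tl l"] by (simp add: equivclp_sym)
  ultimately have 1: "word_equiv E B (u' @ tl l) (u @ tl (local_word i x y))" if "word_equiv E B u u'" for u'
    using that equivclp_trans by metis
  have "(\<exists>u'\<in>word_class u. word_equiv E B (u' @ tl l) w) \<longleftrightarrow> word_equiv E B (u @ tl (local_word i x y)) w" for w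
  proof
    assume "\<exists>u'\<in>word_class u. word_equiv E B (u' @ tl l) w"
    then obtain u' where u': "word_equiv E B u u'" "word_equiv E B (u' @ tl l) w"
      by (auto simp: word_class_def)
    show "word_equiv E B (u @ tl (local_word i x y)) w"
      by (rule equivclp_trans[OF equivclp_sym[OF 1[OF u'(1)]] u'(2)])
  next
    assume "word_equiv E B (u @ tl (local_word i x y)) w"
    then have "word_equiv E B (u @ tl l) w"
      by (rule equivclp_trans[OF 1[OF equivclp_refl]])
    then show "\<exists>u'\<in>word_class u. word_equiv E B (u' @ tl l) w"
      by (intro bexI[of _ u]) (simp_all add: word_class_def)
  qed
  then show ?thesis
    unfolding transport_def Let_def l_def[symmetric] by (simp add: word_class_def)
qed

sublocale local_transport K star_cover fibre transport
proof
  show "openin K U" if "U \<in> star_cover" for U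
    using that by (rule openin_star_cover)
  show "topspace K \<subseteq> \<Union>star_cover"
    by (rule star_cover_covers)
next
  fix U x y q assume "U \<in> star_cover" and xy: "x \<in> U" "y \<in> U" and "q \<in> fibre x"
  then obtain i u where i: "i \<in> patches" "U = patch i" and u: "q = word_class u" "u \<noteq> []" "last u = label x"
    by (auto simp: star_cover_patches fibre_def)
  have "last (u @ tl (local_word i x y)) = label y"
    using local_word[of i x y] i xy u by (subst last_join) auto
  then show "transport x y q \<in> fibre y"
    using transport_word_class[of i x y u] i xy u by (auto simp: fibre_def)
next
  fix U x y z q assume "U \<in> star_cover" and xyz: "x \<in> U" "y \<in> U" "z \<in> U" and "q \<in> fibre x"
  then obtain i u where i: "i \<in> patches" "U = patch i" and u: "q = word_class u" "u \<noteq> []" "last u = label x"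
    by (auto simp: star_cover_patches fibre_def)
  have last: "last (u @ tl (local_word i x y)) = label y"
    using local_word[of i x y] i xyz u by (subst last_join) auto
  have "word_equiv E B (u @ tl (local_word i x y @ tl (local_word i y z))) (u @ tl (local_word i x z))"
    using local_word_trans[of i x y z] local_word[of i x y] i xyz u by (intro word_equiv_join) auto
  then have "word_class (u @ tl (local_word i x y) @ tl (local_word i y z)) = word_class (u @ tl (local_word i x z))"
    using local_word(1)[of i x y] i xyz by (simp add: word_class_eq)
  then show "transport y z (transport x y q) = transport x z q"
    using transport_word_class[of i x y u] transport_word_class[of i x z u]
      transport_word_class[of i y z "u @ tl (local_word i x y)"] i xyz u last by simp
next
  fix x q assume x: "x \<in> topspace K" and "q \<in> fibre x"
  then obtain u where u: "q = word_class u" "u \<noteq> []" "last u = label x"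
    by (auto simp: fibre_def)
  obtain i where i: "i \<in> patches" "x \<in> patch i"
    using x star_cover_covers by (auto simp: star_cover_patches)
  have "word_equiv E B (u @ tl (local_word i x x)) (u @ tl [label x])"
    using local_word_refl[OF i] local_word[OF i i(2)] u by (intro word_equiv_join) auto
  then show "transport x x q = q"
    using transport_word_class[OF i i(2) u(2,3)] u by (simp add: word_class_eq)
qed

text \<open>The lift along the edge appends the label of the moving point to the word. Any two points of the
  edge path at distance less than one half in time avoid one of the two ends of the edge, so they lie in
  the star of the other end.\<close>

lemma carries_edge:
  assumes a: "a \<in> V" and ab: "a = b \<or> {a, b} \<in> E" and u: "u \<noteq> []" "last u = a"
  shows "carries (edge_path a b) (word_class u) (word_class (u @ [b]))"
proof -
  obtain u' where u': "u = u' @ [a]"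
    using u by (metis append_butlast_last_id)
  have stutter: "word_equiv E B (u @ [a]) u"
    using word_equiv_stutter[of E B u' a "[]"] by (simp add: u')
  show ?thesis
  proof (cases "a = b")
    case True
    have "is_lift {0..1::real} (\<lambda>_. Inl (vertex_point a)) (\<lambda>_. word_class u)"
      using a u by (intro is_lift_const) (auto simp: vertex_in fibre_def)
    moreover have "word_class (u @ [b]) = word_class u"
      using stutter True by (simp add: word_class_eq)
    ultimately show ?thesis
      unfolding carries_def using True
      by (intro exI[of _ "\<lambda>_. word_class u"]) (simp add: edge_path_same)
  next
    case False
    then have ab: "{a, b} \<in> E" using ab by simp
    let ?e = "edge_path a b"
    define l where "l t = label (?e t)" for t
    have e_in: "?e t \<in> topspace K" if "t \<in> {0..1}" for t
      using that edge_point_in[OF ab] by (auto simp: edge_path_def topspace_K)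
    have l: "l t = a \<or> l t = b" if "t \<in> {0..1}" for t
      using label_star[OF e_in[OF that]] edge_point_pos[OF that, of a b "l t"]
      by (auto simp: star_def edge_path_def l_def)
    have l01: "l 0 = a" "l 1 = b"
      by (auto simp: l_def)
    have in_a: "?e t \<in> patch (Inl a)" if "t \<in> {0..1}" "t < 1" for t
      using that False edge_point_in[OF ab] by (auto simp: patch_def vertex_star_def edge_path_def Inl_punctured star_def edge_point_apply)
    have in_b: "?e t \<in> patch (Inl b)" if "t \<in> {0..1}" "t > 0" for t
      using that False edge_point_in[OF ab] by (auto simp: patch_def vertex_star_def edge_path_def Inl_punctured star_def edge_point_apply)
    \<comment> \<open>On a single edge a detour through either end changes only the last letter.\<close>
    have words: "word_equiv E B (u @ [l t, c, l t']) (u @ [l t'])" if "t \<in> {0..1}" "t' \<in> {0..1}" "c = a \<or> c = b" for t t' c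
    proof -
      have spike: "word_equiv E B (p @ d # d' # d # q) (p @ d # q)" if "d \<in> {a, b}" "d' \<in> {a, b}" for d d' p q
        using that ab by (intro word_equiv_spike) (auto simp: insert_commute)
      have st: "word_equiv E B (p @ d # d # q) (p @ d # q)" for p d q
        by (rule word_equiv_stutter)
      show ?thesis
      proof (cases "c = a")
        case True
        then show ?thesis
          using spike[of a "l t" u' "[l t']"] l[OF that(1)] by (auto simp: u')
      next
        case False
        then have c: "c = b" using that by simp
        show ?thesis
        proof (cases "l t' = a")
          case True
          have "word_equiv E B (u @ [l t, c, l t']) (u' @ [a, l t, a])"
            using l[OF that(1)] spike[of a b "u' @ [a]" "[]"] st[of "u' @ [a]" b "[a]"] spike[of a a u' "[]"] st[of u' a "[]"]
            by (auto simp: u' c True intro: equivclp_trans equivclp_sym)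
          also have "word_equiv E B (u' @ [a, l t, a]) (u' @ [a])"
            using spike[of a "l t" u' "[]"] l[OF that(1)] by auto
          also have "word_equiv E B (u' @ [a]) (u @ [l t'])"
            using stutter by (simp add: True u' equivclp_sym)
          finally show ?thesis .
        next
          case f: False
          then have t': "l t' = b" using l[OF that(2)] by simp
          have "word_equiv E B (u @ [l t, b, b]) (u @ [l t, b])"
            using st[of "u @ [l t]" b "[]"] by simp
          also have "word_equiv E B (u @ [l t, b]) (u @ [b])"
            using l[OF that(1)] st[of u b "[]"] st[of u' a "[b]"] by (auto simp: u')
          finally show ?thesis by (simp add: c t')
        qed
      qed
    qed
    have "is_lift {0..1} ?e (\<lambda>t. word_class (u @ [l t]))"
      unfolding is_lift_def
    proof (intro conjI ballI exI[of _ "1/2"] impI)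
      fix t :: real assume "t \<in> {0..1}"
      show "word_class (u @ [l t]) \<in> fibre (?e t)"
        by (auto simp: fibre_def l_def)
      fix t' :: real assume t': "t' \<in> {0..1}" "dist t t' < 1 / 2"
      obtain c where c: "c = a \<or> c = b" "?e t \<in> patch (Inl c)" "?e t' \<in> patch (Inl c)"
      proof (cases "t < 1 \<and> t' < 1")
        case True
        then show ?thesis using that[of a] in_a t' \<open>t \<in> {0..1}\<close> by blast
      next
        case False
        then have "t > 0" "t' > 0"
          using t' \<open>t \<in> {0..1}\<close> by (auto simp: dist_real_def)
        then show ?thesis using that[of b] in_b t' \<open>t \<in> {0..1}\<close> by blast
      qed
      have "transport (?e t) (?e t') (word_class (u @ [l t])) = word_class ((u @ [l t]) @ tl (local_word (Inl c) (?e t) (?e t')))"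
        using c by (intro transport_word_class) (auto simp: patches_def l_def)
      also have "\<dots> = word_class (u @ [l t'])"
        using words[OF \<open>t \<in> {0..1}\<close> t'(1) c(1)]
        by (simp add: word_class_eq local_word_def spoke_def flip: l_def)
      finally show "word_class (u @ [l t']) = transport (?e t) (?e t') (word_class (u @ [l t]))" ..
    qed simp
    then show ?thesis
      unfolding carries_def using stutter l01
      by (intro exI[of _ "\<lambda>t. word_class (u @ [l t])"]) (simp add: word_class_eq)
  qed
qed

lemma carries_word:
  assumes "walk V E w" "u \<noteq> []" "last u = hd w"
  shows "carries (word_path w) (word_class u) (word_class (u @ tl w))"
  using assms
proof (induction w arbitrary: u rule: word_path.induct)
  case (2 a)
  have "is_lift {0..1::real} (\<lambda>_. Inl (vertex_point a)) (\<lambda>_. word_class u)"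
    using 2 by (intro is_lift_const) (auto simp: vertex_in fibre_def)
  then show ?case
    by (auto simp: carries_def)
next
  case (3 a b w)
  have "carries (word_path (b # w)) (word_class (u @ [b])) (word_class ((u @ [b]) @ tl (b # w)))"
    using 3 by (intro "3.IH") auto
  moreover have "carries (edge_path a b) (word_class u) (word_class (u @ [b]))"
    using 3 by (intro carries_edge) auto
  ultimately show ?case
    using carries_join[of "edge_path a b" "word_path (b # w)"] 3
    by (auto simp: edge_path_pathin word_path_pathin)
qed auto

text \<open>Transport along the path of a word turns the class of the trivial word into the class of the word.\<close>

lemma word_equiv_if_path_homotopic:
  assumes w: "walk V E w" "walk V E w'" and "hd w = hd w'" and h: "path_homotopic K (word_path w) (word_path w')"
  shows "word_equiv E B w w'"
proof -
  have "[hd w] @ tl w = w"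
    using assms(1) by (simp add: walk_def)
  moreover have "[hd w] @ tl w' = w'"
    using assms(2,3) by (simp add: walk_def)
  ultimately have "carries (word_path w) (word_class [hd w]) (word_class w)"
    "carries (word_path w') (word_class [hd w]) (word_class w')"
    using carries_word[OF w(1), of "[hd w]"] carries_word[OF w(2), of "[hd w]"] assms(3) by simp_all
  then have "word_class w = word_class w'"
    using carries_homotopic[OF h] carries_unique by blast
  then show ?thesis
    by (simp add: word_class_eq)
qed



section \<open>Every loop is homotopic to an edge path\<close>

text \<open>An open disc carries the usual topology, so a path inside it has continuous coordinates.\<close>

lemma cell_path_factors:
  assumes C: "C \<in> B" and p: "pathin K p" and cell: "\<And>t. t \<in> {0..1} \<Longrightarrow> p t \<in> cell C"
  obtains z z' where "norm z < 1" "norm z' < 1" "p 0 = disc C z" "p 1 = disc C z'"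
    "factors_through (cball 0 1) (disc C) z z' p"
proof -
  \<comment> \<open>the inverse of the characteristic map on the open disc\<close>
  define coord where "coord x = snd (projr x)" for x :: "'a complex_point"
  have coord: "norm (coord x) < 1" "x = disc C (coord x)" if "x \<in> cell C" for x
    using that by (auto simp: cell_def coord_def disc_def)
  have coord_cont: "continuous_map (subtopology K (cell C)) euclidean coord"
    unfolding continuous_map
  proof (intro conjI allI impI)
    fix W :: "complex set" assume W: "openin euclidean W"
    let ?P = "{x \<in> cell C. coord x \<in> W}"
    have disc: "{z \<in> cball 0 1. disc D z \<in> ?P} = (if D = C then cball 0 1 \<inter> (ball 0 1 \<inter> W) else {})" for D
      by (auto simp: disc_def cell_def coord_def)
    have graph: "{y \<in> graph_points V E. Inl y \<in> ?P} = {}"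
      by (auto simp: cell_def)
    have "openin (top_of_set (cball 0 1)) (cball 0 1 \<inter> (ball (0::complex) 1 \<inter> W))"
      using W by (intro openin_open_Int) auto
    moreover have "?P \<subseteq> topspace K"
      using C by (auto simp: cell_def topspace_K)
    ultimately have "openin K ?P"
      unfolding openin_K graph disc by simp
    then show "openin (subtopology K (cell C)) {x \<in> topspace (subtopology K (cell C)). coord x \<in> W}"
      unfolding openin_subtopology using openin_subset by (intro exI[of _ ?P]) fastforce
  qed simp
  have "continuous_map unit_interval (subtopology K (cell C)) p"
    using p cell by (auto simp: pathin_def continuous_map_in_subtopology)
  from continuous_map_compose[OF this coord_cont]
  have path: "path (coord \<circ> p)"
    by (simp add: path_def)
  have "factors_through (cball 0 1) (disc C) (coord (p 0)) (coord (p 1)) p"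
    unfolding factors_through_def
    using path coord cell by (intro exI[of _ "coord \<circ> p"]) (auto simp: path_image_def pathstart_def pathfinish_def less_imp_le)
  then show ?thesis
    using that[of "coord (p 0)" "coord (p 1)"] coord[OF cell[of 0]] coord[OF cell[of 1]] by simp
qed

text \<open>Everything in sight factors through the closed disc: the given path, the standard paths to the vertices
  \<open>a\<close> and \<open>b\<close> of the circuit, and the edge path along the circuit between these.\<close>

lemma cell_path:
  assumes C: "C \<in> B" and p: "pathin K p" and cell: "\<And>t. t \<in> {0..1} \<Longrightarrow> p t \<in> cell C"
    and a: "proj (p 0) \<in> star a" and b: "proj (p 1) \<in> star b"
  obtains u where "walk V E u" "hd u = a" "last u = b"
    "path_homotopic K (join_loops p (to_vertex b (p 1))) (join_loops (to_vertex a (p 0)) (word_path u))"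
proof -
  let ?xs = "r C"
  obtain z z' where z: "norm z < 1" "norm z' < 1" "p 0 = disc C z" "p 1 = disc C z'"
    "factors_through (cball 0 1) (disc C) z z' p"
    using cell_path_factors[OF C p cell] by blast
  have fa: "a \<in> set ?xs" "factors_through (cball 0 1) (disc C) z (circle_vertex ?xs a) (to_vertex a (p 0))"
    using to_vertex_factors[OF C, of z a] a z by auto
  have fb: "b \<in> set ?xs" "factors_through (cball 0 1) (disc C) z' (circle_vertex ?xs b) (to_vertex b (p 1))"
    using to_vertex_factors[OF C, of z' b] b z by auto
  have circ: "is_circuit (set ?xs) (cycle_edges ?xs) ?xs" and sub: "set ?xs \<subseteq> V" "cycle_edges ?xs \<subseteq> E"
    using r_circuit[OF C] by (auto simp: is_circuit_alt)
  define u where "u = rev (arc_to ?xs a) @ tl (arc_to ?xs b)"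
  note arc_a = walk_arc_to[OF circ fa(1)] and arc_b = walk_arc_to[OF circ fb(1)]
  have ne: "arc_to ?xs a \<noteq> []" "arc_to ?xs b \<noteq> []" by (auto simp: arc_to_def)
  have u: "walk (set ?xs) (cycle_edges ?xs) u"
    unfolding u_def using arc_a arc_b ne by (intro walk_join) (auto simp: walk_rev last_rev)
  have "hd u = a" "last u = b"
    using arc_a arc_b ne last_join[of "rev (arc_to ?xs a)" "arc_to ?xs b"] by (auto simp: u_def hd_rev last_rev)
  moreover have "walk V E u"
    using u sub by (rule walk_mono)
  moreover have "path_homotopic K (join_loops p (to_vertex b (p 1))) (join_loops (to_vertex a (p 0)) (word_path u))"
  proof (rule factors_through_homotopic[OF disc_continuous[OF C]])
    show "factors_through (cball 0 1) (disc C) z (circle_vertex ?xs b) (join_loops p (to_vertex b (p 1)))"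
      using z(5) fb(2) by (rule factors_through_join)
    show "factors_through (cball 0 1) (disc C) z (circle_vertex ?xs b) (join_loops (to_vertex a (p 0)) (word_path u))"
      using factors_through_join[OF fa(2)] word_path_factors[OF C u] \<open>hd u = a\<close> \<open>last u = b\<close> by simp
  qed simp
  ultimately show ?thesis
    using that by blast
qed

text \<open>Continued by a standard path to a vertex near its end, \<open>p\<close> is homotopic to an edge path. By
  \<open>spelled_at\<close> the choice of the vertex does not matter.\<close>

definition spelled :: "'a \<Rightarrow> (real \<Rightarrow> 'a complex_point) \<Rightarrow> bool" where
  "spelled v p \<longleftrightarrow> (\<exists>a w. proj (p 1) \<in> star a \<and> walk V E w \<and> hd w = v \<and> last w = a \<and>
     path_homotopic K (join_loops p (to_vertex a (p 1))) (word_path w))"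

lemma spelled_at:
  assumes p: "pathin K p" and s: "spelled v p" and b: "proj (p 1) \<in> star b"
  obtains w where "walk V E w" "hd w = v" "last w = b"
    "path_homotopic K (join_loops p (to_vertex b (p 1))) (word_path w)"
proof -
  obtain a w where a: "proj (p 1) \<in> star a" and w: "walk V E w" "hd w = v" "last w = a"
    and h: "path_homotopic K (join_loops p (to_vertex a (p 1))) (word_path w)"
    using s by (auto simp: spelled_def)
  have p1: "p 1 \<in> topspace K"
    using p by (rule path_finish_in_topspace)
  note switch = to_vertex_switch[OF p1 a b]
  have aV: "a \<in> V" "b \<in> V" using star_V a b by auto
  note paths = p to_vertex_pathin[OF p1 a] to_vertex_pathin[OF p1 b] edge_path_pathin[OF aV(1) switch(1)]
    word_path_pathin[OF w(1)]
  have w': "walk V E [a, b]" "w \<noteq> []" using aV switch(1) w(1) by (auto simp: walk_def)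
  have "path_homotopic K (join_loops p (to_vertex b (p 1)))
      (join_loops p (join_loops (to_vertex a (p 1)) (edge_path a b)))"
    by (intro path_homotopic_join path_homotopic_refl switch(2)[THEN path_homotopic_sym] paths) (simp add: p1)
  also have "path_homotopic K \<dots> (join_loops (join_loops p (to_vertex a (p 1))) (edge_path a b))"
    by (intro path_homotopic_assoc[THEN path_homotopic_sym] paths) (simp_all add: p1)
  also have "path_homotopic K \<dots> (join_loops (word_path w) (edge_path a b))"
    by (intro path_homotopic_join h path_homotopic_refl paths) simp
  also have "path_homotopic K \<dots> (join_loops (word_path w) (word_path [a, b]))"
    using path_homotopic_const_right[OF paths(4), of "Inl (vertex_point b)", THEN path_homotopic_sym] w w'(2)
    by (intro path_homotopic_join path_homotopic_refl paths) simp_all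
  also have "path_homotopic K \<dots> (word_path (w @ tl [a, b]))"
    using w w' by (intro word_path_join[THEN path_homotopic_sym]) auto
  finally show ?thesis
    using that[of "w @ [b]"] walk_join[OF w(1) w'(1)] w w' by simp
qed

lemma spelled_step:
  assumes p: "pathin K p" and q: "pathin K q" and pq: "p 1 = q 0" and s: "spelled v p"
    and U: "U \<in> star_cover" "\<And>t. t \<in> {0..1} \<Longrightarrow> q t \<in> U"
  shows "spelled v (join_loops p q)"
  using U(1)
proof (cases rule: star_coverE)
  case (1 a)
  then have in_a: "q t \<in> vertex_star a" if "t \<in> {0..1}" for t
    using U(2)[OF that] by simp
  then have star: "proj (q 0) \<in> star a" "proj (q 1) \<in> star a" "q 0 \<in> topspace K" "q 1 \<in> topspace K"
    by (auto simp: vertex_star_def punctured_def)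
  then obtain w where w: "walk V E w" "hd w = v" "last w = a"
    "path_homotopic K (join_loops p (to_vertex a (p 1))) (word_path w)"
    using spelled_at[OF p s, of a] pq by auto
  have "path_homotopic K (join_loops (join_loops p q) (to_vertex a (q 1)))
      (join_loops p (join_loops q (to_vertex a (q 1))))"
    using p q pq star by (intro path_homotopic_assoc to_vertex_pathin) auto
  also have "path_homotopic K \<dots> (join_loops p (to_vertex a (q 0)))"
    using p pq star vertex_star_path[OF q in_a]
    by (intro path_homotopic_join path_homotopic_refl) auto
  also have "path_homotopic K \<dots> (word_path w)"
    using w(4) pq by simp
  finally show ?thesis
    unfolding spelled_def using w star by (intro exI[of _ a] exI[of _ w]) simp
next
  case (2 C)
  have ends: "q 0 \<in> topspace K" "q 1 \<in> topspace K"
    using q by (auto simp: path_start_in_topspace path_finish_in_topspace)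
  define a b where "a = label (q 0)" and "b = label (q 1)"
  have star: "proj (q 0) \<in> star a" "proj (q 1) \<in> star b"
    using label_star ends by (auto simp: a_def b_def)
  then obtain w where w: "walk V E w" "hd w = v" "last w = a"
    "path_homotopic K (join_loops p (to_vertex a (p 1))) (word_path w)"
    using spelled_at[OF p s, of a] pq by auto
  obtain u where u: "walk V E u" "hd u = a" "last u = b"
    "path_homotopic K (join_loops q (to_vertex b (q 1))) (join_loops (to_vertex a (q 0)) (word_path u))"
    using cell_path[OF 2(1) q _ star] U(2) 2(2) by blast
  have ne: "w \<noteq> []" "u \<noteq> []" using w u by (auto simp: walk_def)
  have "path_homotopic K (join_loops (join_loops p q) (to_vertex b (q 1)))
      (join_loops p (join_loops q (to_vertex b (q 1))))"
    using p q pq star ends by (intro path_homotopic_assoc to_vertex_pathin) auto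
  also have "path_homotopic K \<dots> (join_loops p (join_loops (to_vertex a (q 0)) (word_path u)))"
    using p pq ends by (intro path_homotopic_join path_homotopic_refl u) auto
  also have "path_homotopic K \<dots> (join_loops (join_loops p (to_vertex a (q 0))) (word_path u))"
    using p pq star ends u ne
    by (intro path_homotopic_assoc[THEN path_homotopic_sym] to_vertex_pathin word_path_pathin) auto
  also have "path_homotopic K \<dots> (join_loops (word_path w) (word_path u))"
    using w(4) pq u ne by (intro path_homotopic_join path_homotopic_refl word_path_pathin) auto
  also have "path_homotopic K \<dots> (word_path (w @ tl u))"
    using w u by (intro word_path_join[THEN path_homotopic_sym]) auto
  finally show ?thesis
    unfolding spelled_def using star w u ne walk_join[OF w(1) u(1)] last_join[of w u]
    by (intro exI[of _ b] exI[of _ "w @ tl u"]) simp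
qed

lemma spelled_cong:
  assumes "path_homotopic K p q" "spelled v p"
  shows "spelled v q"
proof -
  obtain a w where a: "proj (p 1) \<in> star a" and w: "walk V E w" "hd w = v" "last w = a"
    and h: "path_homotopic K (join_loops p (to_vertex a (p 1))) (word_path w)"
    using assms(2) by (auto simp: spelled_def)
  have p1: "p 1 = q 1" "p 1 \<in> topspace K"
    using path_homotopic_ends(2)[OF assms(1)] path_finish_in_topspace[OF path_homotopic_imp_pathin(1)[OF assms(1)]] by auto
  have "path_homotopic K (join_loops q (to_vertex a (p 1))) (join_loops p (to_vertex a (p 1)))"
    using p1 a
    by (intro path_homotopic_join assms(1)[THEN path_homotopic_sym] path_homotopic_refl to_vertex_pathin) auto
  also note h
  finally show ?thesis
    unfolding spelled_def using a w p1 by auto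
qed

text \<open>The set of times up to which the path is spelled contains 0, and around each time there is an interval
  on which the path stays in one member of the cover, so that being spelled passes from any time in this
  interval to any other, earlier or later. The claim follows because the unit interval is connected.\<close>

lemma spelled_path:
  assumes v: "v \<in> V" and p: "pathin K p" and p0: "p 0 = Inl (vertex_point v)"
  shows "spelled v p"
proof -
  define sub where "sub x y t = p ((1 - t) * x + t * y)" for x y t :: real
  have p': "continuous_map (top_of_set {0..1}) K p"
    using p by (simp add: pathin_def)
  have sub_factors: "factors_through {0..1} p x y (sub x y)" if "x \<in> {0..1}" "y \<in> {0..1}" for x y
    using that by (intro factors_through_subpath) (auto simp: sub_def)
  have sub_path: "pathin K (sub x y)" if "x \<in> {0..1}" "y \<in> {0..1}" for x y
    using factors_through_pathin[OF p' _ sub_factors[OF that]] by simp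
  have sub_join: "path_homotopic K (join_loops (sub 0 x) (sub x y)) (sub 0 y)" if "x \<in> {0..1}" "y \<in> {0..1}" for x y
    using factors_through_homotopic[OF p' _ factors_through_join[OF sub_factors[of 0 x] sub_factors[of x y]]
        sub_factors[of 0 y]] that by simp
  have "spelled v (sub 0 1)"
  proof (rule connected_induction_simple[of "{0..1::real}" 0 1 "\<lambda>x. spelled v (sub 0 x)"])
    have "sub 0 0 = (\<lambda>_. Inl (vertex_point v))"
      by (auto simp: sub_def p0)
    moreover have "path_homotopic K (join_loops (\<lambda>_. Inl (vertex_point v)) (to_vertex v (Inl (vertex_point v)))) (word_path [v])"
      using path_homotopic_const_right[of K "\<lambda>_. Inl (vertex_point v)"] v
      by (auto simp: to_vertex_def line_to_vertex_point push_Inl[abs_def] join_loops_def vertex_in path_homotopic_refl)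
    moreover have "vertex_point v \<in> star v"
      using v by (auto simp: star_def graph_points_def vertex_point_apply)
    ultimately show "spelled v (sub 0 0)"
      unfolding spelled_def using v by (intro exI[of _ v] exI[of _ "[v]"]) auto
  next
    fix x :: real assume x: "x \<in> {0..1}"
    then have "p x \<in> topspace K"
      using p' continuous_map_image_subset_topspace by fastforce
    then obtain U where U: "U \<in> star_cover" "p x \<in> U"
      using star_cover_covers by blast
    have "openin (top_of_set {0..1}) {t \<in> {0..1}. p t \<in> U}"
      using openin_continuous_map_preimage[OF p' openin_star_cover[OF U(1)]] by simp
    then obtain e where e: "e > 0" "\<And>t. t \<in> {0..1} \<Longrightarrow> dist t x < e \<Longrightarrow> p t \<in> U"
      using x U(2) unfolding openin_euclidean_subtopology_iff by blast
    let ?T = "{0..1} \<inter> ball x e"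
    have "spelled v (sub 0 z)" if y: "y \<in> ?T" and z: "z \<in> ?T" and s: "spelled v (sub 0 y)" for y z
    proof (rule spelled_cong[OF sub_join spelled_step[OF _ _ _ s U(1)]])
      fix t :: real assume t: "t \<in> {0..1}"
      have "convex ?T" by (intro convex_Int) auto
      from convexD_alt[OF this y z] t have "(1 - t) * y + t * z \<in> ?T" by simp
      then show "sub y z t \<in> U"
        using e(2)[of "(1 - t) * y + t * z"] by (simp add: sub_def dist_commute)
    qed (use y z sub_path in \<open>auto simp: sub_def\<close>)
    then have "\<forall>y\<in>?T. \<forall>z\<in>?T. spelled v (sub 0 y) \<longrightarrow> spelled v (sub 0 z)"
      by blast
    moreover have "openin (top_of_set {0..1}) ?T" "x \<in> ?T"
      using x e(1) by auto
    ultimately show "\<exists>T. openin (top_of_set {0..1}) T \<and> x \<in> T \<and>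
        (\<forall>y\<in>T. \<forall>z\<in>T. spelled v (sub 0 y) \<longrightarrow> spelled v (sub 0 z))"
      by (intro exI[of _ ?T] conjI)
  qed auto
  then show ?thesis
    by (rule spelled_cong[rotated]) (use sub_path[of 0 1] in \<open>auto intro!: path_homotopic_eq simp: sub_def\<close>)
qed

text \<open>The base vertex is the only vertex near itself, and the standard path from it to itself is constant.\<close>

lemma loop_homotopic_word_path:
  assumes v: "v \<in> V" and p: "pathin K p" "p 0 = Inl (vertex_point v)" "p 1 = Inl (vertex_point v)"
  obtains w where "w \<in> based_loops V E v" "path_homotopic K p (word_path w)"
proof -
  have star: "proj (p 1) \<in> star v"
    using v by (auto simp: p star_def graph_points_def vertex_point_apply)
  obtain w where w: "walk V E w" "hd w = v" "last w = v"
    "path_homotopic K (join_loops p (to_vertex v (p 1))) (word_path w)"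
    using spelled_at[OF p(1) spelled_path[OF v p(1,2)] star] by blast
  have "to_vertex v (p 1) = (\<lambda>_. Inl (vertex_point v))"
    by (auto simp: p to_vertex_def line_to_vertex_point join_loops_def)
  then have "path_homotopic K p (join_loops p (to_vertex v (p 1)))"
    using path_homotopic_const_right[OF p(1)] p(3) by (simp add: path_homotopic_sym)
  also note w(4)
  finally show ?thesis
    using that[of w] w by (simp add: based_loops_walk)
qed

end

section \<open>The isomorphism\<close>

lemma loop_homotopy_iff:
  "(g, h) \<in> loop_homotopy X x \<longleftrightarrow> g \<in> loops_at X x \<and> h \<in> loops_at X x \<and> path_homotopic X g h"
proof (cases "g \<in> loops_at X x \<and> h \<in> loops_at X x")
  case True
  then have "g 0 = x" "g 1 = x" "h 0 = x" "h 1 = x"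
    by (simp_all add: loops_at_def)
  with True show ?thesis
    by (simp add: loop_homotopy_def path_homotopic_def)
qed (auto simp: loop_homotopy_def)

lemma equiv_loop_homotopy: "equiv (loops_at X x) (loop_homotopy X x)"
proof (rule equivI)
  show "refl_on (loops_at X x) (loop_homotopy X x)"
    by (auto simp: refl_on_def loop_homotopy_iff loops_at_def path_homotopic_refl)
  show "sym (loop_homotopy X x)"
    by (auto simp: sym_def loop_homotopy_iff path_homotopic_sym)
  show "trans (loop_homotopy X x)"
    by (auto simp: trans_def loop_homotopy_iff intro: path_homotopic_trans)
qed (auto simp: loop_homotopy_iff)

lemma join_in_loops_at: "g \<in> loops_at X x \<Longrightarrow> h \<in> loops_at X x \<Longrightarrow> join_loops g h \<in> loops_at X x"
  by (simp add: loops_at_def pathin_join)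

lemma mult_fundamental_group:
  assumes "g \<in> loops_at X x" "h \<in> loops_at X x"
  shows "loop_homotopy X x `` {g} \<otimes>\<^bsub>fundamental_group X x\<^esub> loop_homotopy X x `` {h} =
    loop_homotopy X x `` {join_loops g h}"
proof -
  let ?R = "loop_homotopy X x"
  have "congruent2 ?R ?R (\<lambda>g h. ?R `` {join_loops g h})"
  proof (rule congruent2I')
    fix g g' h h' assume gh: "(g, g') \<in> ?R" "(h, h') \<in> ?R"
    then have "g 1 = h 0"
      by (simp add: loop_homotopy_iff loops_at_def)
    with gh have "(join_loops g h, join_loops g' h') \<in> ?R"
      by (simp add: loop_homotopy_iff join_in_loops_at path_homotopic_join)
    then show "?R `` {join_loops g h} = ?R `` {join_loops g' h'}"
      by (rule equiv_class_eq[OF equiv_loop_homotopy])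
  qed
  then show ?thesis
    using assms UN_equiv_class2[OF equiv_loop_homotopy equiv_loop_homotopy] by (simp add: fundamental_group_def)
qed

lemma equiv_loop_equiv: "equiv (based_loops V E v) (loop_equiv V E v step)"
proof (rule equivI)
  show "refl_on (based_loops V E v) (loop_equiv V E v step)"
    by (auto simp: refl_on_def loop_equiv_def)
  show "sym (loop_equiv V E v step)"
    by (auto simp: sym_def loop_equiv_def equivclp_sym)
  show "trans (loop_equiv V E v step)"
    by (auto simp: trans_def loop_equiv_def intro: equivclp_trans)
qed (auto simp: loop_equiv_def)

lemma join_in_based_loops:
  assumes "u \<in> based_loops V E v" "w \<in> based_loops V E v"
  shows "u @ tl w \<in> based_loops V E v"
proof -
  have "walk V E u" "walk V E w" "hd u = v" "last u = hd w" "last w = v" "u \<noteq> []" "w \<noteq> []"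
    using assms by (simp_all add: based_loops_walk walk_def)
  then show ?thesis
    using walk_join[of V E u w] last_join[of u w] by (simp add: based_loops_walk)
qed

lemma mult_circuit_group:
  assumes "u \<in> based_loops V E v" "w \<in> based_loops V E v"
  shows "loop_equiv V E v (circuit_step E B) `` {u} \<otimes>\<^bsub>circuit_group V E B v\<^esub>
      loop_equiv V E v (circuit_step E B) `` {w} = loop_equiv V E v (circuit_step E B) `` {u @ tl w}"
proof -
  define R where "R = loop_equiv V E v (circuit_step E B)"
  have eq: "equiv (based_loops V E v) R"
    unfolding R_def by (rule equiv_loop_equiv)
  have "congruent2 R R (\<lambda>u w. R `` {u @ tl w})"
  proof (rule congruent2I')
    fix u u' w w' assume "(u, u') \<in> R" "(w, w') \<in> R"
    then have "(u @ tl w, u' @ tl w') \<in> R"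
      unfolding R_def loop_equiv_def using word_equiv_join[of E B u u' w w']
      by (auto intro!: join_in_based_loops) (auto simp: based_loops_def)
    then show "R `` {u @ tl w} = R `` {u' @ tl w'}"
      by (rule equiv_class_eq[OF eq])
  qed
  then show ?thesis
    using assms UN_equiv_class2[OF eq eq]
    by (simp add: circuit_group_def loop_class_group_def flip: R_def)
qed

lemma (in circuit_complex) circuit_group_iso:
  assumes v: "v \<in> V"
  shows "circuit_group V E B v \<cong> fundamental_group K (Inl (vertex_point v))"
proof -
  let ?x = "Inl (vertex_point v) :: 'a complex_point"
  let ?L = "based_loops V E v"
  define R where "R = loop_equiv V E v (circuit_step E B)"
  define S where "S = loop_homotopy K ?x"
  define \<Phi> where "\<Phi> X = (\<Union>w\<in>X. S `` {word_path w})" for X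
  have R: "equiv ?L R" and S: "equiv (loops_at K ?x) S"
    unfolding R_def S_def by (rule equiv_loop_equiv equiv_loop_homotopy)+
  have R_iff: "(u, w) \<in> R \<longleftrightarrow> u \<in> ?L \<and> w \<in> ?L \<and> word_equiv E B u w" for u w
    by (simp add: R_def loop_equiv_def)
  have loops: "word_path w \<in> loops_at K ?x" if "w \<in> ?L" for w
    using that word_path_pathin[of w] by (auto simp: loops_at_def based_loops_walk walk_def)
  have iff: "(word_path u, word_path w) \<in> S \<longleftrightarrow> (u, w) \<in> R" if "u \<in> ?L" "w \<in> ?L" for u w
    using that loops word_path_equiv[of u w] word_equiv_if_path_homotopic[of u w]
    by (auto simp: R_iff S_def loop_homotopy_iff based_loops_walk)
  have \<Phi>: "\<Phi> (R `` {w}) = S `` {word_path w}" if "w \<in> ?L" for w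
    unfolding \<Phi>_def
  proof (rule UN_equiv_class[OF R _ that])
    show "(\<lambda>w. S `` {word_path w}) respects R"
      using iff by (auto simp: congruent_def R_iff intro!: equiv_class_eq[OF S])
  qed
  have carrier: "carrier (circuit_group V E B v) = ?L // R"
    "carrier (fundamental_group K ?x) = loops_at K ?x // S"
    by (simp_all add: circuit_group_def loop_class_group_def fundamental_group_def R_def S_def)
  have "\<Phi> \<in> hom (circuit_group V E B v) (fundamental_group K ?x)"
  proof (rule homI)
    fix X assume "X \<in> carrier (circuit_group V E B v)"
    then obtain u where "u \<in> ?L" "X = R `` {u}"
      by (auto simp: carrier elim: quotientE)
    then show "\<Phi> X \<in> carrier (fundamental_group K ?x)"
      using \<Phi> loops by (simp add: carrier quotientI)
  next
    fix X Y assume "X \<in> carrier (circuit_group V E B v)" "Y \<in> carrier (circuit_group V E B v)"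
    then obtain u w where u: "u \<in> ?L" "X = R `` {u}" and w: "w \<in> ?L" "Y = R `` {w}"
      by (auto simp: carrier elim!: quotientE)
    have "path_homotopic K (word_path (u @ tl w)) (join_loops (word_path u) (word_path w))"
      using u w by (intro word_path_join) (auto simp: based_loops_walk)
    then have "(word_path (u @ tl w), join_loops (word_path u) (word_path w)) \<in> S"
      using u w by (simp add: S_def loop_homotopy_iff loops join_in_loops_at join_in_based_loops)
    then have "S `` {word_path (u @ tl w)} = S `` {join_loops (word_path u) (word_path w)}"
      by (rule equiv_class_eq[OF S])
    then show "\<Phi> (X \<otimes>\<^bsub>circuit_group V E B v\<^esub> Y) = \<Phi> X \<otimes>\<^bsub>fundamental_group K ?x\<^esub> \<Phi> Y"
      using u w mult_circuit_group[OF u(1) w(1), of B] mult_fundamental_group[OF loops[OF u(1)] loops[OF w(1)]]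
      by (simp add: \<Phi> join_in_based_loops flip: R_def S_def)
  qed
  moreover have "inj_on \<Phi> (?L // R)"
  proof (rule inj_onI)
    fix X Y assume "X \<in> ?L // R" "Y \<in> ?L // R" and eq: "\<Phi> X = \<Phi> Y"
    then obtain u w where u: "u \<in> ?L" "X = R `` {u}" and w: "w \<in> ?L" "Y = R `` {w}"
      by (auto elim!: quotientE)
    then have "(word_path u, word_path w) \<in> S"
      using eq eq_equiv_class[OF _ S loops] \<Phi> by simp
    then show "X = Y"
      using iff u w equiv_class_eq[OF R] by simp
  qed
  moreover have "\<Phi> ` (?L // R) = loops_at K ?x // S"
  proof
    show "\<Phi> ` (?L // R) \<subseteq> loops_at K ?x // S"
      using \<Phi> loops by (auto elim!: quotientE intro!: quotientI)
    show "loops_at K ?x // S \<subseteq> \<Phi> ` (?L // R)"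
    proof
      fix Y assume "Y \<in> loops_at K ?x // S"
      then obtain p where p: "p \<in> loops_at K ?x" "Y = S `` {p}"
        by (auto elim: quotientE)
      then obtain w where w: "w \<in> ?L" "path_homotopic K p (word_path w)"
        using loop_homotopic_word_path[OF v, of p] by (auto simp: loops_at_def)
      then have "(p, word_path w) \<in> S"
        using p loops by (simp add: S_def loop_homotopy_iff)
      then have "Y = \<Phi> (R `` {w})"
        using p \<Phi> w equiv_class_eq[OF S] by simp
      then show "Y \<in> \<Phi> ` (?L // R)"
        using w by (auto intro: quotientI)
    qed
  qed
  ultimately have "\<Phi> \<in> iso (circuit_group V E B v) (fundamental_group K ?x)"
    by (simp add: iso_def bij_betw_def carrier)
  then show ?thesis
    by (auto simp: is_iso_def)
qed

lemma glmy_group_eq: "glmy_group V E v = circuit_group V E (triangles_and_squares V E) v"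
proof -
  have "loop_equiv V E v (glmy_step V E) = loop_equiv V E v (circuit_step E (triangles_and_squares V E))"
    unfolding loop_equiv_def equivclp_glmy_step ..
  then show ?thesis
    unfolding glmy_group_def circuit_group_def loop_class_group_def by (rule arg_cong)
qed

theorem corollary7p4:
  fixes V :: "'a set" and E :: "'a set set" and v :: 'a and B :: "'a list set set"
  assumes "simple_graph V E"
    and "v \<in> V"
    and "B \<subseteq> circuits V E"
  shows "(\<forall>r. (\<forall>C\<in>B. r C \<in> C) \<longrightarrow>
            circuit_group V E B v \<cong>
            fundamental_group (disc_complex V E B r) (Inl (vertex_point v))) \<and>
         (\<forall>r. (\<forall>C\<in>triangles_and_squares V E. r C \<in> C) \<longrightarrow>
            glmy_group V E v \<cong>
            fundamental_group (disc_complex V E (triangles_and_squares V E) r)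
              (Inl (vertex_point v)))"
proof -
  have iso: "circuit_group V E B' v \<cong> fundamental_group (disc_complex V E B' r) (Inl (vertex_point v))"
    if "B' \<subseteq> circuits V E" "\<forall>C\<in>B'. r C \<in> C" for B' r
  proof -
    interpret circuit_complex V E B' r
    proof
      show "simple_graph V E" by (rule assms(1))
      show "B' \<subseteq> circuits V E" by (rule that(1))
      show "r C \<in> C" if "C \<in> B'" for C
        using \<open>\<forall>C\<in>B'. r C \<in> C\<close> that by (rule bspec)
    qed
    show ?thesis
      using circuit_group_iso[OF assms(2)] by (simp add: K_def)
  qed
  have "triangles_and_squares V E \<subseteq> circuits V E"
    by (auto simp: triangles_and_squares_def circuits_def)
  then show ?thesis
    using iso assms(3) by (simp add: glmy_group_eq)
qed

end
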